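(* Let $f(z)=z^2+10^{-9}/z^3$ and $g(z)=z^2+10^{-20}/z^4$, viewed as rational maps of the Riemann sphere $\widehat{\mathbb{C}}$. Then the Julia sets $J_f$ and $J_g$ are each homeomorphic to $C\times \mathbb{S}^1$, where $C\subset\mathbb{R}$ is the middle-thirds Cantor set, but there is no quasisymmetric homeomorphism $J_f\to J_g$ (with respect to the spherical metric).
   Context: A homeomorphism $h:X\to Y$ between metric spaces is quasisymmetric if there is a homeomorphism $\eta:[0,\infty)\to[0,\infty)$ such that $|h(x)-h(a)|/|h(x)-h(b)|\le \eta(|x-a|/|x-b|)$ for all triples of distinct points $x,a,b\in X$. *)

theory Defs
  imports "HOL-Analysis.Analysis"
begin

text \<open>The Riemann sphere is modelled as complex option (None = infinity).
  Its spherical (chordal) metric is obtained by stereographic projection onto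
  the unit sphere of R^3 = C x R, carrying the Euclidean metric.\<close>

definition stereo :: "complex option \<Rightarrow> complex \<times> real" where
  "stereo z = (case z of
      None \<Rightarrow> (0, 1)
    | Some w \<Rightarrow> (2 * w / complex_of_real (1 + (cmod w)\<^sup>2),
                 ((cmod w)\<^sup>2 - 1) / ((cmod w)\<^sup>2 + 1)))"

definition rat_map :: "complex \<Rightarrow> nat \<Rightarrow> complex option \<Rightarrow> complex option" where
  "rat_map c k z = (case z of
      None \<Rightarrow> None
    | Some w \<Rightarrow> (if w = 0 then None else Some (w ^ 2 + c / w ^ k)))"

definition sph_open :: "complex option set \<Rightarrow> bool" where
  "sph_open U \<longleftrightarrow> openin (top_of_set (sphere 0 1)) (stereo ` U)"

definition sph_compact :: "complex option set \<Rightarrow> bool" where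
  "sph_compact K \<longleftrightarrow> compact (stereo ` K)"

definition normal_iterates :: "(complex option \<Rightarrow> complex option) \<Rightarrow> complex option set \<Rightarrow> bool" where
  "normal_iterates R U \<longleftrightarrow>
    (\<forall>n::nat \<Rightarrow> nat. \<exists>r g. strict_mono r \<and>
       (\<forall>K. K \<subseteq> U \<and> sph_compact K \<longrightarrow>
          (\<forall>e>0. \<forall>\<^sub>F j in sequentially. \<forall>z\<in>K.
              dist (stereo ((R ^^ n (r j)) z)) (g z) < e)))"

definition fatou :: "(complex option \<Rightarrow> complex option) \<Rightarrow> complex option set" where
  "fatou R = {z. \<exists>U. sph_open U \<and> z \<in> U \<and> normal_iterates R U}"

definition julia :: "(complex option \<Rightarrow> complex option) \<Rightarrow> complex option set" where
  "julia R = UNIV - fatou R"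

fun cantor_approx :: "nat \<Rightarrow> real set" where
  "cantor_approx 0 = {0..1}"
| "cantor_approx (Suc n) = (\<lambda>x. x / 3) ` cantor_approx n \<union> (\<lambda>x. x / 3 + 2 / 3) ` cantor_approx n"

definition cantor_set :: "real set" where
  "cantor_set = (\<Inter>n. cantor_approx n)"

definition quasisymmetric :: "'a::metric_space set \<Rightarrow> ('a \<Rightarrow> 'b::metric_space) \<Rightarrow> bool" where
  "quasisymmetric X h \<longleftrightarrow>
    (\<exists>\<eta> \<eta>'. homeomorphism {0::real..} {0..} \<eta> \<eta>' \<and>
      (\<forall>x\<in>X. \<forall>a\<in>X. \<forall>b\<in>X. x \<noteq> a \<and> x \<noteq> b \<and> a \<noteq> b \<longrightarrow>
         dist (h x) (h a) / dist (h x) (h b) \<le> \<eta> (dist x a / dist x b)))"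

end

theory Submission
  imports Defs
begin

text \<open>
  For \<open>f z = z^2 + c / z^k\<close> with small \<open>c\<close>, the preimage of a suitable annulus consists of two
  smaller annuli, covered with degrees \<open>2\<close> (outer) and \<open>k\<close> (inner, reversing orientation).
  In the coordinate \<open>\<zeta> = ln z\<close> the inverse branches are contractions \<open>G b\<close> of a vertical strip,
  close to affine maps of slope \<open>1 / 2\<close> and \<open>- 1 / k\<close>.  The functional equation
  \<open>Phi (x, t) = G b (Phi (cshift x, d * t))\<close>, with \<open>b\<close> the first ternary digit of \<open>x\<close> and \<open>d\<close> the degree
  of the branch, has a unique solution at bounded distance from \<open>\<i> * t\<close>, and \<open>exp \<circ> Phi\<close>
  parametrises the Julia set by the Cantor set times the circle.

  Quasisymmetric inequivalence is a length-area argument.  The points \<open>exp (Gw w (p0 + 2 \<pi> \<i> j))\<close>,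
  \<open>w\<close> a word of length \<open>n\<close>, are uniformly relatively separated, because compositions of inverse branches
  have bounded distortion.  A quasisymmetric map \<open>h\<close> sends them to centres of disjoint balls whose radii
  \<open>r\<close> are comparable to the distances between images of consecutive points.  Along
  each word these distances add up to at least a constant; averaging over words with Bernoulli weights and using
  Hoelder's inequality, \<open>\<Sum> r powr p\<close> tends to infinity whenever \<open>p < 1 + \<alpha>\<close> with
  \<open>2 powr - \<alpha> + 3 powr - \<alpha> = 1\<close>.  In the Julia set of \<open>g\<close>, on the other hand, a self-similar mass
  distribution bounds \<open>\<Sum> r powr p\<close> for disjoint balls as soon as \<open>p\<close> exceeds the corresponding number
  for \<open>(2, 4)\<close> by a small amount.  The exponent \<open>p = 7 / 4\<close> fits in between.
\<close>

section \<open>The chordal metric and normal families\<close>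

text \<open>The two Julia sets enter in different ways. For f only the degrees 2 and 3 matter: an
  unknown homeomorphism may change all lengths, but the number of marked points of a word is the
  modulus of its degree, and their relative separation survives a quasisymmetric map. For g the
  contraction rates matter and must be near 1/2 and 1/4; the smallness of 10^-20 provides this. If
  each of the d inverse branches of degree d gets mass d powr - p, total mass 1 reads 2 powr (1 - p)
  + 4 powr (1 - p) = 1, the equation of \<alpha> with p = 1 + \<alpha>. On the Hoelder side the best
  weights are proportional to d powr (1 - p), and they give decay exactly when 2 powr (1 - p) + 3
  powr (1 - p) > 1. Logarithms make the branches single-valued and nearly affine; the price is a
  period that has to be carried through every composition.\<close>

lemma stereo_Some: "stereo (Some w) = (2 * w / complex_of_real (1 + (cmod w)\<^sup>2), ((cmod w)\<^sup>2 - 1) / ((cmod w)\<^sup>2 + 1))"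
  by (simp add: stereo_def)

lemma stereo_None: "stereo None = (0, 1)"
  by (simp add: stereo_def)

lemma dist_stereo_Some:
  "dist (stereo (Some z)) (stereo (Some w)) = 2 * cmod (z - w) / sqrt ((1 + (cmod z)\<^sup>2) * (1 + (cmod w)\<^sup>2))"
proof -
  define N M where "N = 1 + (cmod z)\<^sup>2" and "M = 1 + (cmod w)\<^sup>2"
  have NM: "N > 0" "M > 0" by (auto simp: N_def M_def add_pos_nonneg)
  have cz: "(cmod z)\<^sup>2 = (Re z)\<^sup>2 + (Im z)\<^sup>2" "(cmod w)\<^sup>2 = (Re w)\<^sup>2 + (Im w)\<^sup>2"
    "(cmod (z - w))\<^sup>2 = (Re z - Re w)\<^sup>2 + (Im z - Im w)\<^sup>2"
    by (simp_all add: cmod_power2)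
  have 1: "(dist (2 * z / of_real N) (2 * w / of_real M))\<^sup>2
      = (2 * Re z / N - 2 * Re w / M)\<^sup>2 + (2 * Im z / N - 2 * Im w / M)\<^sup>2"
    by (simp add: dist_norm cmod_power2)
  have s: "((cmod z)\<^sup>2 - 1) / ((cmod z)\<^sup>2 + 1) = 1 - 2 / N" "((cmod w)\<^sup>2 - 1) / ((cmod w)\<^sup>2 + 1) = 1 - 2 / M"
    using NM by (simp_all add: N_def M_def divide_simps)
  have "(dist (2 * z / of_real N) (2 * w / of_real M))\<^sup>2 + (dist (1 - 2 / N) (1 - 2 / M))\<^sup>2
     = 4 * ((Re z)\<^sup>2 + (Im z)\<^sup>2 + 1) / N\<^sup>2 + 4 * ((Re w)\<^sup>2 + (Im w)\<^sup>2 + 1) / M\<^sup>2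
       - 8 * (Re z * Re w + Im z * Im w + 1) / (N * M)"
    unfolding 1 dist_real_def power2_abs
    using NM by (simp add: field_simps power2_eq_square) 
  also have "\<dots> = 4 / N + 4 / M - 8 * (Re z * Re w + Im z * Im w + 1) / (N * M)"
  proof -
    have "(Re z)\<^sup>2 + (Im z)\<^sup>2 + 1 = N" "(Re w)\<^sup>2 + (Im w)\<^sup>2 + 1 = M"
      using cz(1,2) by (simp_all add: N_def M_def)
    then show ?thesis using NM by (simp add: power2_eq_square)
  qed
  also have "\<dots> = 4 * (M + N - 2 - 2 * (Re z * Re w + Im z * Im w)) / (N * M)"
    using NM by (simp add: field_simps)
  also have "M + N - 2 - 2 * (Re z * Re w + Im z * Im w) = (cmod (z - w))\<^sup>2"
    unfolding N_def M_def cz by (simp add: power2_eq_square algebra_simps)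
  finally have *: "(dist (2 * z / of_real N) (2 * w / of_real M))\<^sup>2 + (dist (1 - 2 / N) (1 - 2 / M))\<^sup>2
    = 4 * (cmod (z - w))\<^sup>2 / (N * M)" .
  have "dist (stereo (Some z)) (stereo (Some w)) = sqrt (4 * (cmod (z - w))\<^sup>2 / (N * M))"
    unfolding stereo_Some s dist_Pair_Pair *[symmetric] by (simp add: N_def M_def)
  then show ?thesis
    by (simp add: real_sqrt_divide real_sqrt_mult N_def M_def)
qed

lemma norm_stereo_Some [simp]: "norm (stereo (Some w)) = 1"
proof -
  have p: "1 + (cmod w)\<^sup>2 > 0" by (simp add: add_pos_nonneg)
  define N where "N = 1 + (cmod w)\<^sup>2"
  have e: "(cmod w)\<^sup>2 = N - 1" by (simp add: N_def)
  have "(norm (2 * w / of_real N))\<^sup>2 = 4 * (N - 1) / N\<^sup>2"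
    using p by (simp add: norm_divide norm_mult power_divide e[symmetric] power_mult_distrib)
  moreover have "(norm (((N - 1) - 1) / ((N - 1) + 1)))\<^sup>2 = (N - 2)\<^sup>2 / N\<^sup>2"
    by (simp add: power_divide)
  moreover have "4 * (N - 1) / N\<^sup>2 + (N - 2)\<^sup>2 / N\<^sup>2 = 1"
  proof -
    have "N\<^sup>2 > 0" using p by (simp add: N_def)
    then show ?thesis by (simp add: field_simps) (simp add: power2_eq_square algebra_simps)
  qed
  ultimately show ?thesis
    unfolding stereo_Some norm_Pair e[symmetric] N_def[symmetric] by (simp add: e)
qed

lemma stereo_Some_inverse:
  assumes "norm (a, s::real) = 1" "s < 1"
  shows "stereo (Some (a / of_real (1 - s))) = (a, s)"
proof -
  have "(cmod a)\<^sup>2 + s\<^sup>2 = 1"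
    using assms(1) by (simp add: norm_Pair)
  then have a: "(cmod a)\<^sup>2 = (1 - s) * (1 + s)" by (simp add: algebra_simps power2_eq_square)
  have "(cmod (a / of_real (1 - s)))\<^sup>2 = (1 + s) / (1 - s)"
    unfolding norm_divide power_divide a norm_of_real power2_abs using assms(2) by (simp add: power2_eq_square)
  moreover from this have "1 + (cmod (a / of_real (1 - s)))\<^sup>2 = 2 / (1 - s)"
    using assms(2) by (simp add: field_simps)
  moreover have "((1 + s) / (1 - s) - 1) / ((1 + s) / (1 - s) + 1) = s"
    using assms(2) by (simp add: divide_simps)
  moreover have "2 * (a / of_real (1 - s)) / complex_of_real (2 / (1 - s)) = a"
  proof -
    have "complex_of_real (1 - s) \<noteq> 0" using assms(2) by (metis eq_iff_diff_eq_0 less_irrefl of_real_eq_0_iff)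
    then show ?thesis by (simp add: of_real_divide del: of_real_diff)
  qed
  ultimately show ?thesis unfolding stereo_Some by simp
qed

lemma snd_stereo_Some: "snd (stereo (Some w)) = 1 - 2 / (1 + (cmod w)\<^sup>2)"
  using add_pos_nonneg[of 1 "(cmod w)\<^sup>2"] by (simp add: stereo_Some divide_simps)

lemma snd_stereo_Some_less: "snd (stereo (Some w)) < 1"
  using add_pos_nonneg[of 1 "(cmod w)\<^sup>2"] by (simp add: snd_stereo_Some)

lemma dist_stereo_None: "dist (stereo (Some w)) (stereo None) = 2 / sqrt (1 + (cmod w)\<^sup>2)"
proof -
  define N where "N = 1 + (cmod w)\<^sup>2"
  have N: "N > 0" by (auto simp: N_def add_pos_nonneg)
  have s: "((cmod w)\<^sup>2 - 1) / ((cmod w)\<^sup>2 + 1) = 1 - 2 / N"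
    using N by (simp add: N_def divide_simps)
  have "(dist (2 * w / of_real N) 0)\<^sup>2 + (dist (1 - 2 / N) 1)\<^sup>2 = 4 * (N - 1) / N\<^sup>2 + 4 / N\<^sup>2"
  proof -
    have "cmod (complex_of_real N) = N" "(cmod w)\<^sup>2 = N - 1" using N by (simp_all add: N_def del: of_real_add)
    then show ?thesis by (simp add: norm_divide norm_mult power_divide power_mult_distrib dist_real_def)
  qed
  also have "\<dots> = 4 / N" using N by (simp add: field_simps power2_eq_square)
  finally show ?thesis
    unfolding stereo_None stereo_Some s dist_Pair_Pair N_def[symmetric] by (simp add: real_sqrt_divide N_def)
qed

text \<open>Stereographic projection is inverted by (a, s) -> a / (1 - s). In this form the image is
  visibly a relatively open part of the sphere when \<open>W\<close> is open, which is what
  \<open>sph_open\<close> asks for.\<close>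

lemma stereo_image_Some:
  "stereo ` Some ` W = sphere 0 1 \<inter> {x. snd x < 1 \<and> fst x / of_real (1 - snd x) \<in> W}"
proof (intro equalityI subsetI)
  fix x assume "x \<in> stereo ` Some ` W"
  then obtain w where w: "w \<in> W" "x = stereo (Some w)" by auto
  have p: "1 + (cmod w)\<^sup>2 > 0" by (simp add: add_pos_nonneg)
  then have "complex_of_real (1 + (cmod w)\<^sup>2) \<noteq> 0" by (metis less_irrefl of_real_eq_0_iff)
  then have "fst x / of_real (1 - snd x) = w"
    unfolding w(2) snd_stereo_Some by (simp add: stereo_Some of_real_divide del: of_real_add)
  then show "x \<in> sphere 0 1 \<inter> {x. snd x < 1 \<and> fst x / of_real (1 - snd x) \<in> W}"
    using w snd_stereo_Some_less by auto
next
  fix x assume "x \<in> sphere 0 1 \<inter> {x. snd x < 1 \<and> fst x / complex_of_real (1 - snd x) \<in> W}"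
  then show "x \<in> stereo ` Some ` W"
    using stereo_Some_inverse[of "fst x" "snd x"] by (force simp: image_iff)
qed

lemma sph_open_Some:
  assumes "open W" shows "sph_open (Some ` W)"
proof -
  have o: "open {x::complex \<times> real. snd x < 1}"
    by (intro open_Collect_less continuous_intros)
  have "continuous_on {x::complex \<times> real. snd x < 1} (\<lambda>x. fst x / of_real (1 - snd x))"
    by (intro continuous_intros) (auto simp flip: of_real_diff)
  from continuous_open_preimage[OF this o assms]
  have "open {x::complex \<times> real. snd x < 1 \<and> fst x / of_real (1 - snd x) \<in> W}"
    by (simp add: vimage_def Int_def)
  then show ?thesis
    unfolding sph_open_def stereo_image_Some by (simp add: openin_open_Int)
qed

lemma sph_open_outer:
  assumes "r \<ge> 0" shows "sph_open (insert None (Some ` {w. cmod w > r}))"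
proof -
  \<comment> \<open>The height of the circle of modulus \<open>r\<close> under projection; the set
    is the polar cap above it.\<close>
  define s where "s = 1 - 2 / (1 + r\<^sup>2)"
  have s1: "s < 1" using add_pos_nonneg[of 1 "r\<^sup>2"] by (simp add: s_def)
  have *: "s < snd (stereo (Some w)) \<longleftrightarrow> r < cmod w" for w
  proof -
    have "1 + r\<^sup>2 > 0" "1 + (cmod w)\<^sup>2 > 0" by (auto simp: add_pos_nonneg)
    then have "s < snd (stereo (Some w)) \<longleftrightarrow> r\<^sup>2 < (cmod w)\<^sup>2"
      by (simp add: s_def snd_stereo_Some divide_simps) (simp add: algebra_simps)
    then show ?thesis using assms by (simp add: power_strict_mono power_less_imp_less_base[of r 2] iffI)
  qed
  have "stereo ` insert None (Some ` {w. cmod w > r}) = sphere 0 1 \<inter> {x. s < snd x}"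
  proof (intro equalityI subsetI)
    fix x assume "x \<in> stereo ` insert None (Some ` {w. cmod w > r})"
    then show "x \<in> sphere 0 1 \<inter> {x. s < snd x}" using * s1 by (auto simp: stereo_None norm_Pair)
  next
    fix x :: "complex \<times> real" assume x: "x \<in> sphere 0 1 \<inter> {x. s < snd x}"
    obtain a t where at: "x = (a, t)" by (cases x)
    have n: "(cmod a)\<^sup>2 + t\<^sup>2 = 1" using x by (simp add: at norm_Pair)
    then have "t\<^sup>2 \<le> 1" by (smt (verit) zero_le_power2)
    then have "t \<le> 1" by (simp add: power2_le_iff_abs_le abs_square_le_1)
    then consider "t = 1" | "t < 1" by linarith
    then show "x \<in> stereo ` insert None (Some ` {w. cmod w > r})"
    proof cases
      case 1
      then have "a = 0" using n by simp
      then show ?thesis using 1 at by (simp add: stereo_None)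
    next
      case 2
      have e: "stereo (Some (a / of_real (1 - t))) = x"
        unfolding at by (rule stereo_Some_inverse) (use x 2 at in auto)
      then have "r < cmod (a / of_real (1 - t))" using x unfolding *[symmetric] by simp
      then show ?thesis using e by blast
    qed
  qed
  moreover have "open {x::complex \<times> real. s < snd x}" by (intro open_Collect_less continuous_intros)
  ultimately show ?thesis
    unfolding sph_open_def by (simp add: openin_open_Int)
qed

lemma inj_stereo: "inj stereo"
proof (rule injI)
  fix x y assume e: "stereo x = stereo y"
  then have d: "dist (stereo x) (stereo y) = 0" by simp
  have p: "1 + (cmod w)\<^sup>2 > 0" for w by (simp add: add_pos_nonneg)
  have q: "0 \<noteq> 2 / sqrt (1 + (cmod w)\<^sup>2)" for w using p[of w] by simp
  show "x = y"
  proof (cases x; cases y)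
    fix a b assume "x = Some a" "y = Some b"
    then show ?thesis using d p[of a] p[of b] by (auto simp: dist_stereo_Some add_nonneg_eq_0_iff)
  next
    fix a assume "x = Some a" "y = None"
    then show ?thesis using d q[of a] by (simp add: dist_stereo_None)
  next
    fix a assume "x = None" "y = Some a"
    then show ?thesis using d q[of a] by (simp only: dist_stereo_None dist_commute[of "stereo None"])
  qed simp
qed

lemma dist_stereo_le: "dist (stereo (Some z)) (stereo (Some w)) \<le> 2 * cmod (z - w)"
proof -
  have "1 * 1 \<le> (1 + (cmod z)\<^sup>2) * (1 + (cmod w)\<^sup>2)" by (intro mult_mono) auto
  then have "1 \<le> sqrt ((1 + (cmod z)\<^sup>2) * (1 + (cmod w)\<^sup>2))" by simp
  then show ?thesis unfolding dist_stereo_Some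
    by (metis divide_le_eq_1 div_by_1 frac_le le_numeral_extra(1,4) mult_nonneg_nonneg norm_ge_zero order_refl zero_le_numeral zero_less_one)
qed

lemma dist_stereo_ge:
  assumes "cmod z \<le> r" "cmod w \<le> r"
  shows "2 / (1 + r\<^sup>2) * cmod (z - w) \<le> dist (stereo (Some z)) (stereo (Some w))"
proof -
  have p: "1 + (cmod w)\<^sup>2 > 0" for w by (simp add: add_pos_nonneg)
  have "(1 + (cmod z)\<^sup>2) * (1 + (cmod w)\<^sup>2) \<le> (1 + r\<^sup>2) * (1 + r\<^sup>2)"
    using assms p by (intro mult_mono) (auto simp: power_mono less_imp_le)
  then have "sqrt ((1 + (cmod z)\<^sup>2) * (1 + (cmod w)\<^sup>2)) \<le> sqrt ((1 + r\<^sup>2)\<^sup>2)"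
    by (simp only: power2_eq_square[of "1 + r\<^sup>2"] real_sqrt_le_iff)
  then have "sqrt ((1 + (cmod z)\<^sup>2) * (1 + (cmod w)\<^sup>2)) \<le> 1 + r\<^sup>2"
    by (metis abs_of_pos add_pos_nonneg less_numeral_extra(1) real_sqrt_abs zero_le_power2)
  moreover have "0 < sqrt ((1 + (cmod z)\<^sup>2) * (1 + (cmod w)\<^sup>2))" using p by simp
  moreover have "0 < 1 + r\<^sup>2" by (simp add: add_pos_nonneg)
  ultimately have "2 * cmod (z - w) / (1 + r\<^sup>2) \<le> dist (stereo (Some z)) (stereo (Some w))"
    unfolding dist_stereo_Some by (intro divide_left_mono mult_pos_pos) auto
  then show ?thesis by simp
qed


text \<open>The index sequence in \<open>normal_iterates\<close> is arbitrary and need not grow. If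
  it takes one value infinitely often, a constant subsequence converges trivially; otherwise it
  tends to infinity, and the uniform convergence to \<open>P\<close> applies.\<close>

lemma normal_iteratesI:
  assumes "\<And>e. e > 0 \<Longrightarrow> \<exists>n0. \<forall>n\<ge>n0. \<forall>x\<in>U. dist (stereo ((R ^^ n) x)) P < e"
  shows "normal_iterates R U"
  unfolding normal_iterates_def
proof
  fix n :: "nat \<Rightarrow> nat"
  show "\<exists>r g. strict_mono r \<and>
       (\<forall>K. K \<subseteq> U \<and> sph_compact K \<longrightarrow> (\<forall>e>0. \<forall>\<^sub>F j in sequentially. \<forall>z\<in>K.
              dist (stereo ((R ^^ n (r j)) z)) (g z) < e))"
  proof (cases "\<exists>v. infinite {j. n j = v}")
    case True
    then obtain v where v: "infinite {j. n j = v}" by blast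
    from infinite_enumerate[OF v] obtain r :: "nat \<Rightarrow> nat" where "strict_mono r" "\<forall>j. r j \<in> {j. n j = v}" by auto
    then show ?thesis by (intro exI[of _ r] exI[of _ "\<lambda>z. stereo ((R ^^ v) z)"]) auto
  next
    case False
    have "\<forall>\<^sub>F j in sequentially. n0 \<le> n j" for n0
    proof -
      have "finite (\<Union>v\<in>{..<n0}. {j. n j = v})" using False by auto
      moreover have "{j. \<not> n0 \<le> n j} = (\<Union>v\<in>{..<n0}. {j. n j = v})" by auto
      ultimately show ?thesis by (simp add: eventually_cofinite flip: cofinite_eq_sequentially)
    qed
    then have *: "\<exists>j0. \<forall>j\<ge>j0. n0 \<le> n j" for n0 by (simp add: eventually_sequentially)
    have "\<forall>\<^sub>F j in sequentially. \<forall>z\<in>K. dist (stereo ((R ^^ n j) z)) P < e" if "K \<subseteq> U" "e > 0" for K e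
    proof -
      obtain n0 where n0: "\<forall>n\<ge>n0. \<forall>x\<in>U. dist (stereo ((R ^^ n) x)) P < e" using assms \<open>e > 0\<close> by blast
      obtain j0 where "\<forall>j\<ge>j0. n0 \<le> n j" using * by blast
      then show ?thesis unfolding eventually_sequentially using n0 that(1) by blast
    qed
    then show ?thesis
      by (intro exI[of _ id] exI[of _ "\<lambda>z. P"]) (simp add: strict_mono_id)
  qed
qed

section \<open>Inverse branches in logarithmic coordinates\<close>

text \<open>Dividing the map by its dominant term leaves a factor 1 + exp \<xi>, where exp \<xi> is
  the quotient of the two terms. If Re \<xi> \<le> ln W < 0, this factor lies in the right
  half-plane, so the principal logarithm is holomorphic there.\<close>

definition log1p_exp :: "complex \<Rightarrow> complex" where
  "log1p_exp \<xi> = Ln (1 + exp \<xi>)"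

context
  fixes W :: real
  assumes W: "0 < W" "W < 1"
begin

lemma norm_exp_le_W: "Re \<xi> \<le> ln W \<Longrightarrow> cmod (exp \<xi>) \<le> W"
  using W by (metis exp_le_cancel_iff exp_ln norm_exp_eq_Re)

lemma one_plus_exp_Re: "Re \<xi> \<le> ln W \<Longrightarrow> Re (1 + exp \<xi>) > 0"
  using norm_exp_le_W[of \<xi>] W abs_Re_le_cmod[of "exp \<xi>"] by (simp del: Re_exp norm_exp_eq_Re)

lemma one_plus_exp_ge: "Re \<xi> \<le> ln W \<Longrightarrow> cmod (1 + exp \<xi>) \<ge> 1 - W"
  using norm_exp_le_W[of \<xi>] norm_diff_ineq[of 1 "exp \<xi>"] by (simp del: norm_exp_eq_Re)

lemma one_plus_exp_neq_0: "Re \<xi> \<le> ln W \<Longrightarrow> 1 + exp \<xi> \<noteq> 0"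
  using one_plus_exp_Re[of \<xi>] by force

lemma exp_log1p_exp: "Re \<xi> \<le> ln W \<Longrightarrow> exp (log1p_exp \<xi>) = 1 + exp \<xi>"
  using one_plus_exp_neq_0 by (simp add: log1p_exp_def)

lemma Re_log1p_exp: 
  assumes "Re \<xi> \<le> ln W" shows "Re (log1p_exp \<xi>) \<le> ln (1 + W)"
proof -
  have "exp (Re (log1p_exp \<xi>)) = cmod (1 + exp \<xi>)"
    using exp_log1p_exp[OF assms] by (metis norm_exp_eq_Re)
  also have "\<dots> \<le> 1 + W"
    using norm_exp_le_W[OF assms] norm_triangle_ineq[of 1 "exp \<xi>"] by (simp del: norm_exp_eq_Re)
  finally show ?thesis using W by (simp add: ln_ge_iff)
qed

lemma log1p_exp_deriv:
  assumes "Re \<xi> \<le> ln W"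
  shows "(log1p_exp has_field_derivative (1 - 1 / (1 + exp \<xi>))) (at \<xi> within X)"
proof -
  have "1 + exp \<xi> \<notin> \<real>\<^sub>\<le>\<^sub>0"
    using one_plus_exp_Re[OF assms] by (auto simp: complex_nonpos_Reals_iff simp del: Re_exp)
  then have "((\<lambda>\<xi>. Ln (1 + exp \<xi>)) has_field_derivative (exp \<xi> / (1 + exp \<xi>))) (at \<xi> within X)"
    by (auto intro!: derivative_eq_intros simp: divide_inverse mult.commute)
  moreover have "exp \<xi> / (1 + exp \<xi>) = 1 - 1 / (1 + exp \<xi>)"
    using one_plus_exp_neq_0[OF assms] by (simp add: field_simps)
  ultimately show ?thesis unfolding log1p_exp_def[abs_def] by simp
qed

lemma log1p_exp_lipschitz:
  assumes "Re x \<le> ln W" "Re y \<le> ln W"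
  shows "cmod (log1p_exp x - log1p_exp y) \<le> W / (1 - W) * cmod (x - y)"
proof (rule field_differentiable_bound[where S = "{z. Re z \<le> ln W}"])
  fix z :: complex assume "z \<in> {z. Re z \<le> ln W}"
  then have z: "Re z \<le> ln W" by simp
  show "(log1p_exp has_field_derivative (1 - 1 / (1 + exp z))) (at z within {z. Re z \<le> ln W})"
    by (rule log1p_exp_deriv[OF z])
  have "1 - 1 / (1 + exp z) = exp z / (1 + exp z)"
    using one_plus_exp_neq_0[OF z] by (simp add: field_simps)
  then show "cmod (1 - 1 / (1 + exp z)) \<le> W / (1 - W)"
    using norm_exp_le_W[OF z] one_plus_exp_ge[OF z] W
    by (simp add: norm_divide frac_le del: norm_exp_eq_Re)
qed (use assms in \<open>auto simp: convex_halfspace_Re_le\<close>)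

text \<open>The mean value inequality is applied twice: to the derivative, and then to the function
  minus its linear part. This quadratic remainder is the source of all distortion bounds.\<close>

lemma log1p_exp_taylor:
  assumes x: "Re x \<le> ln W" and y: "Re y \<le> ln W"
  shows "cmod (log1p_exp y - log1p_exp x - (1 - 1 / (1 + exp x)) * (y - x)) \<le> 1 / (1 - W)\<^sup>2 * (cmod (y - x))\<^sup>2"
proof -
  have lip: "cmod ((1 - 1 / (1 + exp z)) - (1 - 1 / (1 + exp x))) \<le> 1 / (1 - W)\<^sup>2 * cmod (z - x)"
    if "Re z \<le> ln W" for z
  proof (rule field_differentiable_bound[where S = "{z. Re z \<le> ln W}"])
    fix z :: complex assume "z \<in> {z. Re z \<le> ln W}"
    then have z: "Re z \<le> ln W" by simp
    show "((\<lambda>z. 1 - 1 / (1 + exp z)) has_field_derivative (exp z / (1 + exp z)\<^sup>2)) (at z within {z. Re z \<le> ln W})"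
      using one_plus_exp_neq_0[OF z] by (auto intro!: derivative_eq_intros simp: power2_eq_square)
    show "cmod (exp z / (1 + exp z)\<^sup>2) \<le> 1 / (1 - W)\<^sup>2"
      using norm_exp_le_W[OF z] one_plus_exp_ge[OF z] W
      by (simp add: norm_divide norm_power frac_le power_mono del: norm_exp_eq_Re)
  qed (use x that in \<open>auto simp: convex_halfspace_Re_le\<close>)
  define g where "g z = log1p_exp z - (1 - 1 / (1 + exp x)) * z" for z
  have "cmod (g y - g x) \<le> (1 / (1 - W)\<^sup>2 * cmod (y - x)) * cmod (y - x)"
  proof (rule field_differentiable_bound[where S = "closed_segment x y"])
    fix z assume z: "z \<in> closed_segment x y"
    have "closed_segment x y \<subseteq> {z. Re z \<le> ln W}"
      using x y by (intro closed_segment_subset) (auto simp: convex_halfspace_Re_le)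
    then have Rz: "Re z \<le> ln W" using z by auto
    show "(g has_field_derivative ((1 - 1 / (1 + exp z)) - (1 - 1 / (1 + exp x)))) (at z within closed_segment x y)"
      unfolding g_def[abs_def] by (rule derivative_eq_intros log1p_exp_deriv[OF Rz] refl | simp)+
    have "cmod (z - x) \<le> cmod (y - x)" using z by (rule segment_bound1)
    then show "cmod ((1 - 1 / (1 + exp z)) - (1 - 1 / (1 + exp x))) \<le> 1 / (1 - W)\<^sup>2 * cmod (y - x)"
      by (intro order_trans[OF lip[OF Rz]] mult_left_mono) auto
  qed auto
  moreover have "g y - g x = log1p_exp y - log1p_exp x - (1 - 1 / (1 + exp x)) * (y - x)"
    by (simp add: g_def right_diff_distrib)
  ultimately show ?thesis by (simp add: power2_eq_square mult.assoc)
qed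

end

section \<open>Period translations of the logarithm\<close>

definition per :: "int \<Rightarrow> complex" where
  "per m = 2 * of_real pi * \<i> * of_int m"

lemma per_simps [simp]: "Re (per m) = 0" "Im (per m) = 2 * pi * of_int m" "per 0 = 0"
  by (simp_all add: per_def)

lemma per_add: "per (m + n) = per m + per n" and per_diff: "per (m - n) = per m - per n"
  and per_minus: "per (- m) = - per m"
  by (simp_all add: per_def algebra_simps)

lemma norm_per: "cmod (per m) = 2 * pi * \<bar>of_int m\<bar>"
  by (simp add: per_def norm_mult)

lemma exp_per [simp]: "exp (\<eta> + per m) = exp \<eta>"
  by (subst exp_eq) (auto simp: per_def intro!: exI[of _ m])

lemma exp_eq_per: "exp x = exp y \<longleftrightarrow> (\<exists>m. x = y + per m)"
  unfolding exp_eq by (auto simp: per_def mult_ac)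

text \<open>
  \<open>U\<close> and \<open>V\<close> bound \<open>c / z ^ (k + 2)\<close> for \<open>cmod z \<ge> s1\<close> and its inverse for \<open>cmod z \<le> s2\<close>, that is, the relative
  size of the smaller term of the map; \<open>l1\<close> and \<open>l2\<close> are the resulting Lipschitz constants of the
  inverse branches.  Points of modulus between \<open>s2\<close> and \<open>s1\<close> leave the annulus.
\<close>

locale mcmullen =
  fixes c :: real and k :: nat and ra rb s1 s2 U V l1 l2 :: real
  assumes c_pos: "0 < c" and k_pos: "0 < k" and ra_pos: "0 < ra" and s2_pos: "0 < s2" and s2_s1: "s2 < s1" and ra_rb: "ra < rb"
    and outer: "11 / 10 + c / rb ^ (k + 1) \<le> rb" and rb_pos: "0 < rb"
    and inner: "rb + ra\<^sup>2 < c / ra ^ k"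
    and middle: "\<And>x. s2 < x \<Longrightarrow> x < s1 \<Longrightarrow> x\<^sup>2 + c / x ^ k < ra"
    and U: "c \<le> U * s1 ^ (k + 2)" "U < 1" and V: "s2 ^ (k + 2) \<le> V * c" "V < 1"
    and map1: "s1\<^sup>2 * (1 + U) \<le> ra" and map2: "c * (1 + V) \<le> ra * s2 ^ k"
    and l1: "1 \<le> l1 * (2 - real (k + 2) * (U / (1 - U)))" "0 < l1" "l1 < 1"
    and l2: "1 \<le> l2 * (real k - real (k + 2) * (V / (1 - V)))" "0 < l2" "l2 < 1"
begin

definition f :: "complex \<Rightarrow> complex" where "f z = z\<^sup>2 + of_real c / z ^ k"
definition annulus :: "complex set" where "annulus = {z. ra \<le> cmod z \<and> cmod z \<le> rb}"
definition strip :: "complex set" where "strip = {\<zeta>. ln ra \<le> Re \<zeta> \<and> Re \<zeta> \<le> ln rb}"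

text \<open>The outer branch is indexed by \<open>True\<close>; the sign of \<open>dg\<close> records orientation.\<close>

definition dg :: "bool \<Rightarrow> int" where "dg b = (if b then 2 else - int k)"
definition off :: "bool \<Rightarrow> complex" where "off b = (if b then 0 else of_real (ln c))"
definition pert :: "bool \<Rightarrow> complex \<Rightarrow> complex" where
  "pert b \<zeta> = (if b then of_real (ln c) - of_nat (k + 2) * \<zeta> else of_nat (k + 2) * \<zeta> - of_real (ln c))"
definition W :: "bool \<Rightarrow> real" where "W b = (if b then U else V)"
definition ll :: "bool \<Rightarrow> real" where "ll b = (if b then l1 else l2)"
definition dom :: "bool \<Rightarrow> complex set" where
  "dom b = (if b then {\<zeta>. ln s1 \<le> Re \<zeta>} else {\<zeta>. Re \<zeta> \<le> ln s2})"
text \<open>The lift of \<open>f\<close> through \<open>exp\<close> on \<open>dom b\<close>: the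
  dominant monomial, z^2 or c / z^k, becomes the affine part, and \<open>pert b \<zeta>\<close> is
  the logarithm of the other monomial divided by it.\<close>

definition F :: "bool \<Rightarrow> complex \<Rightarrow> complex" where
  "F b \<zeta> = of_int (dg b) * \<zeta> + off b + log1p_exp (pert b \<zeta>)"

lemma s1_pos: "0 < s1" using s2_pos s2_s1 by simp

lemma W: "0 < W b" "W b < 1"
proof -
  have "0 < U * s1 ^ (k + 2)" using U c_pos by linarith
  moreover have "0 < V * c" using V s2_pos zero_less_power[of s2 "k + 2"] by linarith
  ultimately have "0 < U * s1 ^ (k + 2)" "0 < V * c" by auto
  then have "0 < U" "0 < V" using zero_less_mult_pos2[of U "s1 ^ (k + 2)"] zero_less_mult_pos2[of V c] s1_pos c_pos zero_less_power by blast+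
  then show "0 < W b" "W b < 1" using U V by (auto simp: W_def)
qed

lemma ll: "0 < ll b" "ll b < 1" 
  "1 \<le> ll b * (\<bar>of_int (dg b)\<bar> - real (k + 2) * (W b / (1 - W b)))"
  using l1 l2 by (auto simp: ll_def dg_def W_def)

lemma strip_iff: "exp \<zeta> \<in> annulus \<longleftrightarrow> \<zeta> \<in> strip"
proof -
  have "ra \<le> exp (Re \<zeta>) \<longleftrightarrow> ln ra \<le> Re \<zeta>" "exp (Re \<zeta>) \<le> rb \<longleftrightarrow> Re \<zeta> \<le> ln rb"
    using ra_pos rb_pos by (metis exp_le_cancel_iff exp_ln)+
  then show ?thesis by (simp add: annulus_def strip_def)
qed

lemma pert_dom:
  assumes "\<zeta> \<in> dom b" shows "Re (pert b \<zeta>) \<le> ln (W b)"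
proof (cases b)
  case True
  have "ln c \<le> ln (U * s1 ^ (k + 2))" using U c_pos by simp
  also have "\<dots> = ln U + real (k + 2) * ln s1"
    using W[of True] s1_pos ln_realpow[of s1 "k + 2"] by (subst ln_mult_pos) (auto simp: W_def simp del: power_add power_Suc)
  also have "\<dots> \<le> ln U + real (k + 2) * Re \<zeta>"
    using assms True by (auto simp: dom_def intro!: mult_left_mono)
  finally show ?thesis using True by (simp add: pert_def W_def)
next
  case False
  have "real (k + 2) * Re \<zeta> \<le> real (k + 2) * ln s2"
    using assms False by (auto simp: dom_def intro!: mult_left_mono)
  also have "\<dots> = ln (s2 ^ (k + 2))" using ln_realpow[of s2 "k + 2"] by (simp del: power_add power_Suc)
  also have "\<dots> \<le> ln (V * c)" using V(1) zero_less_power[OF s2_pos, of "k + 2"] by (metis ln_mono)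
  also have "\<dots> = ln V + ln c" using W[of False] c_pos by (subst ln_mult_pos) (auto simp: W_def)
  finally show ?thesis using False by (simp add: pert_def W_def)
qed

lemma exp_F:
  assumes "\<zeta> \<in> dom b" shows "exp (F b \<zeta>) = f (exp \<zeta>)"
proof -
  have ec: "exp (complex_of_real (ln c)) = of_real c" using c_pos by (simp add: exp_of_real)
  have e: "exp (F b \<zeta>) = exp (of_int (dg b) * \<zeta>) * exp (off b) * (1 + exp (pert b \<zeta>))"
    unfolding F_def exp_add exp_log1p_exp[OF W pert_dom[OF assms]] by simp
  have "exp (of_nat (k + 2) * \<zeta>) = exp \<zeta> ^ k * (exp \<zeta>)\<^sup>2"
    by (simp only: exp_of_nat_mult power_add)
  moreover have "exp (of_nat k * \<zeta>) = exp \<zeta> ^ k" "exp (2 * \<zeta>) = (exp \<zeta>)\<^sup>2"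
    by (simp_all add: exp_of_nat_mult exp_double)
  ultimately show ?thesis
    unfolding e pert_def dg_def off_def f_def
    using c_pos by (auto simp: exp_diff exp_minus ec field_simps power2_eq_square simp del: of_nat_add exp_of_real)
qed

lemma pert_diff: "cmod (pert b x - pert b y) = real (k + 2) * cmod (x - y)"
proof -
  have "pert b x - pert b y = (if b then - 1 else 1) * of_nat (k + 2) * (x - y)"
    by (simp add: pert_def algebra_simps)
  then show ?thesis by (simp only: norm_mult norm_of_nat) simp
qed

lemma closed_dom: "closed (dom b)"
  by (auto simp: dom_def closed_halfspace_Re_le closed_halfspace_Re_ge)

lemma log1p_pert_lip:
  assumes "x \<in> dom b" "y \<in> dom b"
  shows "cmod (log1p_exp (pert b x) - log1p_exp (pert b y)) \<le> real (k + 2) * (W b / (1 - W b)) * cmod (x - y)"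
  using log1p_exp_lipschitz[OF W pert_dom[OF assms(1)] pert_dom[OF assms(2)]]
  by (simp add: pert_diff mult_ac)

text \<open>The affine part expands by |dg b| and the perturbation has Lipschitz constant (k + 2) W
  / (1 - W). The assumptions on \<open>l1\<close> and \<open>l2\<close> say that the difference is
  at least 1 / ll b, so an inverse of \<open>F b\<close> contracts by \<open>ll b\<close>.\<close>

lemma F_expand:
  assumes "x \<in> dom b" "y \<in> dom b"
  shows "cmod (x - y) \<le> ll b * cmod (F b x - F b y)"
proof -
  define q where "q = real (k + 2) * (W b / (1 - W b))"
  have "F b x - F b y = of_int (dg b) * (x - y) + (log1p_exp (pert b x) - log1p_exp (pert b y))"
    by (simp add: F_def algebra_simps)
  then have "\<bar>of_int (dg b)\<bar> * cmod (x - y) - q * cmod (x - y) \<le> cmod (F b x - F b y)"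
    using norm_diff_ineq[of "of_int (dg b) * (x - y)" "log1p_exp (pert b x) - log1p_exp (pert b y)"]
      log1p_pert_lip[OF assms] by (simp add: norm_mult q_def)
  then have "ll b * ((\<bar>of_int (dg b)\<bar> - q) * cmod (x - y)) \<le> ll b * cmod (F b x - F b y)"
    using ll[of b] by (intro mult_left_mono) (auto simp: algebra_simps)
  moreover have "1 * cmod (x - y) \<le> (ll b * (\<bar>of_int (dg b)\<bar> - q)) * cmod (x - y)"
    using ll(3)[of b] by (intro mult_right_mono) (auto simp: q_def)
  ultimately show ?thesis by (simp add: mult_ac)
qed

text \<open>A crude expansion bound: by \<open>kap_less\<close> the perturbation contributes less
  than |dg b|, so the total is below 2 |dg b|, and |dg b| is 2 or k.\<close>

definition Lup :: real where "Lup = 2 * (real k + 2)"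

lemma kap_less: "real (k + 2) * (W b / (1 - W b)) < \<bar>of_int (dg b)\<bar>"
proof -
  have "0 < ll b * (\<bar>of_int (dg b)\<bar> - real (k + 2) * (W b / (1 - W b)))"
    using ll(3)[of b] by linarith
  then show ?thesis using ll(1)[of b] by (simp add: zero_less_mult_iff)
qed

lemma F_upper:
  assumes "x \<in> dom b" "y \<in> dom b"
  shows "cmod (F b x - F b y) \<le> Lup * cmod (x - y)"
proof -
  define q where "q = real (k + 2) * (W b / (1 - W b))"
  have "F b x - F b y = of_int (dg b) * (x - y) + (log1p_exp (pert b x) - log1p_exp (pert b y))"
    by (simp add: F_def algebra_simps)
  then have "cmod (F b x - F b y) \<le> \<bar>of_int (dg b)\<bar> * cmod (x - y) + q * cmod (x - y)"
    using norm_triangle_ineq[of "of_int (dg b) * (x - y)" "log1p_exp (pert b x) - log1p_exp (pert b y)"]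
      log1p_pert_lip[OF assms] by (simp add: norm_mult q_def)
  also have "\<dots> = (\<bar>of_int (dg b)\<bar> + q) * cmod (x - y)" by (simp add: algebra_simps)
  also have "\<dots> \<le> Lup * cmod (x - y)"
    using kap_less[of b] by (intro mult_right_mono) (auto simp: q_def Lup_def dg_def split: if_splits)
  finally show ?thesis .
qed

lemma F_periodic: "F b (\<zeta> + per m) = F b \<zeta> + per (dg b * m)"
proof -
  have "exp (pert b (\<zeta> + per m)) = exp (pert b \<zeta>)"
  proof (subst exp_eq, intro exI)
    show "pert b (\<zeta> + per m) = pert b \<zeta>
      + of_real (of_int (2 * (if b then - (int (k + 2) * m) else int (k + 2) * m)) * pi) * \<i>"
      by (simp add: pert_def per_def algebra_simps)
  qed
  then show ?thesis by (simp add: F_def log1p_exp_def per_def algebra_simps)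
qed

section \<open>Escape from the annulus\<close>

lemma esc_out:
  assumes "cmod z \<ge> rb" shows "11 / 10 * cmod z \<le> cmod (f z)"
proof -
  have z: "cmod z > 0" using assms rb_pos by linarith
  have "c / cmod z ^ (k + 1) \<le> c / rb ^ (k + 1)"
    using assms rb_pos c_pos z by (intro divide_left_mono power_mono) auto
  then have "11 / 10 + c / cmod z ^ (k + 1) \<le> cmod z" using outer assms by linarith
  then have "cmod z * (11 / 10 + c / cmod z ^ (k + 1)) \<le> cmod z * cmod z"
    using z by (intro mult_left_mono) auto
  then have "11 / 10 * cmod z \<le> (cmod z)\<^sup>2 - c / cmod z ^ k"
    using z by (simp add: field_simps power2_eq_square)
  also have "\<dots> \<le> cmod (f z)"
    using norm_diff_ineq[of "z\<^sup>2" "of_real c / z ^ k"] c_pos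
    by (simp add: f_def norm_power norm_divide)
  finally show ?thesis .
qed

lemma esc_in:
  assumes "cmod z \<le> ra" "z \<noteq> 0" shows "rb < cmod (f z)"
proof -
  have z: "cmod z > 0" using assms by simp
  have "c / ra ^ k \<le> c / cmod z ^ k"
  proof (rule divide_left_mono)
    show "cmod z ^ k \<le> ra ^ k" using assms by (intro power_mono) auto
    show "0 < ra ^ k * cmod z ^ k" using z ra_pos by simp
  qed (use c_pos in auto)
  moreover have "(cmod z)\<^sup>2 \<le> ra\<^sup>2" using assms by (intro power_mono) auto
  ultimately have "rb < c / cmod z ^ k - (cmod z)\<^sup>2" using inner by linarith
  also have "\<dots> \<le> cmod (f z)"
    using norm_diff_ineq[of "of_real c / z ^ k" "z\<^sup>2"] c_pos
    by (simp add: f_def norm_power norm_divide add.commute)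
  finally show ?thesis .
qed

lemma esc_middle:
  assumes "s2 < cmod z" "cmod z < s1" shows "cmod (f z) < ra"
  using norm_triangle_ineq[of "z\<^sup>2" "of_real c / z ^ k"] middle[OF assms] c_pos
  by (simp add: f_def norm_power norm_divide)

lemma f_annulus_dest:
  assumes "f z \<in> annulus" "z \<noteq> 0" shows "z \<in> annulus"
proof -
  have "\<not> cmod z \<le> ra" using esc_in[of z] assms by (auto simp: annulus_def)
  moreover have "cmod z \<le> rb"
    using esc_out[of z] assms rb_pos by (cases "cmod z \<le> rb") (auto simp: annulus_def)
  ultimately show ?thesis by (simp add: annulus_def)
qed

text \<open>Solving \<open>F b \<zeta> = \<eta>\<close> for the \<zeta> of the affine part gives a
  fixed point equation for \<open>h\<close>, which is a contraction of \<open>dom b\<close>.\<close>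

lemma F_surj:
  assumes \<eta>: "\<eta> \<in> strip" shows "\<exists>\<zeta>\<in>dom b. F b \<zeta> = \<eta>"
proof -
  define q where "q = real (k + 2) * (W b / (1 - W b))"
  define h where "h \<zeta> = (\<eta> - off b - log1p_exp (pert b \<zeta>)) / of_int (dg b)" for \<zeta>
  have d0: "dg b \<noteq> 0" using k_pos by (auto simp: dg_def)
  have "\<exists>!x\<in>dom b. h x = x"
  proof (rule Banach_fix)
    show "complete (dom b)" using closed_dom by (simp add: complete_eq_closed)
    show "dom b \<noteq> {}" by (cases b) (auto simp: dom_def intro: exI[of _ "of_real (ln s1)"] exI[of _ "of_real (ln s2)"])
    \<comment> \<open>Invariance is decided at the extreme values Re \<eta> = ln ra and ln (1 + W b)
      of the correction; \<open>map1\<close> and \<open>map2\<close> are the resulting inequalities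
      before taking logarithms.\<close>
    show "h ` dom b \<subseteq> dom b"
    proof (intro image_subsetI)
      fix \<zeta> assume \<zeta>: "\<zeta> \<in> dom b"
      have R: "Re (log1p_exp (pert b \<zeta>)) \<le> ln (1 + W b)" by (rule Re_log1p_exp[OF W pert_dom[OF \<zeta>]])
      have E: "ln ra \<le> Re \<eta>" using \<eta> by (simp add: strip_def)
      show "h \<zeta> \<in> dom b"
      proof (cases b)
        case True
        have "2 * ln s1 + ln (1 + U) = ln (s1\<^sup>2 * (1 + U))"
          using s1_pos W[of True] by (subst ln_mult_pos) (auto simp: W_def ln_realpow)
        also have "\<dots> \<le> ln ra"
          using map1 s1_pos W[of True] ra_pos by (subst ln_le_cancel_iff) (auto simp: W_def)
        finally show ?thesis using True R E by (simp add: dom_def h_def dg_def off_def W_def)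
      next
        case False
        have "ln c + ln (1 + V) = ln (c * (1 + V))"
          using c_pos W[of False] by (subst ln_mult_pos) (auto simp: W_def)
        also have "\<dots> \<le> ln (ra * s2 ^ k)"
          using map2 s2_pos c_pos W[of False] ra_pos by (subst ln_le_cancel_iff) (auto simp: W_def)
        also have "\<dots> = ln ra + real k * ln s2"
          using s2_pos ra_pos by (subst ln_mult_pos) (auto simp: ln_realpow)
        finally have "ln c + ln (1 + V) \<le> ln ra + real k * ln s2" .
        moreover have "Re (h \<zeta>) = (ln c + Re (log1p_exp (pert b \<zeta>)) - Re \<eta>) / real k"
        proof -
          have "h \<zeta> = (of_real (ln c) + log1p_exp (pert b \<zeta>) - \<eta>) / of_real (real k)"
            using False k_pos by (simp add: h_def dg_def off_def field_simps)
          then show ?thesis by (simp only: Re_divide_of_real) simp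
        qed
        ultimately have "Re (h \<zeta>) \<le> ln s2"
          using False R E k_pos by (simp add: W_def pos_divide_le_eq mult.commute)
        then show ?thesis using False by (simp add: dom_def)
      qed
    qed
    show "0 \<le> q / \<bar>of_int (dg b)\<bar>" using W[of b] by (simp add: q_def)
    show "q / \<bar>of_int (dg b)\<bar> < 1" using kap_less[of b] d0 by (subst divide_less_eq_1_pos) (simp_all add: q_def)
    fix x y assume xy: "x \<in> dom b" "y \<in> dom b"
    have "h x - h y = (log1p_exp (pert b y) - log1p_exp (pert b x)) / of_int (dg b)"
      by (simp add: h_def diff_divide_distrib)
    then have "dist (h x) (h y) = cmod (log1p_exp (pert b y) - log1p_exp (pert b x)) / \<bar>of_int (dg b)\<bar>"
      by (simp add: dist_norm norm_divide)
    also have "\<dots> \<le> q * cmod (y - x) / \<bar>of_int (dg b)\<bar>"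
      using log1p_pert_lip[OF xy(2,1)] by (intro divide_right_mono) (auto simp: q_def)
    finally show "dist (h x) (h y) \<le> q / \<bar>of_int (dg b)\<bar> * dist x y"
      by (simp add: dist_norm norm_minus_commute)
  qed
  then obtain \<zeta> where \<zeta>: "\<zeta> \<in> dom b" "h \<zeta> = \<zeta>" by blast
  have "of_int (dg b) * h \<zeta> = \<eta> - off b - log1p_exp (pert b \<zeta>)" using d0 by (simp add: h_def)
  then have "F b \<zeta> = \<eta>" unfolding \<zeta>(2) by (simp add: F_def)
  then show ?thesis using \<zeta>(1) by blast
qed

section \<open>The inverse branches\<close>

definition G :: "bool \<Rightarrow> complex \<Rightarrow> complex" where
  "G b \<eta> = (SOME \<zeta>. \<zeta> \<in> dom b \<and> F b \<zeta> = \<eta>)"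

lemma G: assumes "\<eta> \<in> strip" shows "G b \<eta> \<in> dom b" "F b (G b \<eta>) = \<eta>"
  using someI_ex[of "\<lambda>\<zeta>. \<zeta> \<in> dom b \<and> F b \<zeta> = \<eta>"] F_surj[OF assms, of b] unfolding G_def by auto

lemma G_unique: 
  assumes "\<eta> \<in> strip" "\<zeta> \<in> dom b" "F b \<zeta> = \<eta>" shows "G b \<eta> = \<zeta>"
  using F_expand[OF G(1)[OF assms(1)] assms(2)] G(2)[OF assms(1), of b] assms(3) by simp

lemma exp_G: "\<eta> \<in> strip \<Longrightarrow> f (exp (G b \<eta>)) = exp \<eta>"
  using exp_F[OF G(1)] G(2) by metis

lemma G_strip: "\<eta> \<in> strip \<Longrightarrow> G b \<eta> \<in> strip"
  using f_annulus_dest[of "exp (G b \<eta>)"] exp_G[of \<eta> b] by (simp add: strip_iff)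

lemma G_lip: "x \<in> strip \<Longrightarrow> y \<in> strip \<Longrightarrow> cmod (G b x - G b y) \<le> ll b * cmod (x - y)"
  using F_expand[OF G(1) G(1)] G(2) by metis

lemma G_low: "x \<in> strip \<Longrightarrow> y \<in> strip \<Longrightarrow> cmod (x - y) \<le> Lup * cmod (G b x - G b y)"
  using F_upper[OF G(1) G(1)] G(2) by metis

lemma strip_per [simp]: "\<eta> + per m \<in> strip \<longleftrightarrow> \<eta> \<in> strip"
  by (simp add: strip_def)

lemma dom_per [simp]: "\<eta> + per m \<in> dom b \<longleftrightarrow> \<eta> \<in> dom b"
  by (simp add: dom_def)

text \<open>The branch wraps |dg b| times around the annulus: that many periods in the argument make
  one period in the preimage, and arguments shifted by 0, ..., |dg b| - 1 periods give the different
  preimages.\<close>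

lemma G_per: "\<eta> \<in> strip \<Longrightarrow> G b (\<eta> + per (dg b * m)) = G b \<eta> + per m"
  by (rule G_unique) (simp_all add: G F_periodic)

lemma gap: "x \<in> strip \<Longrightarrow> y \<in> strip \<Longrightarrow> b \<noteq> b' \<Longrightarrow> ln s1 - ln s2 \<le> cmod (G b x - G b' y)"
  using G(1)[of x b] G(1)[of y b'] abs_Re_le_cmod[of "G b x - G b' y"]
  by (cases b; cases b') (auto simp: dom_def)

text \<open>By \<open>esc_middle\<close> a point whose image lies in the annulus has modulus at
  least \<open>s1\<close> or at most \<open>s2\<close>, so its logarithm is in one of the two
  domains on which \<open>F b\<close> lifts \<open>f\<close>.\<close>

lemma preimage:
  assumes "z \<in> annulus" "f z \<in> annulus"
  obtains b \<eta> where "\<eta> \<in> strip" "exp \<eta> = f z" "z = exp (G b \<eta>)"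
proof -
  have z0: "z \<noteq> 0" using assms(1) ra_pos by (auto simp: annulus_def)
  define b where "b \<longleftrightarrow> cmod z \<ge> s1"
  have "s1 \<le> cmod z \<or> cmod z \<le> s2"
    using esc_middle[of z] assms(2) by (force simp: annulus_def)
  then have d: "Ln z \<in> dom b"
    using z0 s1_pos s2_pos by (auto simp: dom_def b_def)
  have e: "exp (F b (Ln z)) = f z" using exp_F[OF d] z0 by simp
  have s: "F b (Ln z) \<in> strip" using e assms(2) strip_iff by metis
  have "G b (F b (Ln z)) = Ln z" by (rule G_unique[OF s d refl])
  then show ?thesis using that[OF s e, of b] z0 by simp
qed

definition Mdist :: real where
  "Mdist = (\<Sum>b\<in>UNIV. (real (k + 2))\<^sup>2 / (1 - W b)\<^sup>2 * ll b)"

lemma Mdist_nonneg: "0 \<le> Mdist"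
  unfolding Mdist_def using ll by (intro sum_nonneg) (auto simp: less_imp_le)

text \<open>One branch changes the ratio |x - z| / |x - y| at most by a factor 1 + O(|x - y| + |x -
  z|). Avoiding quotients covers coinciding points. \<open>Mdist\<close> dominates the second-order
  constant of \<open>F b\<close> times \<open>ll b\<close> for both branches.\<close>

lemma G_distortion:
  assumes S: "x \<in> strip" "y \<in> strip" "z \<in> strip"
  shows "cmod (G b x - G b z) * cmod (x - y)
    \<le> (1 + Mdist * (cmod (x - y) + cmod (x - z))) * (cmod (G b x - G b y) * cmod (x - z))"
proof -
  define x' y' z' where "x' = G b x" and "y' = G b y" and "z' = G b z"
  have D: "x' \<in> dom b" "y' \<in> dom b" "z' \<in> dom b" using G(1) S by (auto simp: x'_def y'_def z'_def)
  have FF: "F b x' = x" "F b y' = y" "F b z' = z" using G(2) S by (auto simp: x'_def y'_def z'_def)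
  define p where "p = (if b then - 1 else (1::complex)) * of_nat (k + 2)"
  \<comment> \<open>The derivative of \<open>F b\<close> at \<open>x'\<close>.\<close>
  define A where "A = of_int (dg b) + (1 - 1 / (1 + exp (pert b x'))) * p"
  define B where "B = (real (k + 2))\<^sup>2 / (1 - W b)\<^sup>2"
  have B0: "B \<ge> 0" by (simp add: B_def)
  have T: "cmod (F b v - x - A * (v - x')) \<le> B * (cmod (v - x'))\<^sup>2" if v: "v \<in> dom b" for v
  proof -
    have "pert b v - pert b x' = p * (v - x')" by (simp add: pert_def p_def algebra_simps)
    moreover have "F b v - x - A * (v - x') = log1p_exp (pert b v) - log1p_exp (pert b x') - (1 - 1 / (1 + exp (pert b x'))) * (p * (v - x'))"
      unfolding FF(1)[symmetric] F_def A_def by (simp add: algebra_simps)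
    ultimately have "F b v - x - A * (v - x') = log1p_exp (pert b v) - log1p_exp (pert b x') - (1 - 1 / (1 + exp (pert b x'))) * (pert b v - pert b x')"
      by simp
    then have "cmod (F b v - x - A * (v - x')) \<le> 1 / (1 - W b)\<^sup>2 * (cmod (pert b v - pert b x'))\<^sup>2"
      using log1p_exp_taylor[OF W pert_dom[OF D(1)] pert_dom[OF v]] by simp
    then show ?thesis by (simp add: pert_diff power_mult_distrib B_def)
  qed
  let ?Y = "cmod (x' - y')" and ?Z = "cmod (x' - z')"
  have y: "cmod (x - y) \<le> (cmod A + B * ?Y) * ?Y"
  proof -
    have "cmod (y - x) \<le> cmod (A * (y' - x')) + cmod (y - x - A * (y' - x'))"
      using norm_triangle_ineq[of "A * (y' - x')" "y - x - A * (y' - x')"] by simp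
    also have "\<dots> \<le> cmod A * cmod (y' - x') + B * (cmod (y' - x'))\<^sup>2"
      using T[OF D(2)] FF by (simp add: norm_mult)
    finally show ?thesis by (simp add: norm_minus_commute distrib_right power2_eq_square mult.assoc)
  qed
  have z: "cmod A * ?Z \<le> cmod (x - z) + B * ?Z\<^sup>2"
  proof -
    have "cmod (A * (z' - x')) \<le> cmod (z - x) + cmod (z - x - A * (z' - x'))"
      using norm_triangle_ineq4[of "z - x" "z - x - A * (z' - x')"] by simp
    also have "\<dots> \<le> cmod (z - x) + B * (cmod (z' - x'))\<^sup>2"
      using T[OF D(3)] FF by simp
    finally show ?thesis by (simp add: norm_mult norm_minus_commute)
  qed
  have YZ: "?Y \<le> cmod (x - y)" "?Z \<le> ll b * cmod (x - z)" "?Z \<le> cmod (x - z)"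
    using G_lip[OF S(1,2), of b] G_lip[OF S(1,3), of b] ll(2)[of b]
      mult_right_mono[of "ll b" 1 "cmod (x - y)"] mult_right_mono[of "ll b" 1 "cmod (x - z)"]
    by (auto simp: x'_def y'_def z'_def)
  have BM: "B * ll b \<le> Mdist"
    using ll[of True] ll[of False] unfolding Mdist_def B_def UNIV_bool by (cases b) (auto simp: less_imp_le)
  have "?Z * cmod (x - y) \<le> ?Z * ((cmod A + B * ?Y) * ?Y)"
    by (intro mult_left_mono y) auto
  also have "\<dots> = ?Y * (cmod A * ?Z) + B * ?Z * ?Y\<^sup>2" by (simp add: algebra_simps power2_eq_square)
  \<comment> \<open>Both estimates contain the unknown \<open>cmod A\<close>; inserting
    \<open>z\<close> eliminates it.\<close>
  also have "\<dots> \<le> ?Y * (cmod (x - z) + B * ?Z\<^sup>2) + B * ?Z * ?Y\<^sup>2"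
    by (intro add_right_mono mult_left_mono z) auto
  also have "\<dots> = ?Y * (cmod (x - z) + B * ?Z * (?Z + ?Y))"
    by (simp add: algebra_simps power2_eq_square)
  also have "\<dots> \<le> ?Y * (cmod (x - z) + B * (ll b * cmod (x - z)) * (cmod (x - z) + cmod (x - y)))"
    using YZ B0 ll(1)[of b] by (intro mult_left_mono add_left_mono mult_mono add_mono) (auto simp: less_imp_le)
  also have "\<dots> = ?Y * (cmod (x - z) + (B * ll b) * (cmod (x - z) * (cmod (x - z) + cmod (x - y))))"
    by (simp add: algebra_simps)
  also have "\<dots> \<le> ?Y * (cmod (x - z) + Mdist * (cmod (x - z) * (cmod (x - z) + cmod (x - y))))"
    by (intro mult_left_mono add_left_mono mult_right_mono BM) auto
  finally show ?thesis by (simp add: x'_def y'_def z'_def algebra_simps)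
qed

end

section \<open>The Julia set as the set of non-escaping points\<close>

context mcmullen begin

fun Gw :: "bool list \<Rightarrow> complex \<Rightarrow> complex" where
  "Gw [] \<eta> = \<eta>"
| "Gw (b # w) \<eta> = G b (Gw w \<eta>)"

definition dw :: "bool list \<Rightarrow> int" where "dw w = prod_list (map dg w)"
definition Lw :: "bool list \<Rightarrow> real" where "Lw w = prod_list (map ll w)"
definition lam :: real where "lam = max l1 l2"

lemma lam: "0 < lam" "lam < 1" "ll b \<le> lam"
  using l1 l2 by (auto simp: lam_def ll_def)

lemma Gw_append: "Gw (v @ w) \<eta> = Gw v (Gw w \<eta>)"
  by (induction v) auto

lemma Gw_strip: "\<eta> \<in> strip \<Longrightarrow> Gw w \<eta> \<in> strip"
  by (induction w) (auto simp: G_strip)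

lemma Lw_pos: "0 < Lw w"
  by (induction w) (auto simp: Lw_def ll)

lemma Lw_le: "Lw w \<le> lam ^ length w"
  using lam ll Lw_pos by (induction w) (auto simp: Lw_def intro!: mult_mono intro: less_imp_le)

lemma Gw_lip: "x \<in> strip \<Longrightarrow> y \<in> strip \<Longrightarrow> cmod (Gw w x - Gw w y) \<le> Lw w * cmod (x - y)"
proof (induction w)
  case Nil
  then show ?case by (simp add: Lw_def)
next
  case (Cons b w)
  have "cmod (Gw (b # w) x - Gw (b # w) y) \<le> ll b * cmod (Gw w x - Gw w y)"
    using Cons by (simp add: G_lip Gw_strip)
  also have "\<dots> \<le> ll b * (Lw w * cmod (x - y))"
    using Cons ll(1)[of b] by (intro mult_left_mono) auto
  finally show ?case by (simp add: Lw_def mult_ac)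
qed

lemma Gw_lip_lam: 
  assumes "x \<in> strip" "y \<in> strip" shows "cmod (Gw w x - Gw w y) \<le> lam ^ length w * cmod (x - y)"
  using Gw_lip[OF assms, of w] mult_right_mono[OF Lw_le[of w], of "cmod (x - y)"] by simp

lemma dw_Cons [simp]: "dw (b # w) = dg b * dw w" and dw_Nil [simp]: "dw [] = 1"
  by (simp_all add: dw_def)

lemma Gw_per: "\<eta> \<in> strip \<Longrightarrow> Gw w (\<eta> + per (dw w * m)) = Gw w \<eta> + per m"
proof (induction w arbitrary: m)
  case (Cons b w)
  have "Gw w (\<eta> + per (dw w * (dg b * m))) = Gw w \<eta> + per (dg b * m)"
    using Cons by simp
  then have "Gw (b # w) (\<eta> + per (dw (b # w) * m)) = G b (Gw w \<eta> + per (dg b * m))"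
    by (simp add: mult_ac)
  then show ?case using G_per[OF Gw_strip[OF Cons.prems]] by simp
qed simp

lemma convex_strip: "convex strip"
proof -
  have "strip = {z. ln ra \<le> Re z} \<inter> {z. Re z \<le> ln rb}" by (auto simp: strip_def)
  then show ?thesis by (simp add: convex_Int convex_halfspace_Re_le convex_halfspace_Re_ge)
qed

lemma norm_exp_strip: "x \<in> strip \<Longrightarrow> cmod (exp x) \<le> rb" "x \<in> strip \<Longrightarrow> ra \<le> cmod (exp x)"
  using strip_iff[of x] by (auto simp: annulus_def)

lemma exp_lip: 
  assumes "x \<in> strip" "y \<in> strip" shows "cmod (exp x - exp y) \<le> rb * cmod (x - y)"
  by (rule field_differentiable_bound[OF convex_strip _ _ assms, where f' = exp])
    (auto intro!: derivative_eq_intros norm_exp_strip simp del: norm_exp_eq_Re)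

definition Kinf :: "complex set" where "Kinf = {z. \<forall>n. (f ^^ n) z \<in> annulus}"

lemma Kinf_annulus: "z \<in> Kinf \<Longrightarrow> z \<in> annulus"
  unfolding Kinf_def by (metis funpow_0 mem_Collect_eq)

lemma annulus_neq_0: "z \<in> annulus \<Longrightarrow> z \<noteq> 0"
  using ra_pos by (auto simp: annulus_def)

lemma Kinf_f: "z \<in> Kinf \<Longrightarrow> f z \<in> Kinf"
  unfolding Kinf_def by (auto simp flip: funpow_swap1 funpow.simps(2)[unfolded o_def])
     (metis comp_apply funpow.simps(2) funpow_swap1)

lemma KinfI: 
  assumes "z \<noteq> 0" "f z \<in> Kinf" shows "z \<in> Kinf"
proof -
  have a: "z \<in> annulus" using f_annulus_dest[OF Kinf_annulus] assms by blast
  have "(f ^^ n) z \<in> annulus" for n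
  proof (cases n)
    case (Suc m)
    then have "(f ^^ n) z = (f ^^ m) (f z)" by (simp add: funpow_swap1)
    then show ?thesis using assms(2) by (simp add: Kinf_def)
  qed (use a in simp)
  then show ?thesis by (simp add: Kinf_def)
qed

lemma Kinf_G: "\<eta> \<in> strip \<Longrightarrow> exp \<eta> \<in> Kinf \<Longrightarrow> exp (G b \<eta>) \<in> Kinf"
  by (rule KinfI) (auto simp: exp_G)

lemma Kinf_Gw: "\<eta> \<in> strip \<Longrightarrow> exp \<eta> \<in> Kinf \<Longrightarrow> exp (Gw w \<eta>) \<in> Kinf"
  by (induction w) (auto simp: Kinf_G Gw_strip)

lemma Kinf_preimage:
  assumes "z \<in> Kinf"
  obtains b \<eta> where "\<eta> \<in> strip" "exp \<eta> = f z" "z = exp (G b \<eta>)"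
  using preimage[OF Kinf_annulus[OF assms] Kinf_annulus[OF Kinf_f[OF assms]]] by blast

lemma Kinf_rep:
  assumes "z \<in> Kinf"
  shows "\<exists>w \<eta>. length w = n \<and> \<eta> \<in> strip \<and> exp \<eta> \<in> Kinf \<and> z = exp (Gw w \<eta>)"
  using assms
proof (induction n arbitrary: z)
  case 0
  have "exp (Ln z) = z" using annulus_neq_0[OF Kinf_annulus[OF 0]] by simp
  then show ?case using 0 strip_iff[of "Ln z"] Kinf_annulus[OF 0] by (intro exI[of _ "[]"] exI[of _ "Ln z"]) auto
next
  case (Suc n)
  obtain b \<eta>1 where 1: "\<eta>1 \<in> strip" "exp \<eta>1 = f z" "z = exp (G b \<eta>1)"
    using Kinf_preimage[OF Suc.prems] by blast
  obtain w \<eta> where 2: "length w = n" "\<eta> \<in> strip" "exp \<eta> \<in> Kinf" "f z = exp (Gw w \<eta>)"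
    using Suc.IH[OF Kinf_f[OF Suc.prems]] by blast
  \<comment> \<open>Two logarithms of \<open>f z\<close> differ by a period, which
    \<open>Gw_per\<close> absorbs into the argument of the word.\<close>
  obtain m where "\<eta>1 = Gw w \<eta> + per m" using 1(2) 2(4) exp_eq_per by metis
  then have "\<eta>1 = Gw w (\<eta> + per (dw w * m))" using Gw_per[OF 2(2)] by simp
  then have "z = exp (Gw (b # w) (\<eta> + per (dw w * m)))" using 1(3) by simp
  moreover have "length (b # w) = Suc n" "\<eta> + per (dw w * m) \<in> strip" "exp (\<eta> + per (dw w * m)) \<in> Kinf"
    using 2(1-3) by simp_all
  ultimately show ?case by blast
qed

abbreviation R :: "complex option \<Rightarrow> complex option" where "R \<equiv> rat_map (of_real c) k"

lemma R_Some: "z \<noteq> 0 \<Longrightarrow> R (Some z) = Some (f z)"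
  by (simp add: rat_map_def f_def)

section \<open>Attraction to infinity and the Fatou set\<close>

definition outside :: "complex option set" where "outside = insert None (Some ` {w. rb < cmod w})"

lemma R_None [simp]: "R None = None" by (simp add: rat_map_def)

lemma funpow_R_None [simp]: "(R ^^ n) None = None" by (induction n) auto

lemma R_outside: 
  assumes "x \<in> outside" "(R ^^ n) x = Some w" shows "(11 / 10) ^ n * rb < cmod w"
  using assms(2)
proof (induction n arbitrary: w)
  case 0
  then show ?case using assms(1) by (auto simp: outside_def)
next
  case (Suc n)
  then obtain v where v: "(R ^^ n) x = Some v" by (cases "(R ^^ n) x") auto
  have lt: "(11 / 10) ^ n * rb < cmod v" by (rule Suc.IH[OF v])
  moreover have "1 * rb \<le> (11 / 10) ^ n * rb" using rb_pos by (intro mult_right_mono) auto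
  ultimately have "rb \<le> cmod v" by simp
  moreover from this have "v \<noteq> 0" using rb_pos by auto
  ultimately have "w = f v" "11 / 10 * cmod v \<le> cmod (f v)" 
    using Suc.prems v R_Some[of v] esc_out[of v] by auto
  then show ?case using lt by simp
qed

lemma funpow_R_outside: "x \<in> outside \<Longrightarrow> (R ^^ n) x \<in> outside"
proof (cases "(R ^^ n) x")
  case (Some w)
  assume "x \<in> outside"
  have "1 * rb \<le> (11 / 10) ^ n * rb" using rb_pos by (intro mult_right_mono) auto
  then show ?thesis using R_outside[OF \<open>x \<in> outside\<close> Some] Some by (auto simp: outside_def)
qed (simp add: outside_def)

lemma outside_attracted:
  assumes "e > 0"
  shows "\<exists>N. \<forall>n\<ge>N. \<forall>x\<in>outside. dist (stereo ((R ^^ n) x)) (stereo None) < e"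
proof -
  obtain N where N: "2 / (e * rb) < (11 / 10 :: real) ^ N" using real_arch_pow[of "11/10" "2 / (e * rb)"] by auto
  have "dist (stereo ((R ^^ n) x)) (stereo None) < e" if "n \<ge> N" "x \<in> outside" for n x
  proof (cases "(R ^^ n) x")
    case None
    then show ?thesis using assms by simp
  next
    case (Some w)
    have "2 / (e * rb) < (11 / 10) ^ n" using N power_increasing[OF that(1), of "11/10 :: real"] by linarith
    then have "2 / e < (11 / 10) ^ n * rb" using rb_pos assms by (simp add: field_simps)
    then have w: "2 / e < cmod w" using R_outside[OF that(2) Some] by simp
    moreover have "0 < 2 / e" using assms by simp
    ultimately have w0: "0 < cmod w" by linarith
    have "dist (stereo ((R ^^ n) x)) (stereo None) = 2 / sqrt (1 + (cmod w)\<^sup>2)"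
      by (simp add: Some dist_stereo_None)
    also have "\<dots> \<le> 2 / cmod w"
    proof (intro divide_left_mono)
      show "cmod w \<le> sqrt (1 + (cmod w)\<^sup>2)" by (rule real_le_rsqrt) simp
      show "0 < sqrt (1 + (cmod w)\<^sup>2) * cmod w" using w0 by (simp add: add_pos_nonneg)
    qed simp
    also have "\<dots> < e" using w w0 assms by (simp add: field_simps)
    finally show ?thesis .
  qed
  then show ?thesis by blast
qed

lemma normal_if_escapes:
  assumes "\<And>x. x \<in> X \<Longrightarrow> (R ^^ n0) x \<in> outside"
  shows "normal_iterates R X"
proof (rule normal_iteratesI)
  fix e :: real assume "e > 0"
  then obtain N where N: "\<forall>n\<ge>N. \<forall>x\<in>outside. dist (stereo ((R ^^ n) x)) (stereo None) < e"
    using outside_attracted by blast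
  show "\<exists>n0. \<forall>n\<ge>n0. \<forall>x\<in>X. dist (stereo ((R ^^ n) x)) (stereo None) < e"
  proof (intro exI allI impI ballI)
    fix n x assume n: "n \<ge> N + n0" and x: "x \<in> X"
    have "(R ^^ n) x = (R ^^ (n - n0)) ((R ^^ n0) x)"
      using n by (metis add_leD2 funpow_add comp_apply le_add_diff_inverse2)
    then show "dist (stereo ((R ^^ n) x)) (stereo None) < e"
      using N assms[OF x] n by simp
  qed
qed

text \<open>Written with open conditions, so that openness follows by induction. Removing 0 keeps
  the pole out of the preimage: \<open>f 0 = 0\<close> by the convention for division, whereas
  \<open>R\<close> sends 0 to infinity. The point 0 itself is covered by the inner disc.\<close>

fun esc_set :: "nat \<Rightarrow> complex set" where
  "esc_set 0 = {z. cmod z < ra \<or> rb < cmod z}"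
| "esc_set (Suc n) = {z. cmod z < ra \<or> rb < cmod z} \<union> (- {0} \<inter> f -` esc_set n)"

lemma continuous_on_f: "continuous_on (- {0}) f"
  unfolding f_def[abs_def] by (intro continuous_intros) auto

lemma tendsto_f: "(v \<longlongrightarrow> a) X \<Longrightarrow> a \<noteq> 0 \<Longrightarrow> ((\<lambda>n. f (v n)) \<longlongrightarrow> f a) X"
  unfolding f_def by (intro tendsto_intros) auto

lemma open_esc_set: "open (esc_set n)"
proof (induction n)
  case 0
  have "esc_set 0 = {z. cmod z < ra} \<union> {z. rb < cmod z}" by auto
  then show ?case by (simp del: esc_set.simps add: open_Un open_Collect_less continuous_intros)
next
  case (Suc n)
  have "open (- {0} \<inter> f -` esc_set n)"
    by (rule continuous_open_preimage[OF continuous_on_f _ Suc]) auto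
  moreover have "open ({z::complex. cmod z < ra} \<union> {z. rb < cmod z})"
    by (simp add: open_Un open_Collect_less continuous_intros)
  ultimately show ?case by (simp add: open_Un Collect_disj_eq)
qed

text \<open>The one extra iterate is for the inner disc: \<open>esc_in\<close> throws it beyond
  \<open>rb\<close>, and 0 goes to infinity.\<close>

lemma esc_set_outside: "z \<in> esc_set n \<Longrightarrow> (R ^^ Suc n) (Some z) \<in> outside"
proof (induction n arbitrary: z)
  have 0: "R (Some z) \<in> outside" if "cmod z < ra \<or> rb < cmod z" for z
  proof (cases "rb < cmod z")
    case True
    then have "Some z \<in> outside" by (auto simp: outside_def)
    then show ?thesis using funpow_R_outside[of "Some z" 1] by simp
  next
    case False
    then show ?thesis using that esc_in[of z] R_Some[of z] 
      by (cases "z = 0") (auto simp: outside_def rat_map_def)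
  qed
  {
    case 0
    then show ?case using \<open>\<And>z. cmod z < ra \<or> rb < cmod z \<Longrightarrow> R (Some z) \<in> outside\<close> by simp
  next
    case (Suc n)
    show ?case
    proof (cases "cmod z < ra \<or> rb < cmod z")
      case True
      then have "R (Some z) \<in> outside" using 0 by blast
      then have "(R ^^ Suc n) (R (Some z)) \<in> outside" by (rule funpow_R_outside)
      then show ?thesis by (simp only: funpow_Suc_right comp_apply)
    next
      case False
      then have "z \<noteq> 0" "f z \<in> esc_set n" using Suc.prems by auto
      then have "(R ^^ Suc n) (R (Some z)) \<in> outside" using Suc.IH R_Some by simp
      then show ?thesis by (simp only: funpow_Suc_right comp_apply)
    qed
  }
qed

lemma not_Kinf_esc: "z \<notin> Kinf \<Longrightarrow> \<exists>n. z \<in> esc_set n"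
proof -
  have "\<exists>m. z \<in> esc_set m" if "(f ^^ n) z \<notin> annulus" for n z
    using that
  proof (induction n arbitrary: z)
    case 0
    then show ?case by (intro exI[of _ 0]) (auto simp: annulus_def)
  next
    case (Suc n)
    then have "(f ^^ n) (f z) \<notin> annulus" by (simp add: funpow_swap1)
    then obtain m where "f z \<in> esc_set m" using Suc.IH by blast
    then have "z \<in> esc_set (Suc m)" using ra_pos by (cases "z = 0") auto
    then show ?case by blast
  qed
  then show "z \<notin> Kinf \<Longrightarrow> \<exists>n. z \<in> esc_set n" by (auto simp: Kinf_def)
qed

lemma fatou_superset: "- Some ` Kinf \<subseteq> fatou R"
proof
  fix x assume x: "x \<in> - Some ` Kinf"
  show "x \<in> fatou R"
  proof (cases x)
    case None
    have "sph_open outside" unfolding outside_def using rb_pos by (intro sph_open_outer) simp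
    moreover have "normal_iterates R outside" by (rule normal_if_escapes[of _ 0]) simp
    moreover have "x \<in> outside" using None by (simp add: outside_def)
    ultimately show ?thesis unfolding fatou_def by blast
  next
    case (Some z)
    then obtain n where n: "z \<in> esc_set n" using x not_Kinf_esc by blast
    have "normal_iterates R (Some ` esc_set n)"
      by (rule normal_if_escapes[of _ "Suc n"]) (use esc_set_outside in blast)
    then show ?thesis unfolding fatou_def using sph_open_Some[OF open_esc_set] n Some by blast
  qed
qed

section \<open>Instability on the non-escaping set\<close>

definition mid :: "complex \<Rightarrow> complex" where "mid \<eta> = Complex (ln ((s1 + s2) / 2)) (Im \<eta>)"

lemma s_bounds: "ra \<le> s2" "s1 \<le> rb"
proof -
  have s: "of_real (ln ra) \<in> strip" using ra_pos ra_rb rb_pos by (simp add: strip_def)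
  have "ln s1 \<le> ln rb" using G(1)[OF s, of True] G_strip[OF s, of True] by (simp add: dom_def strip_def)
  then show "s1 \<le> rb" using s1_pos rb_pos by simp
  have "ln ra \<le> ln s2" using G(1)[OF s, of False] G_strip[OF s, of False] by (simp add: dom_def strip_def)
  then show "ra \<le> s2" using s2_pos ra_pos by simp
qed

lemma mid_strip: "mid \<eta> \<in> strip"
  using s_bounds s2_s1 s2_pos ra_pos rb_pos by (simp add: strip_def mid_def)

lemma mid_dist: assumes "\<eta> \<in> strip" shows "cmod (mid \<eta> - \<eta>) \<le> ln rb - ln ra"
proof -
  have "mid \<eta> - \<eta> = of_real (ln ((s1 + s2) / 2) - Re \<eta>)" by (simp add: mid_def complex_eq_iff)
  then have "cmod (mid \<eta> - \<eta>) = \<bar>Re (mid \<eta>) - Re \<eta>\<bar>" by (simp add: mid_def flip: of_real_diff)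
  then show ?thesis using assms mid_strip[of \<eta>] by (simp add: strip_def abs_le_iff)
qed

lemma mid_escapes: "exp (mid \<eta>) \<in> esc_set 1"
proof -
  have "s2 < cmod (exp (mid \<eta>))" "cmod (exp (mid \<eta>)) < s1"
    using s2_s1 s2_pos by (simp_all add: mid_def)
  then show ?thesis using esc_middle[of "exp (mid \<eta>)"] by simp
qed

lemma funpow_R_exp_Gw: "\<eta> \<in> strip \<Longrightarrow> (R ^^ length w) (Some (exp (Gw w \<eta>))) = Some (exp \<eta>)"
proof (induction w)
  case (Cons b w)
  have "R (Some (exp (Gw (b # w) \<eta>))) = Some (exp (Gw w \<eta>))"
    using Cons.prems by (simp add: R_Some exp_G Gw_strip)
  then show ?case using Cons by (simp add: funpow_swap1)
qed simp

text \<open>The points \<open>y n\<close> follow the first n branches of z and then land on the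
  circle of modulus (s1 + s2) / 2, between the two preimage annuli, from where two more steps lead
  outside. So each \<open>y n\<close> is attracted to infinity although the \<open>y n\<close>
  converge to z. Normality would force one fixed iterate \<open>r J\<close> to be close to infinity
  at all late \<open>y n\<close>, hence at z, whose orbit is bounded.\<close>

lemma Kinf_not_fatou:
  assumes z: "z \<in> Kinf" shows "Some z \<notin> fatou R"
proof
  assume "Some z \<in> fatou R"
  then obtain X where X: "sph_open X" "Some z \<in> X" "normal_iterates R X" by (auto simp: fatou_def)
  have "\<exists>w \<eta>. length w = n \<and> \<eta> \<in> strip \<and> z = exp (Gw w \<eta>)" for n using Kinf_rep[OF z] by blast
  then obtain w \<eta> where w: "length (w n) = n" "\<eta> n \<in> strip" "z = exp (Gw (w n) (\<eta> n))" for n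
    by metis
  define y where "y n = exp (Gw (w n) (mid (\<eta> n)))" for n
  have ylim: "y \<longlonglongrightarrow> z"
  proof (rule Lim_null_comparison[where g = "\<lambda>n. rb * (lam ^ n * (ln rb - ln ra))", THEN LIM_zero_cancel], rule always_eventually, rule allI)
    fix n
    have "cmod (y n - z) \<le> rb * cmod (Gw (w n) (mid (\<eta> n)) - Gw (w n) (\<eta> n))"
      unfolding y_def by (subst w(3)[of n]) (intro exp_lip Gw_strip mid_strip w)
    also have "\<dots> \<le> rb * (lam ^ n * cmod (mid (\<eta> n) - \<eta> n))"
      using Gw_lip_lam[OF mid_strip w(2), of "w n" "\<eta> n" n] rb_pos by (simp add: w)
    also have "\<dots> \<le> rb * (lam ^ n * (ln rb - ln ra))"
      using mid_dist[OF w(2)] rb_pos lam by (intro mult_left_mono) auto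
    finally show "norm (y n - z) \<le> rb * (lam ^ n * (ln rb - ln ra))" .
  next
    have "(\<lambda>n. rb * (lam ^ n * (ln rb - ln ra))) \<longlonglongrightarrow> rb * (0 * (ln rb - ln ra))"
      using lam by (intro tendsto_intros LIMSEQ_power_zero) auto
    then show "(\<lambda>n. rb * (lam ^ n * (ln rb - ln ra))) \<longlonglongrightarrow> 0" by simp
  qed
  have st: "(\<lambda>n. stereo (Some (v n))) \<longlonglongrightarrow> stereo (Some a)" if "v \<longlonglongrightarrow> a" for v a
  proof -
    have "(\<lambda>n. 2 * cmod (v n - a)) \<longlonglongrightarrow> 2 * cmod (a - a)" by (intro tendsto_intros that)
    then have "(\<lambda>n. 2 * cmod (v n - a)) \<longlonglongrightarrow> 0" by simp
    then have "(\<lambda>n. dist (stereo (Some (v n))) (stereo (Some a))) \<longlonglongrightarrow> 0"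
      by (rule Lim_null_comparison[rotated]) (simp add: dist_stereo_le)
    then show ?thesis by (rule tendsto_dist_iff[THEN iffD2])
  qed
  \<comment> \<open>Only eventually in n: for small n the orbit of \<open>y n\<close> may run
    through 0.\<close>
  have orb: "\<exists>v. (\<forall>\<^sub>F n in sequentially. (R ^^ m) (Some (y n)) = Some (v n)) \<and> v \<longlonglongrightarrow> (f ^^ m) z" for m
  proof (induction m)
    case 0
    then show ?case using ylim by (intro exI[of _ y]) auto
  next
    case (Suc m)
    then obtain v where v: "\<forall>\<^sub>F n in sequentially. (R ^^ m) (Some (y n)) = Some (v n)" "v \<longlonglongrightarrow> (f ^^ m) z" by blast
    have nz: "(f ^^ m) z \<noteq> 0" using z annulus_neq_0 by (simp add: Kinf_def)
    have "\<forall>\<^sub>F n in sequentially. v n \<noteq> 0" using v(2) nz by (rule tendsto_imp_eventually_ne)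
    with v(1) have "\<forall>\<^sub>F n in sequentially. (R ^^ Suc m) (Some (y n)) = Some (f (v n))"
      by eventually_elim (simp add: R_Some)
    moreover have "(\<lambda>n. f (v n)) \<longlonglongrightarrow> f ((f ^^ m) z)"
      by (rule tendsto_f[OF v(2) nz])
    ultimately show ?case by (intro exI[of _ "\<lambda>n. f (v n)"]) simp
  qed
  obtain T where T: "open T" "stereo ` X = sphere 0 1 \<inter> T" using X(1) by (auto simp: sph_open_def openin_open)
  then have "stereo (Some z) \<in> T" using X(2) by blast
  then have "\<forall>\<^sub>F n in sequentially. stereo (Some (y n)) \<in> T"
    using st[OF ylim] T(1) by (rule topological_tendstoD[rotated 2])
  then obtain N0 where "\<And>n. n \<ge> N0 \<Longrightarrow> stereo (Some (y n)) \<in> T" by (auto simp: eventually_sequentially)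
  then have "stereo (Some (y n)) \<in> stereo ` X" if "n \<ge> N0" for n
    using that T(2) by simp
  then have N0: "Some (y n) \<in> X" if "n \<ge> N0" for n
    using that inj_image_mem_iff[OF inj_stereo] by blast
  \<comment> \<open>A convergent sequence with its limit is a compact set on which normality can be
    tested.\<close>
  define K where "K = insert (Some z) (range (\<lambda>n. Some (y (n + N0))))"
  have KX: "K \<subseteq> X" using X(2) N0 by (auto simp: K_def)
  have "compact (insert (stereo (Some z)) (range (\<lambda>n. stereo (Some (y (n + N0))))))"
    by (rule compact_sequence_with_limit) (rule LIMSEQ_ignore_initial_segment[OF st[OF ylim]])
  then have Kc: "sph_compact K" by (simp add: sph_compact_def K_def image_image)
  obtain r g where r: "strict_mono r" and g: "\<And>K e. K \<subseteq> X \<Longrightarrow> sph_compact K \<Longrightarrow> e > 0 \<Longrightarrow>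
      \<forall>\<^sub>F j in sequentially. \<forall>z\<in>K. dist (stereo ((R ^^ (r j)) z)) (g z) < e"
    using X(3)[unfolded normal_iterates_def, THEN spec, of "\<lambda>n. n"] by blast
  \<comment> \<open>A quarter of the chordal distance from the circle of modulus \<open>rb\<close>
    to infinity.\<close>
  define e where "e = 2 / sqrt (1 + rb\<^sup>2) / 4"
  have e0: "e > 0" by (simp add: e_def add_pos_nonneg)
  obtain J where J: "\<And>j x. j \<ge> J \<Longrightarrow> x \<in> K \<Longrightarrow> dist (stereo ((R ^^ (r j)) x)) (g x) < e"
    using g[OF KX Kc e0] by (auto simp: eventually_sequentially)
  have esc: "dist (stereo ((R ^^ (r J)) (Some (y n)))) (stereo None) \<le> 3 * e" if "n \<ge> N0" for n
  proof -
    have yK: "Some (y n) \<in> K" unfolding K_def using that by (auto intro!: image_eqI[of _ _ "n - N0"])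
    obtain N where N: "\<forall>m\<ge>N. \<forall>x\<in>outside. dist (stereo ((R ^^ m) x)) (stereo None) < e"
      using outside_attracted[OF e0] by blast
    have "(R ^^ n) (Some (y n)) = Some (exp (mid (\<eta> n)))"
      using funpow_R_exp_Gw[OF mid_strip, of "w n" "\<eta> n"] by (simp add: y_def w)
    then have "(R ^^ 2) ((R ^^ n) (Some (y n))) \<in> outside"
      using esc_set_outside[OF mid_escapes] by (simp add: numeral_2_eq_2)
    then have out: "(R ^^ (2 + n)) (Some (y n)) \<in> outside" by (simp only: funpow_add comp_apply)
    \<comment> \<open>Large enough that \<open>j\<close> is at least \<open>J\<close> and that at
      least \<open>N\<close> iterates remain after the first \<open>2 + n\<close>.\<close>
    define j where "j = J + N + 2 + n"
    have "j \<le> r j" using r by (rule strict_mono_imp_increasing)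
    then have "N \<le> r j - (2 + n)" "r j = (r j - (2 + n)) + (2 + n)" by (auto simp: j_def)
    then have "dist (stereo ((R ^^ (r j)) (Some (y n)))) (stereo None) < e"
      using N out by (metis comp_apply funpow_add)
    moreover have "dist (stereo ((R ^^ (r j)) (Some (y n)))) (g (Some (y n))) < e"
      by (rule J[OF _ yK]) (simp add: j_def)
    moreover have "dist (stereo ((R ^^ (r J)) (Some (y n)))) (g (Some (y n))) < e"
      by (rule J[OF _ yK]) simp
    ultimately show ?thesis by metric
  qed
  obtain v where v: "\<forall>\<^sub>F n in sequentially. (R ^^ (r J)) (Some (y n)) = Some (v n)" "v \<longlonglongrightarrow> (f ^^ (r J)) z"
    using orb by blast
  have "dist (stereo (Some ((f ^^ (r J)) z))) (stereo None) \<le> 3 * e"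
  proof (rule tendsto_upperbound)
    show "(\<lambda>n. dist (stereo (Some (v n))) (stereo None)) \<longlonglongrightarrow> dist (stereo (Some ((f ^^ (r J)) z))) (stereo None)"
      by (intro tendsto_intros st v)
    show "\<forall>\<^sub>F n in sequentially. dist (stereo (Some (v n))) (stereo None) \<le> 3 * e"
      using v(1) eventually_ge_at_top[of N0] by eventually_elim (use esc in metis)
  qed simp
  moreover have "4 * e \<le> dist (stereo (Some ((f ^^ (r J)) z))) (stereo None)"
  proof -
    define u where "u = (f ^^ (r J)) z"
    have "cmod u \<le> rb" using z by (simp add: Kinf_def annulus_def u_def)
    then have "1 + (cmod u)\<^sup>2 \<le> 1 + rb\<^sup>2" by (simp add: power_mono)
    then have "2 / sqrt (1 + rb\<^sup>2) \<le> 2 / sqrt (1 + (cmod u)\<^sup>2)"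
      by (intro divide_left_mono) (auto intro!: mult_pos_pos simp: add_pos_nonneg)
    then show ?thesis by (simp add: dist_stereo_None e_def u_def)
  qed
  ultimately show False using e0 by linarith
qed

theorem julia_eq: "julia R = Some ` Kinf"
  using fatou_superset Kinf_not_fatou by (auto simp: julia_def)

end

section \<open>Homeomorphism with the Cantor set times the circle\<close>

lemma cantor_approx_subset: "cantor_approx n \<subseteq> {0..1}"
  by (induction n) auto

lemma cantor_set_subset: "cantor_set \<subseteq> {0..1}"
  unfolding cantor_set_def using cantor_approx_subset[of 0] by (metis INT_lower UNIV_I order_trans)

lemma compact_cantor_approx: "compact (cantor_approx n)"
  by (induction n) (auto intro!: compact_Un compact_continuous_image continuous_intros)

lemma compact_cantor_set: "compact cantor_set"
  unfolding cantor_set_def by (intro compact_Inter) (auto simp: compact_cantor_approx)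

text \<open>On the Cantor set this deletes the first ternary digit; the cut 1 / 2 lies in the
  removed middle third.\<close>

definition cshift :: "real \<Rightarrow> real" where
  "cshift x = (if x \<le> 1 / 2 then 3 * x else 3 * x - 2)"

lemma cantor_set_cases:
  assumes "x \<in> cantor_set" shows "x \<le> 1 / 3 \<or> 2 / 3 \<le> x" "cshift x \<in> cantor_set"
proof -
  have x: "x \<in> cantor_approx n" for n using assms by (auto simp: cantor_set_def)
  show "x \<le> 1 / 3 \<or> 2 / 3 \<le> x" using x[of 1] by auto
  have "cshift x \<in> cantor_approx n" for n
    using x[of "Suc n"] cantor_approx_subset[of n] by (auto simp: cshift_def field_simps)
  then show "cshift x \<in> cantor_set" by (simp add: cantor_set_def)
qed

definition cbranch :: "bool \<Rightarrow> real \<Rightarrow> real" where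
  "cbranch b y = (if b then y / 3 else y / 3 + 2 / 3)"

lemma cbranch_cantor_set:
  assumes "y \<in> cantor_set" 
  shows "cbranch b y \<in> cantor_set" "cshift (cbranch b y) = y" "(cbranch b y \<le> 1 / 2) = b"
proof -
  have y: "y \<in> cantor_approx n" for n using assms by (auto simp: cantor_set_def)
  have y01: "0 \<le> y" "y \<le> 1" using cantor_set_subset assms by auto
  have "cbranch b y \<in> cantor_approx n" for n
    using y[of "n - 1"] y01 by (cases n) (auto simp: cbranch_def)
  then show "cbranch b y \<in> cantor_set" by (simp add: cantor_set_def)
  show "cshift (cbranch b y) = y" "(cbranch b y \<le> 1 / 2) = b" using y01 by (auto simp: cshift_def cbranch_def)
qed

lemma zero_in_cantor_set: "0 \<in> cantor_set"
proof -
  have "0 \<in> cantor_approx n" for n by (induction n) (auto intro: image_eqI[of _ _ 0])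
  then show ?thesis by (simp add: cantor_set_def)
qed

context mcmullen begin

text \<open>The lower bound on k is hidden in the contraction constants: 1 \<le> ll b * |dg b|
  together with ll b < 1 forces |dg b| > 1.\<close>

lemma dg_ge_2: "2 \<le> \<bar>dg b\<bar>"
proof -
  have "0 \<le> real (k + 2) * (W b / (1 - W b))" using W[of b] by simp
  then have "ll b * (\<bar>of_int (dg b)\<bar> - real (k + 2) * (W b / (1 - W b))) \<le> ll b * \<bar>of_int (dg b)\<bar>"
    using ll(1)[of b] by (intro mult_left_mono) auto
  then have 1: "1 \<le> ll b * \<bar>of_int (dg b)\<bar>" using ll(3)[of b] by linarith
  have "\<not> \<bar>dg b\<bar> \<le> 1"
  proof
    assume "\<bar>dg b\<bar> \<le> 1"
    then have "\<bar>real_of_int (dg b)\<bar> \<le> 1" by linarith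
    then have "ll b * \<bar>of_int (dg b)\<bar> \<le> ll b * 1" using ll(1)[of b] by (intro mult_left_mono) auto
    then show False using 1 ll(2)[of b] by linarith
  qed
  then show ?thesis by linarith
qed

lemma closed_strip: "closed strip"
proof -
  have "strip = {z. ln ra \<le> Re z} \<inter> {z. Re z \<le> ln rb}" by (auto simp: strip_def)
  then show ?thesis by (simp add: closed_Int closed_halfspace_Re_le closed_halfspace_Re_ge)
qed

lemma continuous_on_G: "continuous_on strip (G b)"
proof (rule continuous_onI)
  fix x e assume x: "x \<in> strip" "0 < (e::real)"
  have "dist (G b x') (G b x) \<le> e" if "x' \<in> strip" "dist x' x < e" for x'
    using G_lip[OF that(1) x(1), of b] ll(2)[of b] mult_right_mono[of "ll b" 1 "cmod (x' - x)"] that(2) 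
    by (auto simp: dist_norm)
  then show "\<exists>d>0. \<forall>x'\<in>strip. dist x' x < d \<longrightarrow> dist (G b x') (G b x) \<le> e" using x(2) by blast
qed

section \<open>The functional equation solved by iteration\<close>

definition base :: complex where "base = of_real (ln rb)"

fun Phi_approx :: "nat \<Rightarrow> real \<times> real \<Rightarrow> complex" where
  "Phi_approx 0 (x, t) = base + \<i> * of_real t"
| "Phi_approx (Suc n) (x, t) = G (x \<le> 1 / 2) (Phi_approx n (cshift x, of_int (dg (x \<le> 1 / 2)) * t))"

lemma base_strip [simp]: "base + \<i> * of_real t \<in> strip" "base \<in> strip"
  using ra_rb ra_pos rb_pos by (auto simp: base_def strip_def)

lemma Phi_approx_strip: "Phi_approx n p \<in> strip"
  by (induction n p rule: Phi_approx.induct) (auto simp: G_strip)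

definition C1 :: real where
  "C1 = (\<Sum>b\<in>UNIV. \<bar>of_int (dg b)\<bar> * (2 * pi) + cmod (G b base - base) + 2 * pi)"

text \<open>By \<open>G_per\<close> the difference is unchanged under t -> t + 2 \<pi>, so t may be
  replaced by its remainder \<open>s\<close> in one period; this makes the bound uniform over all
  real t.\<close>

lemma Phi_approx_1: "cmod (Phi_approx 1 p - Phi_approx 0 p) \<le> C1"
proof (cases p)
  case (Pair x t)
  define b where "b \<longleftrightarrow> x \<le> 1 / 2"
  define m where "m = \<lfloor>t / (2 * pi)\<rfloor>"
  define s where "s = t - 2 * pi * of_int m"
  have "of_int m \<le> t / (2 * pi)" "t / (2 * pi) < of_int m + 1" unfolding m_def by linarith+
  then have s: "0 \<le> s" "s \<le> 2 * pi" by (simp_all add: s_def field_simps)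
  have e: "base + \<i> * of_real (of_int (dg b) * t) = (base + \<i> * of_real (of_int (dg b) * s)) + per (dg b * m)"
    by (simp add: s_def per_def algebra_simps)
  have e2: "base + \<i> * of_real t = base + \<i> * of_real s + per m"
    by (simp add: s_def per_def algebra_simps)
  have "Phi_approx 1 p - Phi_approx 0 p = G b (base + \<i> * of_real (of_int (dg b) * t)) - (base + \<i> * of_real t)"
    by (simp add: Pair b_def)
  also have "\<dots> = G b (base + \<i> * of_real (of_int (dg b) * s)) - (base + \<i> * of_real s)"
    unfolding e e2 using G_per[OF base_strip(1), of b "of_int (dg b) * s" m] by simp
  also have "\<dots> = (G b (base + \<i> * of_real (of_int (dg b) * s)) - G b base) + (G b base - base) - \<i> * of_real s"
    by simp
  finally have "cmod (Phi_approx 1 p - Phi_approx 0 p) \<le> cmod (G b (base + \<i> * of_real (of_int (dg b) * s)) - G b base) + cmod (G b base - base) + cmod (\<i> * of_real s)"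
    using norm_triangle_ineq4 norm_triangle_ineq by (smt (verit, best))
  also have "cmod (\<i> * of_real s) \<le> 2 * pi" using s by (simp add: norm_mult)
  also have "cmod (G b (base + \<i> * of_real (of_int (dg b) * s)) - G b base) \<le> \<bar>of_int (dg b)\<bar> * (2 * pi)"
  proof -
    have "cmod (G b (base + \<i> * of_real (of_int (dg b) * s)) - G b base) \<le> ll b * cmod (base + \<i> * of_real (of_int (dg b) * s) - base)"
      by (intro G_lip base_strip)
    also have "\<dots> = ll b * (\<bar>of_int (dg b)\<bar> * s)" using s by (simp add: norm_mult)
    also have "\<dots> \<le> 1 * (\<bar>of_int (dg b)\<bar> * (2 * pi))"
      using ll(1,2)[of b] s by (intro mult_mono) (auto intro: less_imp_le)
    finally show ?thesis by simp
  qed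
  finally have "cmod (Phi_approx 1 p - Phi_approx 0 p) \<le> \<bar>of_int (dg b)\<bar> * (2 * pi) + cmod (G b base - base) + 2 * pi" by simp
  also have "\<dots> \<le> C1" unfolding C1_def by (rule member_le_sum) (auto intro!: add_nonneg_nonneg)
  finally show ?thesis .
qed

lemma Phi_approx_diff: "cmod (Phi_approx (Suc n) p - Phi_approx n p) \<le> lam ^ n * C1"
proof (induction n arbitrary: p)
  case 0
  then show ?case using Phi_approx_1[of p] by simp
next
  case (Suc n)
  obtain x t where p: "p = (x, t)" by (cases p)
  define b q where "b \<longleftrightarrow> x \<le> 1 / 2" and "q = (cshift x, of_int (dg b) * t)"
  have "Phi_approx (Suc (Suc n)) p = G b (Phi_approx (Suc n) q)" "Phi_approx (Suc n) p = G b (Phi_approx n q)"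
    unfolding p q_def b_def Phi_approx.simps(2) by simp_all
  then have "cmod (Phi_approx (Suc (Suc n)) p - Phi_approx (Suc n) p) \<le> ll b * cmod (Phi_approx (Suc n) q - Phi_approx n q)"
    using G_lip[OF Phi_approx_strip Phi_approx_strip] by metis
  also have "\<dots> \<le> lam * (lam ^ n * C1)"
    using Suc[of q] lam ll(1)[of b] by (intro mult_mono) (auto intro: less_imp_le)
  finally show ?case by (simp add: mult_ac)
qed

definition Phi :: "real \<times> real \<Rightarrow> complex" where
  "Phi p = Phi_approx 0 p + (\<Sum>i. Phi_approx (Suc i) p - Phi_approx i p)"

lemma summable_C1: "summable (\<lambda>n. lam ^ n * C1)"
  using lam by (intro summable_mult2 summable_geometric) auto

lemma Phi_approx_uniform_limit: "uniform_limit UNIV Phi_approx Phi sequentially"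
proof -
  have "uniform_limit UNIV (\<lambda>n p. Phi_approx 0 p + (\<Sum>i<n. Phi_approx (Suc i) p - Phi_approx i p)) (\<lambda>p. Phi_approx 0 p + (\<Sum>i. Phi_approx (Suc i) p - Phi_approx i p)) sequentially"
    by (intro uniform_limit_intros Weierstrass_m_test_ev[where M = "\<lambda>n. lam ^ n * C1"])
      (auto simp: summable_C1 Phi_approx_diff intro!: always_eventually)
  moreover have "Phi_approx 0 p + (\<Sum>i<n. Phi_approx (Suc i) p - Phi_approx i p) = Phi_approx n p" for n p
    using sum_lessThan_telescope[of "\<lambda>i. Phi_approx i p" n] by (metis add.commute diff_add_cancel)
  ultimately show ?thesis unfolding Phi_def[abs_def] by (simp del: Phi_approx.simps)
qed

lemma Phi_approx_tendsto: "(\<lambda>n. Phi_approx n p) \<longlonglongrightarrow> Phi p"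
  using tendsto_uniform_limitI[OF Phi_approx_uniform_limit] by simp

lemma Phi_strip: "Phi p \<in> strip"
  using closed_strip Phi_approx_strip Phi_approx_tendsto by (rule closed_sequentially)

lemma Phi_eq: "Phi (x, t) = G (x \<le> 1 / 2) (Phi (cshift x, of_int (dg (x \<le> 1 / 2)) * t))"
proof (rule LIMSEQ_unique)
  show "(\<lambda>n. Phi_approx (Suc n) (x, t)) \<longlonglongrightarrow> Phi (x, t)" by (rule LIMSEQ_Suc[OF Phi_approx_tendsto])
  show "(\<lambda>n. Phi_approx (Suc n) (x, t)) \<longlonglongrightarrow> G (x \<le> 1 / 2) (Phi (cshift x, of_int (dg (x \<le> 1 / 2)) * t))"
    unfolding Phi_approx.simps
    by (rule continuous_on_tendsto_compose[OF continuous_on_G Phi_approx_tendsto]) (auto simp: Phi_strip Phi_approx_strip)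
qed

lemma Phi_per: "Phi (x, t + 2 * pi * of_int m) = Phi (x, t) + per m"
proof (rule LIMSEQ_unique)
  have "Phi_approx n (x, t + 2 * pi * of_int m) = Phi_approx n (x, t) + per m" for n
  proof (induction n arbitrary: x t m)
    case (Suc n)
    define b where "b \<longleftrightarrow> x \<le> 1 / 2"
    have "of_int (dg b) * (t + 2 * pi * of_int m) = of_int (dg b) * t + 2 * pi * of_int (dg b * m)"
      by (simp add: algebra_simps)
    then have "Phi_approx n (cshift x, of_int (dg b) * (t + 2 * pi * of_int m)) = Phi_approx n (cshift x, of_int (dg b) * t) + per (dg b * m)"
      using Suc.IH by metis
    then show ?case unfolding Phi_approx.simps b_def[symmetric] by (simp only: G_per Phi_approx_strip)
  qed (simp add: per_def algebra_simps)
  then have "(\<lambda>n. Phi_approx n (x, t) + per m) = (\<lambda>n. Phi_approx n (x, t + 2 * pi * of_int m))" by (rule ext[OF sym])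
  then show "(\<lambda>n. Phi_approx n (x, t) + per m) \<longlonglongrightarrow> Phi (x, t + 2 * pi * of_int m)"
    using Phi_approx_tendsto[of "(x, t + 2 * pi * of_int m)"] by (simp only:)
  show "(\<lambda>n. Phi_approx n (x, t) + per m) \<longlonglongrightarrow> Phi (x, t) + per m" by (intro tendsto_intros Phi_approx_tendsto)
qed

definition C2 :: real where "C2 = (\<Sum>n. lam ^ n * C1)"

lemma Phi_near: "cmod (Phi (x, t) - (base + \<i> * of_real t)) \<le> C2"
  unfolding Phi_def C2_def by (simp del: Phi_approx.simps(2)) (rule norm_suminf_le[OF Phi_approx_diff summable_C1])

lemma continuous_on_Phi: "continuous_on (cantor_set \<times> UNIV) Phi"
proof (rule uniform_limit_theorem)
  show "uniform_limit (cantor_set \<times> UNIV) Phi_approx Phi sequentially"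
    by (rule uniform_limit_on_subset[OF Phi_approx_uniform_limit]) simp
  have "continuous_on (cantor_set \<times> UNIV) (Phi_approx n)" for n
  proof (induction n)
    case 0
    have "continuous_on (cantor_set \<times> UNIV) (\<lambda>p. base + \<i> * of_real (snd p))" by (intro continuous_intros)
    moreover have "(\<lambda>p. base + \<i> * of_real (snd p)) = Phi_approx 0" by (auto simp: fun_eq_iff)
    ultimately show ?case by metis
  next
    case (Suc n)
    have br: "continuous_on A (\<lambda>p. G b (Phi_approx n (h (fst p), of_int (dg b) * snd p)))"
      if "continuous_on UNIV h" "\<And>p. p \<in> A \<Longrightarrow> h (fst p) \<in> cantor_set" for A b h
    proof (rule continuous_on_compose2[OF continuous_on_G])
      have "continuous_on A (\<lambda>p. (h (fst p), of_int (dg b) * snd p))"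
        by (intro continuous_intros continuous_on_compose2[OF that(1)]) auto
      then show "continuous_on A (\<lambda>p. Phi_approx n (h (fst p), of_int (dg b) * snd p))"
        by (rule continuous_on_compose2[OF Suc]) (use that in auto)
    qed (auto simp: Phi_approx_strip)
    \<comment> \<open>\<open>cshift\<close> jumps at 1 / 2, but the Cantor set splits into two
      closed pieces on which it is affine; the branches are pasted along these.\<close>
    have "continuous_on ((cantor_set \<inter> {..1/3}) \<times> UNIV \<union> (cantor_set \<inter> {2/3..}) \<times> UNIV)
      (\<lambda>p. if fst p \<le> 1 / 2 then G True (Phi_approx n (3 * fst p, of_int (dg True) * snd p)) 
        else G False (Phi_approx n (3 * fst p - 2, of_int (dg False) * snd p)))"
    proof (rule continuous_on_If)
      show "closed ((cantor_set \<inter> {..1/3}) \<times> (UNIV::real set))" "closed ((cantor_set \<inter> {2/3..}) \<times> (UNIV::real set))"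
        by (auto intro!: closed_Times closed_Int compact_imp_closed[OF compact_cantor_set])
      show "continuous_on ((cantor_set \<inter> {..1/3}) \<times> UNIV) (\<lambda>p. G True (Phi_approx n (3 * fst p, of_int (dg True) * snd p)))"
        using cantor_set_cases(2) by (intro br[of "\<lambda>x. 3 * x"] continuous_intros) (force simp: cshift_def)
      show "continuous_on ((cantor_set \<inter> {2/3..}) \<times> UNIV) (\<lambda>p. G False (Phi_approx n (3 * fst p - 2, of_int (dg False) * snd p)))"
        using cantor_set_cases(2) by (intro br[of "\<lambda>x. 3 * x - 2"] continuous_intros) (force simp: cshift_def)
    qed auto
    moreover have "(cantor_set \<inter> {..1/3}) \<times> UNIV \<union> (cantor_set \<inter> {2/3..}) \<times> (UNIV::real set) = cantor_set \<times> UNIV"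
    proof -
      have "x \<in> {..1/3} \<or> x \<in> {2/3..}" if "x \<in> cantor_set" for x
        using cantor_set_cases(1)[OF that] unfolding atMost_iff atLeast_iff .
      then show ?thesis by blast
    qed
    moreover have "(\<lambda>p. if fst p \<le> 1 / 2 then G True (Phi_approx n (3 * fst p, of_int (dg True) * snd p)) 
        else G False (Phi_approx n (3 * fst p - 2, of_int (dg False) * snd p))) = Phi_approx (Suc n)"
      by (auto simp: fun_eq_iff cshift_def)
    ultimately show ?case by metis
  qed
  then show "\<forall>\<^sub>F n in sequentially. continuous_on (cantor_set \<times> UNIV) (Phi_approx n)" by simp
qed simp

section \<open>Injectivity and symbolic coding\<close>

lemma gap_pos: "0 < ln s1 - ln s2" using s2_s1 s2_pos by simp

lemma G_inj: 
  assumes "x \<in> strip" "y \<in> strip" "G b x = G b' y" shows "b = b'" "x = y"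
proof -
  show b: "b = b'" using gap[OF assms(1,2), of b b'] assms(3) gap_pos by (cases "b = b'") auto
  show "x = y" using G_low[OF assms(1,2), of b] assms(3) b by simp
qed

text \<open>Equal values have the same first branch, so equality passes to the shifted points. Each
  step multiplies the difference of the Cantor coordinates by 3 and that of the parameters by |dg b|
  \<ge> 2 in modulus, while \<open>cantor_set_subset\<close> and \<open>Phi_near\<close> keep both
  bounded.\<close>

lemma Phi_inj:
  assumes "x \<in> cantor_set" "x' \<in> cantor_set" "Phi (x, t) = Phi (x', t')"
  shows "x = x' \<and> t = t'"
proof -
  have bound: "\<bar>t - t'\<bar> \<le> 2 * C2" if "Phi (x, t) = Phi (x', t')" for x t x' t'
  proof -
    have "cmod ((base + \<i> * of_real t) - (base + \<i> * of_real t')) \<le> 2 * C2"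
      using norm_triangle_ineq4[of "Phi (x', t') - (base + \<i> * of_real t')" "Phi (x, t) - (base + \<i> * of_real t)"]
        Phi_near[of x t] Phi_near[of x' t'] that by simp
    moreover have "(base + \<i> * of_real t) - (base + \<i> * of_real t') = \<i> * of_real (t - t')" by (simp add: algebra_simps)
    ultimately have "cmod (\<i> * of_real (t - t')) \<le> 2 * C2" by metis
    then show ?thesis by (simp only: norm_mult norm_of_real norm_ii mult_1)
  qed
  have est: "3 ^ n * \<bar>x - x'\<bar> \<le> 1 \<and> 2 ^ n * \<bar>t - t'\<bar> \<le> 2 * C2"
    if "x \<in> cantor_set" "x' \<in> cantor_set" "Phi (x, t) = Phi (x', t')" for x x' t t' n
    using that
  proof (induction n arbitrary: x x' t t')
    case 0
    have "\<bar>x - x'\<bar> \<le> 1" using subsetD[OF cantor_set_subset 0(1)] subsetD[OF cantor_set_subset 0(2)] by auto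
    then show ?case using bound[OF 0(3)] by simp
  next
    case (Suc n)
    define b where "b \<longleftrightarrow> x \<le> 1 / 2"
    define b' where "b' \<longleftrightarrow> x' \<le> 1 / 2"
    have e: "G b (Phi (cshift x, of_int (dg b) * t)) = G b' (Phi (cshift x', of_int (dg b') * t'))"
      using Suc.prems(3) Phi_eq[of x t] Phi_eq[of x' t'] by (simp add: b_def b'_def)
    note i = G_inj[OF Phi_strip Phi_strip e]
    then have "b' = b" by simp
    then have sh: "cshift x - cshift x' = 3 * (x - x')" by (auto simp: b_def b'_def cshift_def)
    have "3 ^ n * \<bar>cshift x - cshift x'\<bar> \<le> 1 \<and> 2 ^ n * \<bar>of_int (dg b) * t - of_int (dg b) * t'\<bar> \<le> 2 * C2"
      using i \<open>b' = b\<close> by (intro Suc.IH cantor_set_cases Suc.prems) simp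
    moreover have "2 * \<bar>t - t'\<bar> \<le> \<bar>of_int (dg b) * t - of_int (dg b) * t'\<bar>"
    proof -
      have "2 \<le> \<bar>real_of_int (dg b)\<bar>" using dg_ge_2[of b] by linarith
      then have "2 * \<bar>t - t'\<bar> \<le> \<bar>of_int (dg b)\<bar> * \<bar>t - t'\<bar>" by (intro mult_right_mono) auto
      also have "\<dots> = \<bar>of_int (dg b) * t - of_int (dg b) * t'\<bar>" by (simp flip: abs_mult right_diff_distrib)
      finally show ?thesis .
    qed
    then have "2 ^ n * (2 * \<bar>t - t'\<bar>) \<le> 2 ^ n * \<bar>of_int (dg b) * t - of_int (dg b) * t'\<bar>" by (intro mult_left_mono) auto
    moreover have "3 ^ Suc n * \<bar>x - x'\<bar> = 3 ^ n * \<bar>3 * (x - x')\<bar>" "2 ^ Suc n * \<bar>t - t'\<bar> = 2 ^ n * (2 * \<bar>t - t'\<bar>)"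
      by (simp_all only: abs_mult power_Suc mult_ac abs_numeral)
    ultimately show ?case unfolding sh by linarith
  qed
  have small: "u = 0" if le: "\<And>n. a ^ n * \<bar>u\<bar> \<le> B" and a: "a > 1" for a u B :: real
  proof (rule ccontr)
    assume "u \<noteq> 0"
    then obtain n where "B / \<bar>u\<bar> < a ^ n" using real_arch_pow[OF a] by blast
    then show False using le[of n] \<open>u \<noteq> 0\<close> by (simp add: field_simps)
  qed
  have "x - x' = 0" by (rule small[of 3 _ 1]) (use est[OF assms] in auto)
  moreover have "t - t' = 0" by (rule small[of 2 _ "2 * C2"]) (use est[OF assms] in auto)
  ultimately show ?thesis by simp
qed

lemma f_exp_Phi: "f (exp (Phi (x, t))) = exp (Phi (cshift x, of_int (dg (x \<le> 1 / 2)) * t))"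
  using Phi_eq[of x t] exp_G[OF Phi_strip] by metis

lemma exp_Phi_Kinf: "exp (Phi p) \<in> Kinf"
proof -
  have "\<exists>q. (f ^^ n) (exp (Phi p)) = exp (Phi q)" for n
  proof (induction n)
    case 0
    show ?case by (intro exI[of _ p]) simp
  next
    case (Suc n)
    then obtain x t where "(f ^^ n) (exp (Phi p)) = exp (Phi (x, t))" by auto
    then have "(f ^^ Suc n) (exp (Phi p)) = exp (Phi (cshift x, of_int (dg (x \<le> 1 / 2)) * t))"
      by (simp only: funpow.simps comp_apply f_exp_Phi)
    then show ?case by blast
  qed
  moreover have "exp (Phi q) \<in> annulus" for q by (simp only: strip_iff Phi_strip)
  ultimately have "(f ^^ n) (exp (Phi p)) \<in> annulus" for n by metis
  then show ?thesis by (simp add: Kinf_def)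
qed

text \<open>The Cantor point is 0 with the digits of \<open>w\<close> put in front of it by
  \<open>cbranch\<close>.\<close>

lemma Phi_word: "\<exists>x\<in>cantor_set. \<forall>t. Phi (x, t) = Gw w (Phi (0, of_int (dw w) * t))"
proof (induction w)
  case Nil
  then show ?case using zero_in_cantor_set by auto
next
  case (Cons b w)
  then obtain x where x: "x \<in> cantor_set" "\<And>t. Phi (x, t) = Gw w (Phi (0, of_int (dw w) * t))" by blast
  have "Phi (cbranch b x, t) = Gw (b # w) (Phi (0, of_int (dw (b # w)) * t))" for t
    using Phi_eq[of "cbranch b x" t] x(2)[of "of_int (dg b) * t"] cbranch_cantor_set[OF x(1), of b]
    by (simp add: mult_ac)
  then show ?case using cbranch_cantor_set(1)[OF x(1)] by blast
qed

lemma dw_neq_0: "dw w \<noteq> 0"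
proof (induction w)
  case (Cons b w)
  then show ?case using dg_ge_2[of b] by auto
qed simp

section \<open>Passage from the line to the circle\<close>

definition Psi :: "real \<times> complex \<Rightarrow> complex" where
  "Psi p = exp (Phi (fst p, Arg (snd p)))"

lemma exp_Phi_cis: 
  assumes "u = cis t" shows "Psi (x, u) = exp (Phi (x, t))"
proof -
  have "cis (Arg u) = cis t" using assms cis_Arg[of u] by (simp add: sgn_eq)
  then have "exp (\<i> * of_real (Arg u)) = exp (\<i> * of_real t)" by (simp add: cis_conv_exp)
  then obtain m where "\<i> * of_real (Arg u) = \<i> * of_real t + per m" using exp_eq_per by blast
  then have "Im (\<i> * of_real (Arg u)) = Im (\<i> * of_real t + per m)" by simp
  then have "Arg u = t + 2 * pi * of_int m" by simp
  then show ?thesis by (simp add: Psi_def Phi_per)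
qed

lemma sphere_cis: "u \<in> sphere 0 1 \<Longrightarrow> u = cis (Arg u)"
  using cis_Arg[of u] by (cases "u = 0") (auto simp: sgn_eq)

text \<open>\<open>Arg\<close> jumps on the negative real axis. The relatively open piece
  \<open>S2\<close> around it uses the argument Arg (- u) + \<pi> instead; by
  \<open>exp_Phi_cis\<close> every argument of u gives the same value.\<close>

lemma continuous_on_Psi: "continuous_on (cantor_set \<times> sphere 0 1) Psi"
proof -
  define S1 where "S1 = cantor_set \<times> sphere (0::complex) 1 \<inter> {p. snd p \<in> - \<real>\<^sub>\<le>\<^sub>0}"
  define S2 where "S2 = cantor_set \<times> sphere (0::complex) 1 \<inter> {p. - snd p \<in> - \<real>\<^sub>\<le>\<^sub>0}"
  have o: "open (- \<real>\<^sub>\<le>\<^sub>0 :: complex set)" by (simp add: open_Compl)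
  have "open (snd -` (- \<real>\<^sub>\<le>\<^sub>0) :: (real \<times> complex) set)"
    by (intro open_vimage o continuous_intros)
  then have op1: "openin (top_of_set (cantor_set \<times> sphere 0 1)) S1"
    unfolding S1_def vimage_def by (rule openin_open_Int)
  have "open ((\<lambda>p. - snd p) -` (- \<real>\<^sub>\<le>\<^sub>0) :: (real \<times> complex) set)"
    by (intro open_vimage o continuous_intros)
  then have op2: "openin (top_of_set (cantor_set \<times> sphere 0 1)) S2"
    unfolding S2_def vimage_def by (rule openin_open_Int)
  have "u \<in> - \<real>\<^sub>\<le>\<^sub>0 \<or> - u \<in> - \<real>\<^sub>\<le>\<^sub>0" if "u \<in> sphere 0 1" for u :: complex
  proof -
    have "u \<noteq> 0" using that by auto
    then show ?thesis by (auto simp: complex_nonpos_Reals_iff complex_eq_iff)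
  qed
  then have un: "S1 \<union> S2 = cantor_set \<times> sphere 0 1"
    unfolding S1_def S2_def by fastforce
  have c1: "continuous_on S1 Psi"
    unfolding Psi_def
    by (intro continuous_intros continuous_on_compose2[OF continuous_on_Phi] continuous_on_compose2[OF continuous_on_Arg])
      (auto simp: S1_def)
  have "continuous_on S2 (\<lambda>p. exp (Phi (fst p, Arg (- snd p) + pi)))"
    by (intro continuous_intros continuous_on_compose2[OF continuous_on_Phi] continuous_on_compose2[OF continuous_on_Arg])
      (auto simp: S2_def)
  moreover have "exp (Phi (fst p, Arg (- snd p) + pi)) = Psi p" if "p \<in> S2" for p
  proof -
    have "- snd p = cis (Arg (- snd p))" using that by (intro sphere_cis) (auto simp: S2_def)
    then have "snd p = cis (Arg (- snd p) + pi)" by (metis cis_mult cis_pi minus_minus mult_minus1_right)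
    then show ?thesis using exp_Phi_cis[of "snd p" "Arg (- snd p) + pi" "fst p"] by simp
  qed
  ultimately have c2: "continuous_on S2 Psi" by (simp cong: continuous_on_cong)
  show ?thesis using continuous_on_Un_local_open[OF _ _ c1 c2] op1 op2 un by simp
qed

lemma inj_on_Psi: "inj_on Psi (cantor_set \<times> sphere 0 1)"
proof (rule inj_onI)
  fix p q assume p: "p \<in> cantor_set \<times> sphere 0 1" and q: "q \<in> cantor_set \<times> sphere 0 1" and e: "Psi p = Psi q"
  obtain m where "Phi (fst p, Arg (snd p)) = Phi (fst q, Arg (snd q)) + per m"
    using e unfolding Psi_def exp_eq_per by blast
  then have "Phi (fst p, Arg (snd p)) = Phi (fst q, Arg (snd q) + 2 * pi * of_int m)" by (simp add: Phi_per)
  then have i: "fst p = fst q" "Arg (snd p) = Arg (snd q) + 2 * pi * of_int m"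
    using Phi_inj p q by (metis mem_Times_iff)+
  have "exp (\<i> * of_real (Arg (snd p))) = exp (\<i> * of_real (Arg (snd q)))"
    unfolding i(2) exp_eq_per by (rule exI[of _ m]) (simp add: per_def algebra_simps)
  then have "cis (Arg (snd p)) = cis (Arg (snd q))" by (simp add: cis_conv_exp)
  moreover have "snd p = cis (Arg (snd p))" "snd q = cis (Arg (snd q))" using sphere_cis p q by auto
  ultimately have "snd p = snd q" by simp
  then show "p = q" using i(1) by (simp add: prod_eq_iff)
qed

text \<open>The image is compact, so density suffices. A point coded by a word of length n is
  compared with a parametrised point over the same word: the arguments of \<open>Gw w\<close> are at
  bounded distance, and the word contracts by \<open>lam ^ n\<close>.\<close>

lemma Psi_image: "Psi ` (cantor_set \<times> sphere 0 1) = Kinf"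
proof
  show "Psi ` (cantor_set \<times> sphere 0 1) \<subseteq> Kinf" using exp_Phi_Kinf by (auto simp: Psi_def)
  have "closed (Psi ` (cantor_set \<times> sphere 0 1))"
    by (intro compact_imp_closed compact_continuous_image continuous_on_Psi compact_Times compact_cantor_set) auto
  moreover have "Kinf \<subseteq> closure (Psi ` (cantor_set \<times> sphere 0 1))"
  proof
    fix z assume z: "z \<in> Kinf"
    show "z \<in> closure (Psi ` (cantor_set \<times> sphere 0 1))"
    proof (rule closure_approachable[THEN iffD2], intro allI impI)
      fix e :: real assume e: "0 < e"
      define B where "B = rb * (ln rb - ln ra + C2)"
      have "(\<lambda>n. lam ^ n * B) \<longlonglongrightarrow> 0 * B" using lam by (intro tendsto_intros LIMSEQ_power_zero) auto
      then have "\<forall>\<^sub>F n in sequentially. lam ^ n * B < e" using e by (auto dest!: order_tendstoD(2)[where a = e])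
      then obtain n where n: "lam ^ n * B < e" unfolding eventually_sequentially by blast
      obtain w \<eta> where w: "length w = n" "\<eta> \<in> strip" "z = exp (Gw w \<eta>)" using Kinf_rep[OF z] by blast
      obtain x where x: "x \<in> cantor_set" "\<And>t. Phi (x, t) = Gw w (Phi (0, of_int (dw w) * t))"
        using Phi_word by blast
      \<comment> \<open>Chosen so that the parameter inside the word is \<open>Im \<eta>\<close>,
        which places \<open>Phi (0, Im \<eta>)\<close> at bounded distance from
        \<open>\<eta>\<close>.\<close>
      define t where "t = Im \<eta> / of_int (dw w)"
      have t: "of_int (dw w) * t = Im \<eta>" using dw_neq_0[of w] by (simp add: t_def)
      have "cmod (Phi (0, Im \<eta>) - \<eta>) \<le> cmod (Phi (0, Im \<eta>) - (base + \<i> * of_real (Im \<eta>))) + cmod (base + \<i> * of_real (Im \<eta>) - \<eta>)"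
        using norm_triangle_ineq[of "Phi (0, Im \<eta>) - (base + \<i> * of_real (Im \<eta>))" "base + \<i> * of_real (Im \<eta>) - \<eta>"] by simp
      also have "base + \<i> * of_real (Im \<eta>) - \<eta> = of_real (ln rb - Re \<eta>)" by (simp add: base_def complex_eq_iff)
      also have "cmod (of_real (ln rb - Re \<eta>)) \<le> ln rb - ln ra" using w(2) by (subst norm_of_real) (simp add: strip_def)
      finally have d: "cmod (Phi (0, Im \<eta>) - \<eta>) \<le> ln rb - ln ra + C2" using Phi_near[of 0 "Im \<eta>"] by linarith
      have "cmod (exp (Phi (x, t)) - z) \<le> rb * cmod (Gw w (Phi (0, Im \<eta>)) - Gw w \<eta>)"
        unfolding x(2) t w(3) by (intro exp_lip Gw_strip Phi_strip w)
      also have "\<dots> \<le> rb * (lam ^ n * (ln rb - ln ra + C2))"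
      proof (intro mult_left_mono)
        have "cmod (Gw w (Phi (0, Im \<eta>)) - Gw w \<eta>) \<le> lam ^ n * cmod (Phi (0, Im \<eta>) - \<eta>)"
          using Gw_lip_lam[OF Phi_strip w(2), of w "(0, Im \<eta>)"] by (simp only: w(1))
        also have "\<dots> \<le> lam ^ n * (ln rb - ln ra + C2)"
          using lam(1) by (intro mult_left_mono d) simp
        finally show "cmod (Gw w (Phi (0, Im \<eta>)) - Gw w \<eta>) \<le> lam ^ n * (ln rb - ln ra + C2)" .
      qed (use rb_pos in simp)
      finally have "dist (exp (Phi (x, t))) z < e" using n by (simp add: dist_norm B_def mult_ac)
      moreover have "exp (Phi (x, t)) = Psi (x, cis t)" by (simp add: exp_Phi_cis)
      ultimately show "\<exists>y\<in>Psi ` (cantor_set \<times> sphere 0 1). dist y z < e" using x(1)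
        by (intro bexI[of _ "Psi (x, cis t)"] imageI) auto
    qed
  qed
  ultimately show "Kinf \<subseteq> Psi ` (cantor_set \<times> sphere 0 1)" by simp
qed

lemma continuous_on_stereo_Some: "continuous_on A (\<lambda>z. stereo (Some z))"
proof (rule continuous_onI)
  fix x e assume "x \<in> A" "0 < (e::real)"
  have "dist (stereo (Some x')) (stereo (Some x)) \<le> e" if "dist x' x < e / 2" for x'
    using dist_stereo_le[of x' x] that by (simp add: dist_norm)
  then show "\<exists>d>0. \<forall>x'\<in>A. dist x' x < d \<longrightarrow> dist (stereo (Some x')) (stereo (Some x)) \<le> e"
    using \<open>0 < e\<close> by (intro exI[of _ "e / 2"]) auto
qed

theorem julia_homeomorphic: "stereo ` julia R homeomorphic (cantor_set \<times> sphere (0::complex) 1)"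
proof -
  have "continuous_on (cantor_set \<times> sphere 0 1) (\<lambda>p. stereo (Some (Psi p)))"
    by (rule continuous_on_compose2[OF continuous_on_stereo_Some continuous_on_Psi]) auto
  moreover have "(\<lambda>p. stereo (Some (Psi p))) ` (cantor_set \<times> sphere 0 1) = stereo ` julia R"
    unfolding julia_eq Psi_image[symmetric] by (simp add: image_image)
  moreover have "inj_on (\<lambda>p. stereo (Some (Psi p))) (cantor_set \<times> sphere 0 1)"
    using inj_on_Psi inj_stereo unfolding inj_on_def by (metis UNIV_I option.inject)
  ultimately have "cantor_set \<times> sphere (0::complex) 1 homeomorphic stereo ` julia R"
    by (intro homeomorphic_compact compact_Times compact_cantor_set) auto
  then show ?thesis by (rule homeomorphic_sym[THEN iffD1])
qed

end

section \<open>Distortion of compositions of inverse branches\<close>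

text \<open>The quotient (exp \<delta> - 1) / \<delta>, continued by 1 at 0, is continuous, and it
  has no zero on a rectangle with |Im \<delta>| \<le> \<pi>, because the nonzero zeros of the
  numerator are multiples of 2 \<pi> \<i>. Compactness gives the constant.\<close>

lemma exp_minus_one_lower:
  fixes \<rho> :: real
  shows "\<exists>m>0. \<forall>\<delta>. \<bar>Re \<delta>\<bar> \<le> \<rho> \<and> \<bar>Im \<delta>\<bar> \<le> pi \<longrightarrow> m * cmod \<delta> \<le> cmod (exp \<delta> - 1)"
proof -
  define Q where "Q = cbox (Complex (- \<bar>\<rho>\<bar>) (- pi)) (Complex \<bar>\<rho>\<bar> pi)"
  define h where "h \<delta> = (if \<delta> = 0 then 1 else (exp \<delta> - 1) / \<delta>)" for \<delta> :: complex
  have Q: "\<delta> \<in> Q \<longleftrightarrow> \<bar>Re \<delta>\<bar> \<le> \<bar>\<rho>\<bar> \<and> \<bar>Im \<delta>\<bar> \<le> pi" for \<delta>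
    by (auto simp: Q_def in_cbox_complex_iff)
  have "isCont h \<delta>" for \<delta>
  proof (cases "\<delta> = 0")
    case True
    have "(exp has_field_derivative 1) (at (0::complex))" by (auto intro!: derivative_eq_intros)
    then have "(\<lambda>\<delta>. (exp \<delta> - 1) / \<delta>) \<midarrow>0\<rightarrow> (1::complex)" by (simp add: has_field_derivative_iff)
    then have "h \<midarrow>0\<rightarrow> 1" by (rule Lim_transform_eventually) (auto simp: h_def eventually_at intro!: exI[of _ 1])
    then show ?thesis by (simp add: True isCont_def h_def)
  next
    case False
    have "isCont (\<lambda>\<delta>. (exp \<delta> - 1) / \<delta>) \<delta>" using False by (intro continuous_intros) auto
    moreover have "\<forall>\<^sub>F x in nhds \<delta>. h x = (exp x - 1) / x"
      using t1_space_nhds[OF False] by eventually_elim (simp add: h_def)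
    ultimately show ?thesis by (simp cong: isCont_cong)
  qed
  then have "continuous_on Q (\<lambda>\<delta>. cmod (h \<delta>))" by (intro continuous_intros continuous_at_imp_continuous_on) auto
  moreover have "compact Q" "Q \<noteq> {}" using Q[of 0] by (auto simp: Q_def)
  ultimately obtain \<delta>0 where \<delta>0: "\<delta>0 \<in> Q" "\<And>\<delta>. \<delta> \<in> Q \<Longrightarrow> cmod (h \<delta>0) \<le> cmod (h \<delta>)"
    using continuous_attains_inf[of Q "\<lambda>\<delta>. cmod (h \<delta>)"] by blast
  have "h \<delta>0 \<noteq> 0"
  proof (cases "\<delta>0 = 0")
    case False
    have "exp \<delta>0 \<noteq> 1"
    proof
      assume "exp \<delta>0 = 1"
      then obtain n :: int where n: "Re \<delta>0 = 0" "Im \<delta>0 = of_int (2 * n) * pi" by (auto simp: exp_eq_1)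
      then have "\<bar>of_int (2 * n)\<bar> * pi \<le> 1 * pi" using \<delta>0(1) by (simp add: Q abs_mult)
      then have "\<bar>real_of_int (2 * n)\<bar> \<le> 1" by (subst (asm) mult_le_cancel_right_pos) simp_all
      then have "n = 0" by linarith
      then show False using n False by (simp add: complex_eq_iff)
    qed
    then show ?thesis using False by (simp add: h_def)
  qed (simp add: h_def)
  moreover have "cmod (h \<delta>0) * cmod \<delta> \<le> cmod (exp \<delta> - 1)" if "\<bar>Re \<delta>\<bar> \<le> \<rho>" "\<bar>Im \<delta>\<bar> \<le> pi" for \<delta>
  proof (cases "\<delta> = 0")
    case False
    have "cmod (h \<delta>0) \<le> cmod (h \<delta>)" using that by (intro \<delta>0(2)) (simp add: Q)
    then show ?thesis using False by (simp add: h_def norm_divide field_simps)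
  qed simp
  ultimately show ?thesis by (intro exI[of _ "cmod (h \<delta>0)"]) auto
qed

context mcmullen begin

section \<open>Bounded distortion along words\<close>

lemma Gw_inj:
  assumes "x \<in> strip" "y \<in> strip" "length w = length w'" "Gw w x = Gw w' y"
  shows "w = w' \<and> x = y"
  using assms(3,4)
proof (induction w w' rule: list_induct2)
  case (Cons b w b' w')
  have "G b (Gw w x) = G b' (Gw w' y)" using Cons.prems by simp
  note i = G_inj[OF Gw_strip[OF assms(1)] Gw_strip[OF assms(2)] this]
  show ?case using i Cons.IH by simp
qed simp

lemma lam_sum_le: "(\<Sum>i<n. lam ^ i) \<le> 1 / (1 - lam)"
proof -
  have "(\<Sum>i<n. lam ^ i) = (1 - lam ^ n) / (1 - lam)" using lam by (simp add: sum_gp_strict)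
  also have "\<dots> \<le> 1 / (1 - lam)" using lam by (intro divide_right_mono) auto
  finally show ?thesis .
qed

lemma lam_power_le_1: "lam ^ n \<le> 1"
  using lam by (simp add: power_le_one)

lemma Gw_nonexpanding: "x \<in> strip \<Longrightarrow> y \<in> strip \<Longrightarrow> cmod (Gw w x - Gw w y) \<le> cmod (x - y)"
  using Gw_lip_lam[of x y w] mult_right_mono[OF lam_power_le_1, of "cmod (x - y)" "length w"] by simp

text \<open>The factors of \<open>G_distortion\<close> multiply along the word. After i letters the
  points are at most \<open>lam ^ i * B\<close> apart, so the product is bounded by the exponential
  of a geometric sum.\<close>

lemma Gw_distortion:
  assumes S: "x \<in> strip" "y \<in> strip" "z \<in> strip" and B: "cmod (x - y) \<le> B" "cmod (x - z) \<le> B"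
  shows "cmod (Gw w x - Gw w z) * cmod (x - y)
    \<le> exp (2 * Mdist * B * (\<Sum>i<length w. lam ^ i)) * (cmod (Gw w x - Gw w y) * cmod (x - z))"
proof (induction w)
  case (Cons b w)
  define x1 y1 z1 where "x1 = Gw w x" and "y1 = Gw w y" and "z1 = Gw w z"
  have S1: "x1 \<in> strip" "y1 \<in> strip" "z1 \<in> strip" using S Gw_strip by (auto simp: x1_def y1_def z1_def)
  define E l where "E = exp (2 * Mdist * B * (\<Sum>i<length w. lam ^ i))" and "l = lam ^ length w"
  show ?case
  proof (cases "x = y")
    case False
    then have "x1 \<noteq> y1" using Gw_inj[OF S(1,2), of w w] by (auto simp: x1_def y1_def)
    then have pos: "0 < cmod (x1 - y1)" by simp
    have l0: "0 \<le> l" using lam(1) by (simp add: l_def)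
    have IH: "cmod (x1 - z1) * cmod (x - y) \<le> E * (cmod (x1 - y1) * cmod (x - z))"
      using Cons by (simp add: x1_def y1_def z1_def E_def)
    have "cmod (x1 - y1) \<le> l * B" "cmod (x1 - z1) \<le> l * B"
      using Gw_lip_lam[OF S(1,2), of w] Gw_lip_lam[OF S(1,3), of w] mult_left_mono[OF B(1) l0] mult_left_mono[OF B(2) l0]
      by (simp_all only: x1_def y1_def z1_def l_def)
    then have "Mdist * (cmod (x1 - y1) + cmod (x1 - z1)) \<le> Mdist * (l * B + l * B)"
      using Mdist_nonneg by (intro mult_left_mono add_mono)
    then have "1 + Mdist * (cmod (x1 - y1) + cmod (x1 - z1)) \<le> 1 + 2 * Mdist * B * l"
      by (simp add: algebra_simps)
    also have "\<dots> \<le> exp (2 * Mdist * B * l)" by (rule exp_ge_add_one_self)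
    finally have ex: "1 + Mdist * (cmod (x1 - y1) + cmod (x1 - z1)) \<le> exp (2 * Mdist * B * l)" .
    have "cmod (G b x1 - G b z1) * cmod (x1 - y1)
      \<le> (1 + Mdist * (cmod (x1 - y1) + cmod (x1 - z1))) * (cmod (G b x1 - G b y1) * cmod (x1 - z1))"
      by (rule G_distortion[OF S1])
    also have "\<dots> \<le> exp (2 * Mdist * B * l) * (cmod (G b x1 - G b y1) * cmod (x1 - z1))"
      by (intro mult_right_mono ex) auto
    finally have st: "cmod (G b x1 - G b z1) * cmod (x1 - y1) \<le> exp (2 * Mdist * B * l) * (cmod (G b x1 - G b y1) * cmod (x1 - z1))" .
    have "(cmod (G b x1 - G b z1) * cmod (x - y)) * cmod (x1 - y1) = (cmod (G b x1 - G b z1) * cmod (x1 - y1)) * cmod (x - y)"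
      by (simp add: mult_ac)
    also have "\<dots> \<le> (exp (2 * Mdist * B * l) * (cmod (G b x1 - G b y1) * cmod (x1 - z1))) * cmod (x - y)"
      by (intro mult_right_mono st) auto
    also have "\<dots> = (exp (2 * Mdist * B * l) * cmod (G b x1 - G b y1)) * (cmod (x1 - z1) * cmod (x - y))"
      by (simp add: mult_ac)
    also have "\<dots> \<le> (exp (2 * Mdist * B * l) * cmod (G b x1 - G b y1)) * (E * (cmod (x1 - y1) * cmod (x - z)))"
      by (intro mult_left_mono IH) auto
    also have "\<dots> = (exp (2 * Mdist * B * l) * E * (cmod (G b x1 - G b y1) * cmod (x - z))) * cmod (x1 - y1)"
      by (simp add: mult_ac)
    finally have "cmod (G b x1 - G b z1) * cmod (x - y) \<le> exp (2 * Mdist * B * l) * E * (cmod (G b x1 - G b y1) * cmod (x - z))"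
      using pos by (rule mult_right_le_imp_le)
    moreover have "exp (2 * Mdist * B * l) * E = exp (2 * Mdist * B * (\<Sum>i<length (b # w). lam ^ i))"
      by (simp add: E_def l_def exp_add[symmetric] algebra_simps)
    ultimately show ?thesis by (simp add: x1_def y1_def z1_def)
  qed simp
qed simp

text \<open>Here \<open>y\<close> may be far away, where \<open>Gw_distortion\<close> has no uniform
  constant. The word is therefore applied from its innermost letter: as long as the images of
  \<open>x\<close> and \<open>y\<close> stay at distance at least \<delta>, one letter is applied to
  all three points. When they would first come closer, \<open>G_low\<close> puts the current
  \<open>x\<close> and \<open>y\<close> within \<open>Lup * \<delta>\<close>, and bounded distortion
  handles the whole remaining word.\<close>

theorem Gw_quasisymmetric:
  assumes "0 < \<delta>" "0 < D"
  shows "\<exists>K>0. \<forall>w. \<forall>x\<in>strip. \<forall>y\<in>strip. \<forall>z\<in>strip. \<delta> \<le> cmod (x - y) \<and> cmod (x - z) \<le> D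
    \<longrightarrow> cmod (Gw w x - Gw w z) \<le> K * cmod (Gw w x - Gw w y)"
proof -
  define B where "B = max (Lup * \<delta>) D"
  define E where "E = exp (2 * Mdist * B / (1 - lam))"
  have B0: "0 \<le> B" using assms by (simp add: B_def)
  have E1: "1 \<le> E" using Mdist_nonneg B0 lam by (simp add: E_def)
  have main: "cmod (Gw w x - Gw w z) \<le> E * D / \<delta> * cmod (Gw w x - Gw w y)"
    if "x \<in> strip" "y \<in> strip" "z \<in> strip" "\<delta> \<le> cmod (x - y)" "cmod (x - z) \<le> D" for w x y z
    using that
  proof (induction w arbitrary: x y z rule: rev_induct)
    case Nil
    have "\<delta> * cmod (x - z) \<le> cmod (x - y) * (E * D)"
    proof (intro mult_mono)
      show "cmod (x - z) \<le> E * D" using Nil(5) mult_right_mono[OF E1, of D] assms by linarith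
    qed (use Nil assms in auto)
    then show ?case using assms by (simp add: field_simps)
  next
    case (snoc b w)
    show ?case
    proof (cases "\<delta> \<le> cmod (G b x - G b y)")
      case True
      have "cmod (G b x - G b z) \<le> D" using Gw_nonexpanding[OF snoc.prems(1,3), of "[b]"] snoc.prems(5) by simp
      then show ?thesis using snoc.IH[OF G_strip[OF snoc.prems(1)] G_strip[OF snoc.prems(2)] G_strip[OF snoc.prems(3)] True]
        by (simp add: Gw_append)
    next
      case False
      have "0 \<le> Lup" by (simp add: Lup_def)
      then have "Lup * cmod (G b x - G b y) \<le> Lup * \<delta>" using False by (intro mult_left_mono) auto
      then have "cmod (x - y) \<le> B" using G_low[OF snoc.prems(1,2), of b] by (simp add: B_def)
      moreover have "cmod (x - z) \<le> B" using snoc.prems(5) by (simp add: B_def)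
      ultimately have "cmod (Gw (w @ [b]) x - Gw (w @ [b]) z) * cmod (x - y)
        \<le> exp (2 * Mdist * B * (\<Sum>i<length (w @ [b]). lam ^ i)) * (cmod (Gw (w @ [b]) x - Gw (w @ [b]) y) * cmod (x - z))"
        by (intro Gw_distortion snoc.prems)
      also have "\<dots> \<le> E * (cmod (Gw (w @ [b]) x - Gw (w @ [b]) y) * D)"
      proof (intro mult_mono)
        have "2 * Mdist * B * (\<Sum>i<length (w @ [b]). lam ^ i) \<le> 2 * Mdist * B * (1 / (1 - lam))"
          using Mdist_nonneg B0 by (intro mult_left_mono lam_sum_le) auto
        then show "exp (2 * Mdist * B * (\<Sum>i<length (w @ [b]). lam ^ i)) \<le> E" by (simp add: E_def)
      qed (use snoc.prems E1 in auto)
      finally have "cmod (Gw (w @ [b]) x - Gw (w @ [b]) z) * cmod (x - y) \<le> E * (cmod (Gw (w @ [b]) x - Gw (w @ [b]) y) * D)" .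
      moreover have "cmod (Gw (w @ [b]) x - Gw (w @ [b]) z) * \<delta> \<le> cmod (Gw (w @ [b]) x - Gw (w @ [b]) z) * cmod (x - y)"
        by (intro mult_left_mono snoc.prems) auto
      ultimately show ?thesis using assms(1) by (simp add: field_simps)
    qed
  qed
  moreover have "0 < E * D / \<delta>" using E1 assms by simp
  ultimately show ?thesis by blast
qed

section \<open>Marked points and their separation\<close>

definition p0 :: complex where "p0 = Phi (0, 0)"
definition zeta :: "bool list \<Rightarrow> int \<Rightarrow> complex" where "zeta w j = Gw w (p0 + per j)"
definition pt :: "bool list \<Rightarrow> int \<Rightarrow> complex \<times> real" where "pt w j = stereo (Some (exp (zeta w j)))"

lemma p0_strip: "p0 \<in> strip" by (simp add: p0_def Phi_strip)

lemma zeta_strip: "zeta w j \<in> strip"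
  by (simp add: zeta_def Gw_strip p0_strip)

lemma pt_julia: "pt w j \<in> stereo ` julia R"
proof -
  have "exp (zeta w j) \<in> Kinf" unfolding zeta_def
    by (intro Kinf_Gw) (simp_all add: p0_strip, simp add: p0_def exp_Phi_Kinf)
  then show ?thesis unfolding pt_def julia_eq by blast
qed

lemma zeta_per: "zeta w j + per n = zeta w (j + dw w * n)"
  using Gw_per[of "p0 + per j" w n] p0_strip by (simp add: zeta_def per_add add.assoc)

lemma pt_per: "pt w (j + dw w * n) = pt w j"
  by (simp add: pt_def flip: zeta_per)

lemma per_inj: "per m = per n \<longleftrightarrow> m = n"
  by (auto simp: per_def)

lemma pt_inj:
  assumes "length w = length w'" "pt w j = pt w' j'"
  shows "w = w' \<and> (\<exists>n. j = j' + dw w * n)"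
proof -
  have "exp (zeta w j) = exp (zeta w' j')" using assms(2) inj_stereo by (auto simp: pt_def inj_def)
  then obtain n where "zeta w j = zeta w' (j' + dw w' * n)" unfolding exp_eq_per zeta_per by blast
  then have "w = w' \<and> p0 + per j = p0 + per (j' + dw w' * n)" 
    unfolding zeta_def by (intro Gw_inj assms) (simp_all add: p0_strip)
  then show ?thesis by (auto simp: per_inj)
qed

text \<open>For one word the arguments differ by at least a period. For two words the common prefix
  is split off; after it the letters differ, so the points are separated by \<open>gap\<close>. In
  both cases a step of one period is comparable with the separation before the word, or the prefix,
  is applied, and \<open>Gw_quasisymmetric\<close> transports this.\<close>

lemma zeta_separated:
  "\<exists>K>0. \<forall>w w' j j'. length w = length w' \<and> (w, j) \<noteq> (w', j')
    \<longrightarrow> cmod (zeta w j - zeta w (j + 1)) \<le> K * cmod (zeta w j - zeta w' j')"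
proof -
  define \<delta> where "\<delta> = min (2 * pi) (ln s1 - ln s2)"
  have "0 < \<delta>" using gap_pos by (simp add: \<delta>_def)
  then obtain K where K: "K > 0" "\<And>w x y z. x \<in> strip \<Longrightarrow> y \<in> strip \<Longrightarrow> z \<in> strip \<Longrightarrow> \<delta> \<le> cmod (x - y) \<Longrightarrow> cmod (x - z) \<le> 2 * pi
    \<Longrightarrow> cmod (Gw w x - Gw w z) \<le> K * cmod (Gw w x - Gw w y)"
    using Gw_quasisymmetric[of \<delta> "2 * pi"] by force
  have step: "cmod ((p0 + per j) - (p0 + per (j + 1))) \<le> 2 * pi" for j
    by (simp add: per_add norm_per)
  have "cmod (zeta w j - zeta w (j + 1)) \<le> K * cmod (zeta w j - zeta w' j')"
    if len: "length w = length w'" and ne: "(w, j) \<noteq> (w', j')" for w w' j j'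
  proof (cases "w = w'")
    case True
    then have "j \<noteq> j'" using ne by simp
    then have "1 \<le> \<bar>real_of_int (j - j')\<bar>" by linarith
    then have "2 * pi * 1 \<le> 2 * pi * \<bar>real_of_int (j - j')\<bar>" by (intro mult_left_mono) auto
    also have "\<dots> = cmod ((p0 + per j) - (p0 + per j'))" using norm_per[of "j - j'"] by (simp add: per_diff)
    finally have "\<delta> \<le> cmod ((p0 + per j) - (p0 + per j'))" by (simp add: \<delta>_def)
    then show ?thesis unfolding zeta_def True[symmetric] by (intro K step) (simp_all add: p0_strip)
  next
    case False
    then obtain v b s b' s' where w: "b \<noteq> b'" "w = v @ [b] @ s" "w' = v @ [b'] @ s'"
      using same_length_different[OF False len] by blast
    have z: "zeta w i = Gw v (G b (zeta s i))" "zeta w' i = Gw v (G b' (zeta s' i))" for i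
      by (simp_all add: zeta_def w Gw_append)
    have "\<delta> \<le> cmod (G b (zeta s j) - G b' (zeta s' j'))"
      using gap[OF zeta_strip zeta_strip w(1), of s j s' j'] by (simp add: \<delta>_def)
    moreover have "cmod (G b (zeta s j) - G b (zeta s (j + 1))) \<le> 2 * pi"
      using Gw_nonexpanding[of "p0 + per j" "p0 + per (j + 1)" "b # s"] step[of j] p0_strip
      by (simp add: zeta_def)
    ultimately show ?thesis unfolding z by (intro K G_strip zeta_strip)
  qed
  then show ?thesis using K(1) by blast
qed

lemma stereo_exp_lower:
  "\<exists>m>0. \<forall>a\<in>strip. \<forall>b\<in>strip. \<exists>n. m * cmod (a - (b + per n)) \<le> dist (stereo (Some (exp a))) (stereo (Some (exp b)))"
proof -
  obtain m where m: "m > 0" "\<And>\<delta>. \<bar>Re \<delta>\<bar> \<le> ln rb - ln ra \<Longrightarrow> \<bar>Im \<delta>\<bar> \<le> pi \<Longrightarrow> m * cmod \<delta> \<le> cmod (exp \<delta> - 1)"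
    using exp_minus_one_lower[of "ln rb - ln ra"] by blast
  define q where "q = 2 / (1 + rb\<^sup>2)"
  have q: "q > 0" by (simp add: q_def add_pos_nonneg)
  have "\<exists>n. q * (ra * m) * cmod (a - (b + per n)) \<le> dist (stereo (Some (exp a))) (stereo (Some (exp b)))"
    if ab: "a \<in> strip" "b \<in> strip" for a b
  proof -
    \<comment> \<open>\<open>exp\<close> is injective only up to periods; rounding selects the
      translate of \<open>b\<close> whose imaginary part is nearest to that of
      \<open>a\<close>.\<close>
    define n where "n = round (Im (a - b) / (2 * pi))"
    define \<delta> where "\<delta> = a - (b + per n)"
    have "\<bar>of_int n - Im (a - b) / (2 * pi)\<bar> \<le> 1 / 2" unfolding n_def by (rule of_int_round_abs_le)
    then have "\<bar>of_int n - Im (a - b) / (2 * pi)\<bar> * (2 * pi) \<le> 1 / 2 * (2 * pi)" by (intro mult_right_mono) auto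
    moreover have "\<bar>of_int n - Im (a - b) / (2 * pi)\<bar> * (2 * pi) = \<bar>(of_int n - Im (a - b) / (2 * pi)) * (2 * pi)\<bar>"
      by (simp add: abs_mult)
    moreover have "(of_int n - Im (a - b) / (2 * pi)) * (2 * pi) = - Im \<delta>"
      by (simp add: \<delta>_def field_simps)
    ultimately have "\<bar>Im \<delta>\<bar> \<le> pi" by linarith
    moreover have "\<bar>Re \<delta>\<bar> \<le> ln rb - ln ra" using ab by (auto simp: \<delta>_def strip_def abs_le_iff)
    ultimately have "m * cmod \<delta> \<le> cmod (exp \<delta> - 1)" by (intro m)
    then have "ra * (m * cmod \<delta>) \<le> cmod (exp b) * cmod (exp \<delta> - 1)"
      using norm_exp_strip(2)[OF ab(2)] ra_pos m(1) by (intro mult_mono) auto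
    also have "\<dots> = cmod (exp b * (exp \<delta> - 1))" by (simp only: norm_mult)
    also have "exp b * (exp \<delta> - 1) = exp a - exp b"
    proof -
      have "exp b * exp \<delta> = exp ((b + \<delta>) + per n)" unfolding exp_per by (simp only: exp_add)
      also have "(b + \<delta>) + per n = a" by (simp add: \<delta>_def)
      finally show ?thesis by (simp add: algebra_simps)
    qed
    finally have "q * (ra * (m * cmod \<delta>)) \<le> q * cmod (exp a - exp b)" using q by (intro mult_left_mono) auto
    also have "\<dots> \<le> dist (stereo (Some (exp a))) (stereo (Some (exp b)))"
      unfolding q_def by (intro dist_stereo_ge norm_exp_strip ab)
    finally show ?thesis by (intro exI[of _ n]) (simp add: \<delta>_def mult_ac)
  qed
  moreover have "0 < q * (ra * m)" using q ra_pos m(1) by simp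
  ultimately show ?thesis by blast
qed

lemma stereo_exp_upper:
  assumes "a \<in> strip" "b \<in> strip"
  shows "dist (stereo (Some (exp a))) (stereo (Some (exp b))) \<le> 2 * rb * cmod (a - b)"
  using dist_stereo_le[of "exp a" "exp b"] exp_lip[OF assms] by linarith

text \<open>The period produced by \<open>stereo_exp_lower\<close> is absorbed into the index by
  \<open>zeta_per\<close>, so \<open>zeta_separated\<close> applies to the translate that realises
  the distance on the sphere.\<close>

theorem pt_separated:
  "\<exists>K>0. \<forall>w w' j j'. length w = length w' \<and> pt w j \<noteq> pt w' j'
    \<longrightarrow> dist (pt w j) (pt w (j + 1)) \<le> K * dist (pt w j) (pt w' j')"
proof -
  obtain K where K: "K > 0" "\<And>w w' j j'. length w = length w' \<Longrightarrow> (w, j) \<noteq> (w', j')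
    \<Longrightarrow> cmod (zeta w j - zeta w (j + 1)) \<le> K * cmod (zeta w j - zeta w' j')"
    using zeta_separated by blast
  obtain m where m: "m > 0" "\<And>a b. a \<in> strip \<Longrightarrow> b \<in> strip \<Longrightarrow> \<exists>n. m * cmod (a - (b + per n)) \<le> dist (stereo (Some (exp a))) (stereo (Some (exp b)))"
    using stereo_exp_lower by blast
  have "dist (pt w j) (pt w (j + 1)) \<le> 2 * rb * K / m * dist (pt w j) (pt w' j')"
    if len: "length w = length w'" and ne: "pt w j \<noteq> pt w' j'" for w w' j j'
  proof -
    obtain n where n: "m * cmod (zeta w j - (zeta w' j' + per n)) \<le> dist (pt w j) (pt w' j')"
      using m(2)[OF zeta_strip zeta_strip] unfolding pt_def by blast
    have "(w, j) \<noteq> (w', j' + dw w' * n)" using ne pt_per by auto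
    then have "cmod (zeta w j - zeta w (j + 1)) \<le> K * cmod (zeta w j - (zeta w' j' + per n))"
      unfolding zeta_per by (intro K len)
    then have "m * cmod (zeta w j - zeta w (j + 1)) \<le> m * (K * cmod (zeta w j - (zeta w' j' + per n)))"
      using m(1) by (intro mult_left_mono) auto
    also have "\<dots> \<le> K * dist (pt w j) (pt w' j')" using mult_left_mono[OF n, of K] K(1) by (simp add: mult_ac)
    finally have "cmod (zeta w j - zeta w (j + 1)) \<le> K / m * dist (pt w j) (pt w' j')"
      using m(1) by (simp add: field_simps)
    then have "2 * rb * cmod (zeta w j - zeta w (j + 1)) \<le> 2 * rb * (K / m * dist (pt w j) (pt w' j'))"
      using rb_pos by (intro mult_left_mono) auto
    moreover have "dist (pt w j) (pt w (j + 1)) \<le> 2 * rb * cmod (zeta w j - zeta w (j + 1))"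
      unfolding pt_def by (intro stereo_exp_upper zeta_strip)
    ultimately show ?thesis by (simp add: mult_ac)
  qed
  moreover have "0 < 2 * rb * K / m" using rb_pos K m by simp
  ultimately show ?thesis by blast
qed

text \<open>The lifted points run from \<open>zeta w 0\<close> to its translate by one period in
  steps of at most \<pi>. The first one at distance at least 1 is at distance at most 1 + \<pi>,
  hence at least \<pi> - 1 > 1 from all other translates, so the points on the sphere are far apart
  too.\<close>

theorem pt_spread:
  "\<exists>c0>0. \<forall>w. lam ^ length w \<le> 1 / 2 \<longrightarrow> (\<exists>j::nat. j \<le> nat \<bar>dw w\<bar> \<and> c0 \<le> dist (pt w 0) (pt w (int j)))"
proof -
  obtain m where m: "m > 0" "\<And>a b. a \<in> strip \<Longrightarrow> b \<in> strip \<Longrightarrow> \<exists>n. m * cmod (a - (b + per n)) \<le> dist (stereo (Some (exp a))) (stereo (Some (exp b)))"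
    using stereo_exp_lower by blast
  have "\<exists>j::nat. j \<le> nat \<bar>dw w\<bar> \<and> m \<le> dist (pt w 0) (pt w (int j))" if l: "lam ^ length w \<le> 1 / 2" for w
  proof -
    define N where "N = nat \<bar>dw w\<bar>"
    have "int N = 0 + dw w * sgn (dw w)" unfolding N_def abs_sgn[symmetric] by simp
    then have "zeta w (int N) = zeta w 0 + per (sgn (dw w))" by (simp only: zeta_per)
    then have "cmod (zeta w (int N) - zeta w 0) = 2 * pi" using dw_neq_0[of w] by (cases "0 < dw w") (simp_all add: norm_per)
    then have ex: "1 \<le> cmod (zeta w (int N) - zeta w 0)" using pi_gt3 by linarith
    define j where "j = (LEAST j. 1 \<le> cmod (zeta w (int j) - zeta w 0))"
    have j1: "1 \<le> cmod (zeta w (int j) - zeta w 0)" unfolding j_def by (rule LeastI[where P = "\<lambda>j. 1 \<le> cmod (zeta w (int j) - zeta w 0)", OF ex])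
    have jN: "j \<le> N" unfolding j_def by (rule Least_le[where P = "\<lambda>j. 1 \<le> cmod (zeta w (int j) - zeta w 0)", OF ex])
    have "j \<noteq> 0" using j1 by (cases "j = 0") auto
    then obtain i where i: "j = Suc i" by (cases j) auto
    have "\<not> 1 \<le> cmod (zeta w (int i) - zeta w 0)" using not_less_Least[of i] i unfolding j_def by (metis lessI)
    moreover have "cmod (zeta w (int j) - zeta w (int i)) \<le> pi"
    proof -
      have "cmod (zeta w (int j) - zeta w (int i)) \<le> lam ^ length w * cmod ((p0 + per (int j)) - (p0 + per (int i)))"
        unfolding zeta_def by (intro Gw_lip_lam) (simp_all add: p0_strip)
      also have "(p0 + per (int j)) - (p0 + per (int i)) = per 1" by (simp add: i per_def algebra_simps)
      also have "lam ^ length w * cmod (per 1) \<le> 1 / 2 * cmod (per 1)" by (intro mult_right_mono l) auto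
      finally show ?thesis by (simp add: norm_per)
    qed
    ultimately have j2: "cmod (zeta w (int j) - zeta w 0) \<le> 1 + pi"
      using norm_triangle_ineq[of "zeta w (int j) - zeta w (int i)" "zeta w (int i) - zeta w 0"] by simp
    obtain n where n: "m * cmod (zeta w 0 - (zeta w (int j) + per n)) \<le> dist (pt w 0) (pt w (int j))"
      using m(2)[OF zeta_strip zeta_strip] unfolding pt_def by blast
    have "1 \<le> cmod (zeta w 0 - (zeta w (int j) + per n))"
    proof (cases "n = 0")
      case True
      then show ?thesis using j1 by (simp add: norm_minus_commute)
    next
      case False
      then have "1 \<le> \<bar>real_of_int n\<bar>" by linarith
      then have "2 * pi * 1 \<le> cmod (per n)" unfolding norm_per by (intro mult_left_mono) auto
      then have "2 * pi \<le> cmod (zeta w 0 - (zeta w (int j) + per n)) + cmod (zeta w (int j) - zeta w 0)"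
        using norm_triangle_ineq[of "zeta w 0 - (zeta w (int j) + per n)" "zeta w (int j) - zeta w 0"] by simp
      then show ?thesis using j2 pi_gt3 by linarith
    qed
    then have "m * 1 \<le> m * cmod (zeta w 0 - (zeta w (int j) + per n))" using m(1) by (intro mult_left_mono) auto
    then show ?thesis using n jN by (intro exI[of _ j]) (simp add: N_def)
  qed
  then show ?thesis using m(1) by blast
qed

end

section \<open>Packing bound\<close>

lemma sum_prod_list:
  fixes a :: "'a \<Rightarrow> real"
  assumes "finite A"
  shows "(\<Sum>u | set u \<subseteq> A \<and> length u = n. prod_list (map a u)) = (\<Sum>x\<in>A. a x) ^ n"
proof (induction n)
  case 0
  have "{u. set u \<subseteq> A \<and> length u = 0} = {[]}" by auto
  then show ?case by simp
next
  case (Suc n)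
  have "{u. set u \<subseteq> A \<and> length u = Suc n} = (\<lambda>(x, u). x # u) ` (A \<times> {u. set u \<subseteq> A \<and> length u = n})"
    by (auto simp: length_Suc_conv image_iff)
  then have "(\<Sum>u | set u \<subseteq> A \<and> length u = Suc n. prod_list (map a u))
    = (\<Sum>(x, u)\<in>A \<times> {u. set u \<subseteq> A \<and> length u = n}. a x * prod_list (map a u))"
    by (simp add: sum.reindex inj_on_def case_prod_beta)
  also have "\<dots> = (\<Sum>x\<in>A. a x) * (\<Sum>u | set u \<subseteq> A \<and> length u = n. prod_list (map a u))"
    by (simp add: sum_product sum.cartesian_product)
  finally show ?case by (simp add: Suc)
qed

context mcmullen begin

section \<open>Coding of points at a given scale\<close>

definition lmin :: real where "lmin = min l1 l2"

lemma lmin: "0 < lmin" "lmin \<le> ll b" "lmin \<le> 1"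
  using l1 l2 by (auto simp: lmin_def ll_def)

lemma Lw_Cons: "Lw (b # w) = ll b * Lw w" and Lw_Nil: "Lw [] = 1"
  by (simp_all add: Lw_def)

text \<open>A stopping time: letters are added until the contraction reaches the scale
  \<open>\<rho>\<close>. The recursion passes to \<rho> / ll b, which may exceed 1; hence the
  minimum with 1 and the clause \<open>w = []\<close>. The bound by \<open>lam ^ n\<close> makes the
  induction end.\<close>

lemma Kinf_rep_scale_aux:
  assumes "z \<in> Kinf" "lam ^ n \<le> \<rho>" "0 < \<rho>"
  shows "\<exists>w \<zeta>. \<zeta> \<in> strip \<and> z = exp (Gw w \<zeta>) \<and> Lw w \<le> \<rho> \<and> lmin * min 1 \<rho> \<le> Lw w \<and> (1 \<le> \<rho> \<longrightarrow> w = [])"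
  using assms
proof (induction n arbitrary: z \<rho>)
  case 0
  obtain \<zeta> where "\<zeta> \<in> strip" "z = exp \<zeta>" using Kinf_rep[OF 0(1), of 0] by auto
  then show ?case using 0 lmin(3) by (intro exI[of _ "[]"] exI[of _ \<zeta>]) (auto simp: Lw_Nil)
next
  case (Suc n)
  show ?case
  proof (cases "1 \<le> \<rho>")
    case True
    obtain \<zeta> where "\<zeta> \<in> strip" "z = exp \<zeta>" using Kinf_rep[OF Suc.prems(1), of 0] by auto
    then show ?thesis using True lmin(3) by (intro exI[of _ "[]"] exI[of _ \<zeta>]) (auto simp: Lw_Nil)
  next
    case False
    obtain b \<eta>1 where 1: "\<eta>1 \<in> strip" "exp \<eta>1 = f z" "z = exp (G b \<eta>1)"
      using Kinf_preimage[OF Suc.prems(1)] by blast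
    have "lam ^ n * ll b \<le> lam ^ n * lam" using lam by (intro mult_left_mono) auto
    then have "lam ^ n \<le> \<rho> / ll b" using Suc.prems(2) ll(1)[of b] by (simp add: field_simps)
    moreover have "0 < \<rho> / ll b" using Suc.prems(3) ll(1) by simp
    ultimately obtain w \<zeta> where 2: "\<zeta> \<in> strip" "f z = exp (Gw w \<zeta>)" "Lw w \<le> \<rho> / ll b" "lmin * min 1 (\<rho> / ll b) \<le> Lw w"
      "1 \<le> \<rho> / ll b \<longrightarrow> w = []"
      using Suc.IH[OF Kinf_f[OF Suc.prems(1)]] by blast
    obtain m where "\<eta>1 = Gw w \<zeta> + per m" using 1(2) 2(2) exp_eq_per by metis
    then have "\<eta>1 = Gw w (\<zeta> + per (dw w * m))" using Gw_per[OF 2(1)] by simp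
    then have z: "z = exp (Gw (b # w) (\<zeta> + per (dw w * m)))" using 1(3) by simp
    have up: "Lw (b # w) \<le> \<rho>" using 2(3) ll(1)[of b] by (simp add: Lw_Cons field_simps)
    have "lmin * min 1 \<rho> \<le> Lw (b # w)"
    proof (cases "1 \<le> \<rho> / ll b")
      case True
      then have "Lw (b # w) = ll b" using 2(5) by (simp add: Lw_Cons Lw_Nil)
      moreover have "lmin * min 1 \<rho> \<le> lmin * 1" using lmin(1) by (intro mult_left_mono) auto
      ultimately show ?thesis using lmin(2)[of b] by linarith
    next
      case F: False
      then have "lmin * (\<rho> / ll b) \<le> Lw w" using 2(4) by (simp add: min_def split: if_splits)
      then show ?thesis using False ll(1)[of b] by (simp add: Lw_Cons field_simps min_def)
    qed
    moreover have "\<zeta> + per (dw w * m) \<in> strip" using 2(1) by simp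
    ultimately show ?thesis using z up False by blast
  qed
qed

lemma Kinf_rep_scale:
  assumes "z \<in> Kinf" "0 < \<rho>" "\<rho> \<le> 1"
  shows "\<exists>w \<zeta>. \<zeta> \<in> strip \<and> z = exp (Gw w \<zeta>) \<and> Lw w \<le> \<rho> \<and> lmin * \<rho> \<le> Lw w"
proof -
  obtain n where "lam ^ n < \<rho>" using real_arch_pow_inv[OF assms(2) lam(2)] by blast
  then show ?thesis using Kinf_rep_scale_aux[OF assms(1), of n \<rho>] assms(2,3) by (auto simp: min_def split: if_splits)
qed

text \<open>The 2 + k letters are the single-valued inverse branches of the map: a branch together
  with one residue of the period. Words over \<open>bool\<close> alone forget the residue, so they
  cannot carry the mass distribution.\<close>

definition alphabet :: "(bool \<times> int) set" where
  "alphabet = Sigma UNIV (\<lambda>b. {0..<\<bar>dg b\<bar>})"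

fun Hw :: "(bool \<times> int) list \<Rightarrow> complex \<Rightarrow> complex" where
  "Hw [] \<eta> = \<eta>"
| "Hw (l # s) \<eta> = G (fst l) (Hw s \<eta> + per (snd l))"

lemma Hw_strip: "\<eta> \<in> strip \<Longrightarrow> Hw s \<eta> \<in> strip"
  by (induction s) (auto simp: G_strip)

lemma Hw_append: "Hw (s @ u) \<eta> = Hw s (Hw u \<eta>)"
  by (induction s) auto

lemma Hw_lip: "x \<in> strip \<Longrightarrow> y \<in> strip \<Longrightarrow> cmod (Hw s x - Hw s y) \<le> Lw (map fst s) * cmod (x - y)"
proof (induction s)
  case (Cons l s)
  have "cmod (Hw (l # s) x - Hw (l # s) y) \<le> ll (fst l) * cmod ((Hw s x + per (snd l)) - (Hw s y + per (snd l)))"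
    unfolding Hw.simps using Cons by (intro G_lip) (simp_all add: Hw_strip)
  also have "\<dots> \<le> ll (fst l) * (Lw (map fst s) * cmod (x - y))"
    using Cons ll(1)[of "fst l"] by (intro mult_left_mono) auto
  finally show ?case by (simp add: Lw_Cons mult_ac)
qed (simp add: Lw_Nil)

text \<open>Carrying as in a mixed radix expansion: at each letter the accumulated period is divided
  by |dg b|, the remainder becomes the digit, and the quotient moves outward through
  \<open>G_per\<close>.\<close>

lemma Gw_to_Hw:
  "\<exists>s m'. map fst s = w \<and> set s \<subseteq> alphabet \<and> (\<forall>\<eta>\<in>strip. Gw w (\<eta> + per m) = Hw s \<eta> + per m')"
proof (induction w)
  case Nil
  then show ?case by (intro exI[of _ "[]"] exI[of _ m]) simp
next
  case (Cons b w)
  then obtain s m' where s: "map fst s = w" "set s \<subseteq> alphabet" "\<And>\<eta>. \<eta> \<in> strip \<Longrightarrow> Gw w (\<eta> + per m) = Hw s \<eta> + per m'" by blast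
  define d where "d = \<bar>dg b\<bar>"
  \<comment> \<open>The inner branch has negative degree, so there the carry changes sign.\<close>
  define q where "q = sgn (dg b) * (m' div d)"
  have d: "0 < d" using dg_ge_2[of b] by (simp add: d_def)
  have "dg b * q = (dg b * sgn (dg b)) * (m' div d)" by (simp only: q_def mult.assoc)
  also have "dg b * sgn (dg b) = d" by (simp add: d_def abs_sgn)
  finally have m': "m' = m' mod d + dg b * q" by simp
  have "Gw (b # w) (\<eta> + per m) = Hw ((b, m' mod d) # s) \<eta> + per q" if "\<eta> \<in> strip" for \<eta>
  proof -
    have "Gw (b # w) (\<eta> + per m) = G b ((Hw s \<eta> + per (m' mod d)) + per (dg b * q))"
      using s(3)[OF that] by (subst (asm) m') (simp add: per_add add.assoc)
    also have "\<dots> = G b (Hw s \<eta> + per (m' mod d)) + per q" using that by (intro G_per) (simp add: Hw_strip)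
    finally show ?thesis by simp
  qed
  moreover have "set ((b, m' mod d) # s) \<subseteq> alphabet" using s(2) d by (auto simp: alphabet_def d_def)
  ultimately show ?case using s(1) by (intro exI[of _ "(b, m' mod d) # s"] exI[of _ q]) auto
qed

text \<open>Bounded digits make every letter a contraction that moves \<open>p0\<close> by at most
  \<open>E\<close>, and E / (1 - lam) solves D = lam * D + E.\<close>

lemma Hw_bounded:
  "\<exists>D. \<forall>u. set u \<subseteq> alphabet \<longrightarrow> cmod (Hw u p0 - p0) \<le> D"
proof -
  define E where "E = (\<Sum>b\<in>UNIV. 2 * pi * \<bar>of_int (dg b)\<bar> + cmod (G b p0 - p0))"
  have E: "2 * pi * \<bar>of_int (dg b)\<bar> + cmod (G b p0 - p0) \<le> E" for b
    unfolding E_def by (rule member_le_sum) auto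
  then have E0: "0 \<le> E" by (rule order_trans[rotated]) auto
  have "cmod (Hw u p0 - p0) \<le> E / (1 - lam)" if "set u \<subseteq> alphabet" for u
    using that
  proof (induction u)
    case Nil
    then show ?case using E0 lam by simp
  next
    case (Cons l u)
    define b where "b = fst l"
    have l: "0 \<le> snd l" "snd l < \<bar>dg b\<bar>" using Cons.prems by (auto simp: alphabet_def b_def)
    have "cmod (G b (Hw u p0 + per (snd l)) - G b p0) \<le> ll b * cmod (Hw u p0 + per (snd l) - p0)"
      by (intro G_lip) (simp_all add: Hw_strip p0_strip)
    also have "\<dots> \<le> lam * cmod (Hw u p0 - p0) + 1 * cmod (per (snd l))"
    proof -
      have "ll b * cmod (Hw u p0 + per (snd l) - p0) \<le> ll b * (cmod (Hw u p0 - p0) + cmod (per (snd l)))"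
        using norm_triangle_ineq[of "Hw u p0 - p0" "per (snd l)"] ll(1)[of b] by (intro mult_left_mono) (auto simp: algebra_simps)
      also have "\<dots> = ll b * cmod (Hw u p0 - p0) + ll b * cmod (per (snd l))" by (simp add: algebra_simps)
      also have "\<dots> \<le> lam * cmod (Hw u p0 - p0) + 1 * cmod (per (snd l))"
        using lam(3)[of b] ll(2)[of b] by (intro add_mono mult_right_mono) auto
      finally show ?thesis .
    qed
    also have "\<dots> \<le> lam * (E / (1 - lam)) + 2 * pi * \<bar>of_int (dg b)\<bar>"
    proof -
      have "cmod (per (snd l)) \<le> 2 * pi * \<bar>of_int (dg b)\<bar>"
        unfolding norm_per using l by (intro mult_left_mono) (linarith, simp)
      moreover have "lam * cmod (Hw u p0 - p0) \<le> lam * (E / (1 - lam))" using Cons lam by (intro mult_left_mono) auto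
      ultimately show ?thesis by simp
    qed
    finally have "cmod (G b (Hw u p0 + per (snd l)) - p0) \<le> lam * (E / (1 - lam)) + E"
      using norm_triangle_ineq[of "G b (Hw u p0 + per (snd l)) - G b p0" "G b p0 - p0"] E[of b] by simp
    also have "\<dots> = E / (1 - lam)" using lam by (simp add: field_simps)
    finally show ?case by (simp add: b_def)
  qed
  then show ?thesis by blast
qed

lemma Kinf_cell:
  "\<exists>D>0. \<forall>z\<in>Kinf. \<forall>\<rho>. 0 < \<rho> \<and> \<rho> \<le> 1 \<longrightarrow> (\<exists>s. set s \<subseteq> alphabet \<and> lmin * \<rho> \<le> Lw (map fst s) \<and>
    (\<forall>u. set u \<subseteq> alphabet \<longrightarrow> dist (stereo (Some (exp (Hw (s @ u) p0)))) (stereo (Some z)) \<le> D * \<rho>))"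
proof -
  obtain D0 where D0: "\<And>u. set u \<subseteq> alphabet \<Longrightarrow> cmod (Hw u p0 - p0) \<le> D0" using Hw_bounded by blast
  have "0 \<le> D0" using D0[of "[]"] by simp
  define D1 where "D1 = ln rb - ln ra + 2 * pi + \<bar>Im p0\<bar>"
  define D where "D = 2 * rb * (D0 + D1)"
  have D1: "0 < D1" using ra_rb ra_pos by (simp add: D1_def add_pos_nonneg add_nonneg_pos less_imp_le)
  have "0 < D" using rb_pos D1 \<open>0 \<le> D0\<close> by (simp add: D_def)
  moreover have "\<exists>s. set s \<subseteq> alphabet \<and> lmin * \<rho> \<le> Lw (map fst s) \<and>
    (\<forall>u. set u \<subseteq> alphabet \<longrightarrow> dist (stereo (Some (exp (Hw (s @ u) p0)))) (stereo (Some z)) \<le> D * \<rho>)"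
    if z: "z \<in> Kinf" and \<rho>: "0 < \<rho>" "\<rho> \<le> 1" for z \<rho>
  proof -
    obtain w \<zeta> where w: "\<zeta> \<in> strip" "z = exp (Gw w \<zeta>)" "Lw w \<le> \<rho>" "lmin * \<rho> \<le> Lw w"
      using Kinf_rep_scale[OF z \<rho>] by blast
    \<comment> \<open>Subtracting whole periods brings \<open>\<zeta>\<close> within bounded
      distance of \<open>p0\<close>; \<open>Gw_to_Hw\<close> turns the removed periods into
      digits.\<close>
    define m where "m = \<lfloor>Im \<zeta> / (2 * pi)\<rfloor>"
    define \<xi> where "\<xi> = \<zeta> + per (- m)"
    have \<zeta>: "\<zeta> = \<xi> + per m" by (simp add: \<xi>_def per_minus)
    have \<xi>: "\<xi> \<in> strip" using w(1) by (simp add: \<xi>_def)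
    have "of_int m \<le> Im \<zeta> / (2 * pi)" "Im \<zeta> / (2 * pi) < of_int m + 1" unfolding m_def by linarith+
    then have im: "0 \<le> Im \<xi>" "Im \<xi> \<le> 2 * pi" by (simp_all add: \<xi>_def field_simps)
    have "cmod (p0 - \<xi>) \<le> \<bar>Re (p0 - \<xi>)\<bar> + \<bar>Im (p0 - \<xi>)\<bar>" by (rule cmod_le)
    also have "\<dots> \<le> D1"
    proof -
      have "\<bar>Re (p0 - \<xi>)\<bar> \<le> ln rb - ln ra" using p0_strip \<xi> by (auto simp: strip_def abs_le_iff)
      then show ?thesis using im by (simp add: D1_def) 
    qed
    finally have p\<xi>: "cmod (p0 - \<xi>) \<le> D1" .
    obtain s m' where s: "map fst s = w" "set s \<subseteq> alphabet" "\<And>\<eta>. \<eta> \<in> strip \<Longrightarrow> Gw w (\<eta> + per m) = Hw s \<eta> + per m'"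
      using Gw_to_Hw[of w m] by blast
    have z': "z = exp (Hw s \<xi>)" using w(2) s(3)[OF \<xi>] by (simp add: \<zeta>)
    have "dist (stereo (Some (exp (Hw (s @ u) p0)))) (stereo (Some z)) \<le> D * \<rho>" if u: "set u \<subseteq> alphabet" for u
    proof -
      have Hu: "Hw u p0 \<in> strip" by (simp add: Hw_strip p0_strip)
      have "dist (stereo (Some (exp (Hw (s @ u) p0)))) (stereo (Some z)) \<le> 2 * rb * cmod (Hw s (Hw u p0) - Hw s \<xi>)"
        unfolding z' Hw_append by (intro stereo_exp_upper Hw_strip Hu \<xi>)
      also have "\<dots> \<le> 2 * rb * (\<rho> * (D0 + D1))"
      proof (intro mult_left_mono)
        have "cmod (Hw s (Hw u p0) - Hw s \<xi>) \<le> Lw (map fst s) * cmod (Hw u p0 - \<xi>)" by (rule Hw_lip[OF Hu \<xi>])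
        also have "\<dots> \<le> \<rho> * (D0 + D1)"
        proof (intro mult_mono)
          show "Lw (map fst s) \<le> \<rho>" using w(3) s(1) by simp
          show "cmod (Hw u p0 - \<xi>) \<le> D0 + D1"
            using norm_triangle_ineq[of "Hw u p0 - p0" "p0 - \<xi>"] D0[OF u] p\<xi> by simp
        qed (use \<rho> in auto)
        finally show "cmod (Hw s (Hw u p0) - Hw s \<xi>) \<le> \<rho> * (D0 + D1)" .
      qed (use rb_pos in simp)
      finally show ?thesis by (simp add: D_def mult_ac)
    qed
    then show ?thesis using s w(4) by (intro exI[of _ s]) auto
  qed
  ultimately show ?thesis by blast
qed

text \<open>A letter of branch b gets mass \<open>M b\<close>; these masses add up to 1, and a word
  has at least the p-th power of its contraction as mass. A point of radius r is assigned a word of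
  contraction at least a fixed multiple of r, all continuations of which stay within r / 4.
  Separation makes the sets of continuations disjoint, so the masses of the words add up to at most
  1.\<close>

theorem packing_bound:
  fixes p :: real and M :: "bool \<Rightarrow> real"
  assumes p: "0 < p" and M: "\<And>b. ll b powr p \<le> M b" and M1: "(\<Sum>b\<in>UNIV. \<bar>of_int (dg b)\<bar> * M b) = 1"
  shows "\<exists>C. \<forall>(I :: 'i set) y r. finite I \<longrightarrow> (\<forall>i\<in>I. y i \<in> stereo ` julia R \<and> 0 < r i \<and> r i \<le> 2) \<longrightarrow>
    (\<forall>i\<in>I. \<forall>j\<in>I. i \<noteq> j \<longrightarrow> r i \<le> dist (y i) (y j)) \<longrightarrow> (\<Sum>i\<in>I. r i powr p) \<le> C"
proof -
  obtain D' where D': "D' > 0" "\<And>z \<rho>. z \<in> Kinf \<Longrightarrow> 0 < \<rho> \<Longrightarrow> \<rho> \<le> 1 \<Longrightarrow> \<exists>s. set s \<subseteq> alphabet \<and> lmin * \<rho> \<le> Lw (map fst s) \<and>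
    (\<forall>u. set u \<subseteq> alphabet \<longrightarrow> dist (stereo (Some (exp (Hw (s @ u) p0)))) (stereo (Some z)) \<le> D' * \<rho>)"
    using Kinf_cell by blast
  \<comment> \<open>With this maximum, r \<le> 2 implies r / (4 D) \<le> 1, as
    \<open>Kinf_cell\<close> requires.\<close>
  define D where "D = max 1 D'"
  have D1: "1 \<le> D" "D' \<le> D" by (auto simp: D_def)
  define C where "C = (4 * D / lmin) powr p"
  define wt where "wt s = prod_list (map (M \<circ> fst) s)" for s :: "(bool \<times> int) list"
  define wd where "wd n = {u. set u \<subseteq> alphabet \<and> length u = n}" for n
  have fin: "finite alphabet" by (auto simp: alphabet_def intro!: finite_SigmaI)
  have finw: "finite (wd n)" for n unfolding wd_def by (rule finite_lists_length_eq[OF fin])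
  have M0: "0 < M b" for b using M[of b] ll(1)[of b] by (smt (verit) powr_gt_zero)
  have wt0: "0 \<le> wt s" for s by (induction s) (auto simp: wt_def less_imp_le[OF M0])
  have wt_app: "wt (s @ u) = wt s * wt u" for s u by (simp add: wt_def)
  have "(\<Sum>l\<in>alphabet. (M \<circ> fst) l) = (\<Sum>b\<in>UNIV. \<Sum>m\<in>{0..<\<bar>dg b\<bar>}. M b)"
    unfolding alphabet_def by (subst sum.Sigma) (auto simp: case_prod_beta)
  also have "\<dots> = 1" unfolding M1[symmetric] by (intro sum.cong refl) simp
  finally have "(\<Sum>l\<in>alphabet. (M \<circ> fst) l) = 1" .
  then have tot: "(\<Sum>u\<in>wd n. wt u) = 1" for n
    using sum_prod_list[OF fin, of "M \<circ> fst" n] by (simp add: wt_def wd_def)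
  have wtL: "Lw (map fst s) powr p \<le> wt s" for s
  proof (induction s)
    case (Cons l s)
    have "Lw (map fst (l # s)) powr p = ll (fst l) powr p * Lw (map fst s) powr p"
      using ll(1) Lw_pos by (simp add: Lw_Cons powr_mult less_imp_le)
    also have "\<dots> \<le> M (fst l) * wt s" using M Cons M0 by (intro mult_mono) (auto intro: less_imp_le)
    finally show ?case by (simp add: wt_def)
  qed (simp add: wt_def Lw_Nil)
  have "(\<Sum>i\<in>I. r i powr p) \<le> C"
    if I: "finite I" and yr: "\<forall>i\<in>I. y i \<in> stereo ` julia R \<and> 0 < r i \<and> r i \<le> 2"
      and sep: "\<forall>i\<in>I. \<forall>j\<in>I. i \<noteq> j \<longrightarrow> r i \<le> dist (y i) (y j)" for I :: "'i set" and y r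
  proof -
    have "\<exists>s. set s \<subseteq> alphabet \<and> lmin * (r i / (4 * D)) \<le> Lw (map fst s) \<and>
      (\<forall>u. set u \<subseteq> alphabet \<longrightarrow> dist (stereo (Some (exp (Hw (s @ u) p0)))) (y i) \<le> r i / 4)" if i: "i \<in> I" for i
    proof -
      obtain z where z: "z \<in> Kinf" "y i = stereo (Some z)" using yr i by (auto simp: julia_eq)
      have r: "0 < r i / (4 * D)" "r i / (4 * D) \<le> 1" using yr i D1 by (auto simp: field_simps)
      have "D' * (r i / (4 * D)) \<le> D * (r i / (4 * D))" using D1 r by (intro mult_right_mono) auto
      also have "\<dots> = r i / 4" using D1 by simp
      finally have "D' * (r i / (4 * D)) \<le> r i / 4" .
      then show ?thesis using D'(2)[OF z(1) r] unfolding z(2) by (meson order_trans)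
    qed
    then obtain s where s: "\<And>i. i \<in> I \<Longrightarrow> set (s i) \<subseteq> alphabet" "\<And>i. i \<in> I \<Longrightarrow> lmin * (r i / (4 * D)) \<le> Lw (map fst (s i))"
      "\<And>i u. i \<in> I \<Longrightarrow> set u \<subseteq> alphabet \<Longrightarrow> dist (stereo (Some (exp (Hw (s i @ u) p0)))) (y i) \<le> r i / 4"
      by metis
    have rw: "r i powr p \<le> C * wt (s i)" if i: "i \<in> I" for i
    proof -
      have "r i \<le> 4 * D / lmin * Lw (map fst (s i))" using s(2)[OF i] D1 lmin(1) by (simp add: field_simps)
      then have "r i powr p \<le> (4 * D / lmin * Lw (map fst (s i))) powr p" using yr i p by (intro powr_mono2) auto
      also have "\<dots> = C * Lw (map fst (s i)) powr p" unfolding C_def by (rule powr_mult)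
      also have "\<dots> \<le> C * wt (s i)" by (intro mult_left_mono wtL) (simp add: C_def)
      finally show ?thesis .
    qed
    \<comment> \<open>Words of different lengths are compared after extension to a common length;
      extending keeps the mass because each level has total mass 1.\<close>
    define N where "N = Max (insert 0 ((\<lambda>i. length (s i)) ` I))"
    have N: "length (s i) \<le> N" if "i \<in> I" for i unfolding N_def using I that by (intro Max_ge) auto
    define Us where "Us i = (\<lambda>u. s i @ u) ` wd (N - length (s i))" for i
    have Us: "Us i \<subseteq> wd N" if "i \<in> I" for i using s(1)[OF that] N[OF that] by (auto simp: Us_def wd_def)
    have sumU: "(\<Sum>u\<in>Us i. wt u) = wt (s i)" for i
      unfolding Us_def by (subst sum.reindex) (auto simp: inj_on_def wt_app tot simp flip: sum_distrib_left)
    have disj: "Us i \<inter> Us j = {}" if ij: "i \<in> I" "j \<in> I" "i \<noteq> j" for i j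
    proof (rule ccontr)
      assume "Us i \<inter> Us j \<noteq> {}"
      then obtain u v where u: "s i @ u = s j @ v" "set u \<subseteq> alphabet" "set v \<subseteq> alphabet" by (auto simp: Us_def wd_def)
      define q where "q = stereo (Some (exp (Hw (s i @ u) p0)))"
      have "dist q (y i) \<le> r i / 4" "dist q (y j) \<le> r j / 4" 
        using s(3)[OF ij(1) u(2)] s(3)[OF ij(2) u(3)] by (auto simp: q_def u(1))
      \<comment> \<open>Both radii are at most the distance, so the two quarters fill at most half
        of it.\<close>
      then have "dist (y i) (y j) \<le> r i / 4 + r j / 4" using dist_triangle3[of "y i" "y j" q] by linarith
      moreover have "r i \<le> dist (y i) (y j)" "r j \<le> dist (y i) (y j)" using sep ij by (metis dist_commute)+
      moreover have "0 < r i" using yr ij by blast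
      ultimately show False by linarith
    qed
    have "(\<Sum>i\<in>I. wt (s i)) = (\<Sum>i\<in>I. \<Sum>u\<in>Us i. wt u)" by (simp add: sumU)
    also have "\<dots> = (\<Sum>u\<in>(\<Union>i\<in>I. Us i). wt u)"
      using I finw disj by (intro sum.UNION_disjoint[symmetric]) (auto simp: Us_def)
    also have "\<dots> \<le> (\<Sum>u\<in>wd N. wt u)" using Us by (intro sum_mono2 finw wt0) blast
    finally have "(\<Sum>i\<in>I. wt (s i)) \<le> 1" by (simp add: tot)
    have "(\<Sum>i\<in>I. r i powr p) \<le> (\<Sum>i\<in>I. C * wt (s i))" by (intro sum_mono rw)
    also have "\<dots> = C * (\<Sum>i\<in>I. wt (s i))" by (simp add: sum_distrib_left)
    also have "\<dots> \<le> C * 1" using \<open>(\<Sum>i\<in>I. wt (s i)) \<le> 1\<close> by (intro mult_left_mono) (auto simp: C_def)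
    finally show ?thesis by simp
  qed
  then show ?thesis by blast
qed

end

section \<open>Length-area argument\<close>

lemma dist_chain_le:
  fixes y :: "nat \<Rightarrow> 'a::metric_space"
  shows "dist (y 0) (y n) \<le> (\<Sum>i<n. dist (y i) (y (Suc i)))"
proof (induction n)
  case (Suc n)
  then show ?case using dist_triangle[of "y 0" "y (Suc n)" "y n"] by simp
qed simp

text \<open>Reduces the rational powers in the final numerical check to integer powers.\<close>

lemma powr_divide_le:
  fixes x y :: real
  assumes "0 < x" "0 < y" "0 < b" "x ^ a \<le> y ^ b"
  shows "x powr (real a / real b) \<le> y"
proof -
  have "x powr (real a / real b) = (x ^ a) powr (1 / real b)"
    using assms(1) by (simp add: powr_powr flip: powr_realpow)
  also have "\<dots> \<le> (y ^ b) powr (1 / real b)"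
    using assms by (intro powr_mono2) auto
  also have "\<dots> = y"
    using assms(2,3) by (simp add: powr_powr flip: powr_realpow)
  finally show ?thesis .
qed

context mcmullen begin

lemma dw_ge: "w \<noteq> [] \<Longrightarrow> 2 \<le> \<bar>dw w\<bar>"
proof (induction w)
  case (Cons b w)
  have "1 \<le> \<bar>dw w\<bar>" using dw_neq_0[of w] by linarith
  then have "2 * 1 \<le> \<bar>dg b\<bar> * \<bar>dw w\<bar>" using dg_ge_2[of b] by (intro mult_mono) auto
  then show ?case by (simp add: abs_mult)
qed simp

text \<open>One index from each residue class modulo \<open>dw w\<close>: by \<open>pt_per\<close>
  and \<open>pt_inj\<close> this lists the marked points of level n without repetition.\<close>

definition cells :: "nat \<Rightarrow> (bool list \<times> nat) set" where
  "cells n = Sigma {w. length w = n} (\<lambda>w. {..<nat \<bar>dw w\<bar>})"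

lemma finite_words: "finite {w :: bool list. length w = n}"
  using finite_lists_length_eq[of "UNIV :: bool set" n] by simp

lemma finite_cells: "finite (cells n)"
  unfolding cells_def by (intro finite_SigmaI finite_words) auto

lemma cells_pt_inj:
  assumes "(w, j) \<in> cells n" "(w', j') \<in> cells n" "pt w (int j) = pt w' (int j')"
  shows "(w, j) = (w', j')"
proof -
  have "w = w' \<and> (\<exists>i. int j = int j' + dw w * i)"
    using assms by (intro pt_inj) (auto simp: cells_def)
  then obtain i where i: "w = w'" "int j = int j' + dw w * i" by blast
  have "\<bar>int j - int j'\<bar> < \<bar>dw w\<bar>" using assms(1,2) i(1) by (auto simp: cells_def)
  moreover have "\<bar>int j - int j'\<bar> = \<bar>dw w\<bar> * \<bar>i\<bar>" using i(2) by (simp add: abs_mult)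
  moreover have "\<bar>dw w\<bar> * 1 \<le> \<bar>dw w\<bar> * \<bar>i\<bar>" if "i \<noteq> 0" using that by (intro mult_left_mono) auto
  ultimately have "i = 0" by linarith
  then show ?thesis using i by simp
qed

text \<open>The length-area estimate: the weighted lengths bound the total area from below by
  Hoelder's inequality, which is used in the form of Young's inequality with a free scale \<open>t\<close>.\<close>

lemma length_area:
  fixes p q :: real and m :: "bool \<Rightarrow> real" and D :: "bool list \<Rightarrow> nat \<Rightarrow> real"
  assumes pq: "1 < p" "1 < q" "1 / p + 1 / q = 1"
    and m: "\<And>b. 0 < m b" "(\<Sum>b\<in>UNIV. m b) = 1" "(\<Sum>b\<in>UNIV. \<bar>of_int (dg b)\<bar> * m b powr q) < 1"
    and D: "\<And>w j. 0 \<le> D w j"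
    and c0: "0 < c0" and len: "\<And>w. n0 \<le> length w \<Longrightarrow> c0 \<le> (\<Sum>j<nat \<bar>dw w\<bar>. D w j)"
    and area: "\<And>n. n0 \<le> n \<Longrightarrow> (\<Sum>(w, j)\<in>cells n. D w j powr p) \<le> C"
  shows False
proof -
  define \<theta> where "\<theta> = (\<Sum>b\<in>UNIV. \<bar>of_int (dg b)\<bar> * m b powr q)"
  have \<theta>: "0 \<le> \<theta>" "\<theta> < 1" using m(3) by (auto simp: \<theta>_def intro!: sum_nonneg)
  define mw where "mw w = prod_list (map m w)" for w
  have mw0: "0 < mw w" for w by (induction w) (auto simp: mw_def m)
  have mw1: "(\<Sum>w | length w = n. mw w) = 1" for n
    using sum_prod_list[of "UNIV :: bool set" m n] m(2) by (simp add: mw_def)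
  have "prod_list (map (\<lambda>b. \<bar>of_int (dg b)\<bar> * m b powr q) w) = \<bar>of_int (dw w)\<bar> * mw w powr q" for w
    by (induction w) (simp_all add: mw_def abs_mult powr_mult)
  then have mwq: "(\<Sum>w | length w = n. \<bar>of_int (dw w)\<bar> * mw w powr q) = \<theta> ^ n" for n
    using sum_prod_list[of "UNIV :: bool set" "\<lambda>b. \<bar>of_int (dg b)\<bar> * m b powr q" n] by (simp add: \<theta>_def)
  have C0: "0 \<le> C" using area[of n0] by (rule order_trans[rotated]) (auto intro!: sum_nonneg)
  \<comment> \<open>\<open>u\<close> makes the area term at most c0 / 2; \<open>t\<close> is then
    chosen with t powr - p = u, and \<open>n\<close> so large that the remaining term is below c0 /
    2. The summand 1 in \<open>C + 1\<close> allows C = 0.\<close>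
  define u where "u = c0 / (2 * (C + 1))"
  have u0: "0 < u" using c0 C0 by (simp add: u_def)
  define t where "t = u powr (- 1 / p)"
  have t0: "0 < t" using u0 by (simp add: t_def)
  have tp: "t powr (- p) = u" unfolding t_def powr_powr using u0 pq(1) by simp
  define s where "s = t powr q / q"
  have s0: "0 < s" using t0 pq(2) by (simp add: s_def)
  obtain n1 where n1: "\<theta> ^ n1 < c0 / (2 * s)" using real_arch_pow_inv[of "c0 / (2 * s)" \<theta>] c0 s0 \<theta> by auto
  define n where "n = max n0 n1"
  have "\<theta> ^ n \<le> \<theta> ^ n1" using \<theta> by (intro power_decreasing) (auto simp: n_def)
  then have "\<theta> ^ n < c0 / (2 * s)" using n1 by linarith
  then have sn: "s * \<theta> ^ n < c0 / 2" using s0 by (simp add: field_simps)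
  have n0: "n0 \<le> n" by (simp add: n_def)
  have young: "mw w * D w j \<le> t powr (- p) / p * D w j powr p + s * mw w powr q" for w j
  proof -
    have "(D w j / t) * (t * mw w) \<le> (D w j / t) powr p / p + (t * mw w) powr q / q"
      using D mw0[of w] t0 by (intro Youngs_inequality pq) (auto intro: less_imp_le)
    moreover have "(D w j / t) powr p = t powr (- p) * D w j powr p"
      using t0 D[of w j] by (simp add: powr_divide powr_minus_divide)
    moreover have "(t * mw w) powr q = t powr q * mw w powr q" by (rule powr_mult)
    ultimately show ?thesis using t0 by (simp add: s_def mult_ac)
  qed
  have "c0 = (\<Sum>w | length w = n. mw w * c0)" by (simp add: mw1 flip: sum_distrib_right)
  also have "\<dots> \<le> (\<Sum>w | length w = n. mw w * (\<Sum>j<nat \<bar>dw w\<bar>. D w j))"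
    using len n0 mw0 by (intro sum_mono mult_left_mono) (auto intro: less_imp_le)
  also have "\<dots> = (\<Sum>w | length w = n. \<Sum>j<nat \<bar>dw w\<bar>. mw w * D w j)" by (simp add: sum_distrib_left)
  also have "\<dots> \<le> (\<Sum>w | length w = n. \<Sum>j<nat \<bar>dw w\<bar>. t powr (- p) / p * D w j powr p + s * mw w powr q)"
    by (intro sum_mono young)
  also have "\<dots> = t powr (- p) / p * (\<Sum>w | length w = n. \<Sum>j<nat \<bar>dw w\<bar>. D w j powr p)
      + s * (\<Sum>w | length w = n. \<bar>of_int (dw w)\<bar> * mw w powr q)"
    by (simp add: sum.distrib sum_distrib_left mult_ac)
  also have "(\<Sum>w | length w = n. \<Sum>j<nat \<bar>dw w\<bar>. D w j powr p) = (\<Sum>(w, j)\<in>cells n. D w j powr p)"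
    unfolding cells_def by (rule sum.Sigma) (auto simp: finite_words)
  also have "t powr (- p) / p * (\<Sum>(w, j)\<in>cells n. D w j powr p) \<le> t powr (- p) / p * C"
    using area[OF n0] pq(1) by (intro mult_left_mono) auto
  also have "t powr (- p) / p * C \<le> c0 / 2"
  proof -
    have "1 * (C + 1) \<le> p * (C + 1)" using C0 pq(1) by (intro mult_right_mono) auto
    then have "c0 * C \<le> c0 * (p * (C + 1))" using c0 by (intro mult_left_mono) auto
    moreover have pos: "0 < p * (C + 1)" using pq(1) C0 by simp
    ultimately have le: "c0 * C / (p * (C + 1)) \<le> c0" by (simp only: pos_divide_le_eq)
    have "u / p * C = c0 * C / (p * (C + 1)) / 2" by (simp add: u_def)
    also have "\<dots> \<le> c0 / 2" by (rule divide_right_mono[OF le]) simp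
    finally show ?thesis unfolding tp .
  qed
  also note mwq
  finally show False using sn by simp
qed

text \<open>The target enters only through \<open>diam\<close> and \<open>pack\<close>, the
  exponents of the estimate only through the degrees of the source. The images of the marked points,
  with the distances to the next image divided by \<open>H\<close> as radii, form a separated
  family, so \<open>pack\<close> contradicts \<open>length_area\<close>.\<close>

theorem no_quasisymmetric:
  fixes Y :: "'b::metric_space set" and p q :: real and m :: "bool \<Rightarrow> real"
  assumes pq: "1 < p" "1 < q" "1 / p + 1 / q = 1"
    and m: "\<And>b. 0 < m b" "(\<Sum>b\<in>UNIV. m b) = 1" "(\<Sum>b\<in>UNIV. \<bar>of_int (dg b)\<bar> * m b powr q) < 1"
    and hom: "homeomorphism (stereo ` julia R) Y h h'" and qs: "quasisymmetric (stereo ` julia R) h"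
    and diam: "\<And>y y'. y \<in> Y \<Longrightarrow> y' \<in> Y \<Longrightarrow> dist y y' \<le> B"
    and pack: "\<And>(I :: (bool list \<times> nat) set) y r. finite I \<Longrightarrow> (\<And>i. i \<in> I \<Longrightarrow> y i \<in> Y \<and> 0 < r i \<and> r i \<le> B) \<Longrightarrow>
      (\<And>i j. i \<in> I \<Longrightarrow> j \<in> I \<Longrightarrow> i \<noteq> j \<Longrightarrow> r i \<le> dist (y i) (y j)) \<Longrightarrow> (\<Sum>i\<in>I. r i powr p) \<le> C"
  shows False
proof -
  let ?J = "stereo ` julia R"
  obtain \<eta> \<eta>' where \<eta>: "homeomorphism {0::real..} {0..} \<eta> \<eta>'"
    and q: "\<forall>x\<in>?J. \<forall>a\<in>?J. \<forall>b\<in>?J. x \<noteq> a \<and> x \<noteq> b \<and> a \<noteq> b \<longrightarrow>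
      dist (h x) (h a) / dist (h x) (h b) \<le> \<eta> (dist x a / dist x b)"
    using qs unfolding quasisymmetric_def by (elim exE conjE)
  have qsd: "dist (h x) (h a) / dist (h x) (h b) \<le> \<eta> (dist x a / dist x b)"
    if "x \<in> ?J" "a \<in> ?J" "b \<in> ?J" "x \<noteq> a" "x \<noteq> b" "a \<noteq> b" for x a b
    using q[rule_format, OF that(1-3)] that(4-6) by simp
  have hY: "h x \<in> Y" if "x \<in> ?J" for x using hom that by (auto simp: homeomorphism_def)
  have h'h: "h' (h x) = x" if "x \<in> ?J" for x using hom that by (auto simp: homeomorphism_def)
  have h_inj: "h x \<noteq> h x'" if "x \<in> ?J" "x' \<in> ?J" "x \<noteq> x'" for x x' using h'h that by metis
  obtain K where K: "K > 0" "\<And>w w' j j'. length w = length w' \<Longrightarrow> pt w j \<noteq> pt w' j'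
    \<Longrightarrow> dist (pt w j) (pt w (j + 1)) \<le> K * dist (pt w j) (pt w' j')"
    using pt_separated by blast
  obtain c0 where c0: "c0 > 0" "\<And>w. lam ^ length w \<le> 1 / 2 \<Longrightarrow> \<exists>j::nat. j \<le> nat \<bar>dw w\<bar> \<and> c0 \<le> dist (pt w 0) (pt w (int j))"
    using pt_spread by blast
  have "continuous_on {0..K} \<eta>"
    using \<eta> by (auto simp: homeomorphism_def intro: continuous_on_subset)
  then have "bounded (\<eta> ` {0..K})" by (intro compact_imp_bounded compact_continuous_image) auto
  then obtain H0 where "\<forall>s\<in>{0..K}. \<bar>\<eta> s\<bar> \<le> H0" unfolding bounded_real by auto
  then have H0: "\<eta> s \<le> H0" if "0 \<le> s" "s \<le> K" for s using that by force
  define H where "H = max 1 H0"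
  have H1: "1 \<le> H" by (simp add: H_def)
  have step: "dist (h (pt w j)) (h (pt w (j + 1))) \<le> H * dist (h (pt w j)) (h (pt w' j'))"
    if "length w = length w'" "pt w j \<noteq> pt w' j'" for w w' j j'
  \<comment> \<open>Quasisymmetry speaks about distinct triples only; in the degenerate cases the
    claim reduces to \<open>1 \<le> H\<close> or to a left side 0.\<close>
  proof (cases "pt w (j + 1) = pt w' j' \<or> pt w (j + 1) = pt w j")
    case True
    then show ?thesis using mult_right_mono[OF H1, of "dist (h (pt w j)) (h (pt w' j'))"] H1 by (auto intro!: mult_nonneg_nonneg)
  next
    case False
    have pos: "0 < dist (pt w j) (pt w' j')" "0 < dist (h (pt w j)) (h (pt w' j'))"
      using that(2) h_inj[OF pt_julia pt_julia that(2)] by auto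
    have "dist (pt w j) (pt w (j + 1)) / dist (pt w j) (pt w' j') \<le> K"
      using K(2)[OF that] pos(1) by (simp add: divide_le_eq)
    then have "\<eta> (dist (pt w j) (pt w (j + 1)) / dist (pt w j) (pt w' j')) \<le> H"
      using H0 by (force simp: H_def le_max_iff_disj)
    then have "dist (h (pt w j)) (h (pt w (j + 1))) / dist (h (pt w j)) (h (pt w' j')) \<le> H"
      using qsd[OF pt_julia pt_julia pt_julia, of w j w "j + 1" w' j'] False that(2) by fastforce
    then show ?thesis using pos(2) by (simp add: divide_le_eq)
  qed
  have "compact ?J"
    using julia_homeomorphic homeomorphic_compactness compact_cantor_set by (metis compact_Times compact_sphere)
  then have "compact Y" using hom by (metis compact_continuous_image homeomorphism_def)
  \<comment> \<open>Uniform continuity of the inverse keeps points at distance \<open>c0\<close>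
    from having images closer than \<delta>, which bounds the lengths of the image chains from
    below.\<close>
  then have "uniformly_continuous_on Y h'"
    using hom by (intro compact_uniformly_continuous) (auto simp: homeomorphism_def)
  then obtain \<delta> where \<delta>: "\<delta> > 0" "\<And>y y'. y \<in> Y \<Longrightarrow> y' \<in> Y \<Longrightarrow> dist y' y < \<delta> \<Longrightarrow> dist (h' y') (h' y) < c0"
    unfolding uniformly_continuous_on_def using c0(1) by metis
  obtain n1 where n1: "lam ^ n1 < 1 / 2" using real_arch_pow_inv[of "1/2" lam] lam by auto
  define D where "D w j = dist (h (pt w (int j))) (h (pt w (int j + 1)))" for w and j :: nat
  have len: "\<delta> \<le> (\<Sum>j<nat \<bar>dw w\<bar>. D w j)" if "Suc n1 \<le> length w" for w
  proof -
    have "lam ^ length w \<le> lam ^ n1" using that lam by (intro power_decreasing) auto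
    then obtain j where j: "j \<le> nat \<bar>dw w\<bar>" "c0 \<le> dist (pt w 0) (pt w (int j))" using c0(2)[of w] n1 by auto
    have "\<not> dist (h (pt w 0)) (h (pt w (int j))) < \<delta>"
    proof
      assume "dist (h (pt w 0)) (h (pt w (int j))) < \<delta>"
      then have "dist (h' (h (pt w 0))) (h' (h (pt w (int j)))) < c0" by (intro \<delta>(2) hY pt_julia)
      then show False using j(2) by (simp only: h'h[OF pt_julia])
    qed
    then have "\<delta> \<le> dist (h (pt w (int 0))) (h (pt w (int j)))" by simp
    also have "\<dots> \<le> (\<Sum>i<j. dist (h (pt w (int i))) (h (pt w (int (Suc i)))))"
      by (rule dist_chain_le[where y = "\<lambda>i. h (pt w (int i))"])
    also have "\<dots> = (\<Sum>i<j. D w i)" by (simp add: D_def add.commute)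
    also have "\<dots> \<le> (\<Sum>j<nat \<bar>dw w\<bar>. D w j)" using j(1) by (intro sum_mono2) (auto simp: D_def)
    finally show ?thesis .
  qed
  have area: "(\<Sum>(w, j)\<in>cells n. D w j powr p) \<le> H powr p * C" if n: "Suc n1 \<le> n" for n
  proof -
    define r where "r i = D (fst i) (snd i) / H" for i
    \<comment> \<open>Since n > 0, the degree of the word is at least 2 in modulus and 1 is not a
      multiple of it.\<close>
    have ne: "pt w (int j) \<noteq> pt w (int j + 1)" if w: "(w, j) \<in> cells n" for w j
    proof
      assume "pt w (int j) = pt w (int j + 1)"
      then obtain i where "int j = int j + 1 + dw w * i" using pt_inj[of w w] by blast
      then have "dw w * (- i) = 1" by simp
      then have "dw w dvd 1" by (metis dvd_triv_left)
      moreover have "w \<noteq> []" using w n by (auto simp: cells_def)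
      ultimately show False using dw_ge[of w] by auto
    qed
    have "(\<Sum>i\<in>cells n. r i powr p) \<le> C"
    proof (rule pack[OF finite_cells, where y = "\<lambda>i. h (pt (fst i) (int (snd i)))"])
      fix i assume i: "i \<in> cells n"
      have D0: "0 < D (fst i) (snd i)"
        using h_inj[OF pt_julia pt_julia ne[of "fst i" "snd i"]] i by (simp add: D_def)
      have "r i \<le> D (fst i) (snd i)" using D0 H1 by (simp add: r_def divide_le_eq)
      also have "\<dots> \<le> B" unfolding D_def by (intro diam hY pt_julia)
      finally show "h (pt (fst i) (int (snd i))) \<in> Y \<and> 0 < r i \<and> r i \<le> B"
        using D0 H1 hY[OF pt_julia] by (simp add: r_def)
    next
      fix i i' assume i: "i \<in> cells n" "i' \<in> cells n" "i \<noteq> i'"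
      then have "pt (fst i) (int (snd i)) \<noteq> pt (fst i') (int (snd i'))"
        using cells_pt_inj[of "fst i" "snd i" n "fst i'" "snd i'"] by auto
      then have "D (fst i) (snd i) \<le> H * dist (h (pt (fst i) (int (snd i)))) (h (pt (fst i') (int (snd i'))))"
        unfolding D_def using i by (intro step) (auto simp: cells_def)
      then show "r i \<le> dist (h (pt (fst i) (int (snd i)))) (h (pt (fst i') (int (snd i'))))"
        using H1 by (simp add: r_def divide_le_eq mult.commute)
    qed
    then have "H powr p * (\<Sum>i\<in>cells n. r i powr p) \<le> H powr p * C" by (intro mult_left_mono) auto
    moreover have "H powr p * (\<Sum>i\<in>cells n. r i powr p) = (\<Sum>i\<in>cells n. D (fst i) (snd i) powr p)"
      unfolding sum_distrib_left using H1 by (intro sum.cong refl) (simp add: r_def powr_divide)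
    ultimately show ?thesis by (simp add: case_prod_beta)
  qed
  show False by (rule length_area[OF pq m _ \<delta>(1) len area]) (auto simp: D_def)
qed

end

text \<open>The exponent \<open>7 / 4\<close> lies strictly between the conformal dimensions \<open>1 + \<alpha>\<close> of the two Julia
  sets, where \<open>2 powr - \<alpha> + k powr - \<alpha> = 1\<close> (\<open>\<alpha> \<approx> 0.69\<close> for \<open>k = 4\<close> and
  \<open>\<alpha> \<approx> 0.79\<close> for \<open>k = 3\<close>); the weights below witness this on either side.\<close>

lemma mcmullen_3: "mcmullen (1 / 10 ^ 9) 3 (9 / 10 ^ 4) (5 / 4) (28 / 10 ^ 3) (115 / 10 ^ 4) (582 / 10 ^ 4) (2012 / 10 ^ 4) (6 / 10) (6 / 10)"
proof
  fix x :: real assume x: "115 / 10 ^ 4 < x" "x < 28 / 10 ^ 3"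
  \<comment> \<open>The increasing term is bounded at the right end and the decreasing one at the
    left end; the range is cut finely enough for this to suffice.\<close>
  have est: "x\<^sup>2 + 1 / 10 ^ 9 / x ^ 3 \<le> b\<^sup>2 + 1 / 10 ^ 9 / a ^ 3" if "0 < a" "a \<le> x" "x \<le> b" for a b
  proof (intro add_mono divide_left_mono)
    show "0 < x ^ 3 * a ^ 3" using that by simp
  qed (use that in \<open>auto intro!: power_mono\<close>)
  consider "x \<le> 13 / 10 ^ 3" | "13 / 10 ^ 3 \<le> x" "x \<le> 20 / 10 ^ 3" | "20 / 10 ^ 3 \<le> x" "x \<le> 25 / 10 ^ 3" | "25 / 10 ^ 3 \<le> x"
    by linarith
  then show "x\<^sup>2 + 1 / 10 ^ 9 / x ^ 3 < 9 / 10 ^ 4"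
  proof cases
    case 1
    show ?thesis by (rule le_less_trans[OF est[of "115 / 10 ^ 4" "13 / 10 ^ 3"]]) (use 1 x in \<open>simp_all add: power_divide\<close>)
  next
    case 2
    show ?thesis by (rule le_less_trans[OF est[of "13 / 10 ^ 3" "20 / 10 ^ 3"]]) (use 2 in \<open>simp_all add: power_divide\<close>)
  next
    case 3
    show ?thesis by (rule le_less_trans[OF est[of "20 / 10 ^ 3" "25 / 10 ^ 3"]]) (use 3 in \<open>simp_all add: power_divide\<close>)
  next
    case 4
    show ?thesis by (rule le_less_trans[OF est[of "25 / 10 ^ 3" "28 / 10 ^ 3"]]) (use 4 x in \<open>simp_all add: power_divide\<close>)
  qed
qed (simp_all add: power_divide)

text \<open>The constants 51/100 and 252/1000 stay close to 1/2 and 1/4 because their powers enter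
  the packing bound; for k = 3 any constants below 1 serve, hence the coarser 6/10 there.\<close>

lemma mcmullen_4: "mcmullen (1 / 10 ^ 20) 4 (9 / 10 ^ 6) (5 / 4) (28 / 10 ^ 4) (19 / 10 ^ 5) (21 / 10 ^ 6) (48 / 10 ^ 4) (51 / 10 ^ 2) (252 / 10 ^ 3)"
proof
  fix x :: real assume x: "19 / 10 ^ 5 < x" "x < 28 / 10 ^ 4"
  have est: "x\<^sup>2 + 1 / 10 ^ 20 / x ^ 4 \<le> b\<^sup>2 + 1 / 10 ^ 20 / a ^ 4" if "0 < a" "a \<le> x" "x \<le> b" for a b
  proof (intro add_mono divide_left_mono)
    show "0 < x ^ 4 * a ^ 4" using that by simp
  qed (use that in \<open>auto intro!: power_mono\<close>)
  consider "x \<le> 1 / 10 ^ 3" | "1 / 10 ^ 3 \<le> x" by linarith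
  then show "x\<^sup>2 + 1 / 10 ^ 20 / x ^ 4 < 9 / 10 ^ 6"
  proof cases
    case 1
    show ?thesis by (rule le_less_trans[OF est[of "19 / 10 ^ 5" "1 / 10 ^ 3"]]) (use 1 x in \<open>simp_all add: power_divide\<close>)
  next
    case 2
    show ?thesis by (rule le_less_trans[OF est[of "1 / 10 ^ 3" "28 / 10 ^ 4"]]) (use 2 x in \<open>simp_all add: power_divide\<close>)
  qed
qed (simp_all add: power_divide)

section \<open>Numerical comparison of the two maps at the exponent 7/4\<close>

theorem theorem1:
  defines "Jf \<equiv> stereo ` julia (rat_map (1 / 10 ^ 9) 3)"
      and "Jg \<equiv> stereo ` julia (rat_map (1 / 10 ^ 20) 4)"
  shows "Jf homeomorphic (cantor_set \<times> sphere (0::complex) 1)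
       \<and> Jg homeomorphic (cantor_set \<times> sphere (0::complex) 1)
       \<and> \<not> (\<exists>h h'. homeomorphism Jf Jg h h' \<and> quasisymmetric Jf h)"
proof -
  interpret F: mcmullen "1 / 10 ^ 9" 3 "9 / 10 ^ 4" "5 / 4" "28 / 10 ^ 3" "115 / 10 ^ 4" "582 / 10 ^ 4" "2012 / 10 ^ 4" "6 / 10" "6 / 10"
    by (rule mcmullen_3)
  interpret G: mcmullen "1 / 10 ^ 20" 4 "9 / 10 ^ 6" "5 / 4" "28 / 10 ^ 4" "19 / 10 ^ 5" "21 / 10 ^ 6" "48 / 10 ^ 4" "51 / 10 ^ 2" "252 / 10 ^ 3"
    by (rule mcmullen_4)
  have Jf: "Jf = stereo ` julia (rat_map (complex_of_real (1 / 10 ^ 9)) 3)"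
    unfolding Jf_def by (simp only: of_real_divide of_real_1 of_real_power of_real_numeral)
  have Jg: "Jg = stereo ` julia (rat_map (complex_of_real (1 / 10 ^ 20)) 4)"
    unfolding Jg_def by (simp only: of_real_divide of_real_1 of_real_power of_real_numeral)
  \<comment> \<open>The powers (51/100) powr (7/4), about 0.308, and (252/1000) powr (7/4), about
    0.090, are rounded up so that 2 * 31/100 + 4 * 95/1000 = 1 exactly.\<close>
  define M :: "bool \<Rightarrow> real" where "M b = (if b then 31 / 100 else 95 / 1000)" for b
  \<comment> \<open>Rounded from the optimal weights, which are proportional to 2 powr (- 3/4) and 3
    powr (- 3/4).\<close>
  define m :: "bool \<Rightarrow> real" where "m b = (if b then 58 / 100 else 42 / 100)" for b
  have Mb: "G.ll b powr (7 / 4) \<le> M b" for b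
    using powr_divide_le[of "51 / 10 ^ 2" "31 / 100" 4 7] powr_divide_le[of "252 / 10 ^ 3" "95 / 1000" 4 7]
    unfolding G.ll_def M_def by (cases b) (simp_all add: power_divide)
  have p74: "0 < (7 / 4 :: real)" by simp
  have "(\<Sum>b\<in>UNIV. \<bar>of_int (G.dg b)\<bar> * M b) = 1" unfolding UNIV_bool G.dg_def M_def by simp
  from G.packing_bound[where 'i = "bool list \<times> nat", OF _ Mb this] p74
  obtain C where "\<forall>(I :: (bool list \<times> nat) set) y r. finite I \<longrightarrow> (\<forall>i\<in>I. y i \<in> Jg \<and> 0 < r i \<and> r i \<le> 2) \<longrightarrow>
    (\<forall>i\<in>I. \<forall>j\<in>I. i \<noteq> j \<longrightarrow> r i \<le> dist (y i) (y j)) \<longrightarrow> (\<Sum>i\<in>I. r i powr (7 / 4)) \<le> C"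
    unfolding Jg[symmetric] by blast
  then have C: "(\<Sum>i\<in>I. r i powr (7 / 4)) \<le> C"
    if "finite I" "\<And>i. i \<in> I \<Longrightarrow> y i \<in> Jg \<and> 0 < r i \<and> r i \<le> 2"
      "\<And>i j. i \<in> I \<Longrightarrow> j \<in> I \<Longrightarrow> i \<noteq> j \<Longrightarrow> r i \<le> dist (y i) (y j)"
    for I :: "(bool list \<times> nat) set" and y r
    using that by blast
  have diam: "dist y y' \<le> 2" if "y \<in> Jg" "y' \<in> Jg" for y y'
  proof -
    have "norm y = 1" "norm y' = 1" using that unfolding Jg G.julia_eq by auto
    then show ?thesis using norm_triangle_ineq4[of y y'] by (simp add: dist_norm)
  qed
  have m1: "0 < m b" "(\<Sum>b\<in>UNIV. m b) = 1" for b by (auto simp: m_def UNIV_bool)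
  \<comment> \<open>7/3 is the exponent conjugate to 7/4; these bounds give 2 * 0.285 + 3 * 0.134 =
    0.972 < 1.\<close>
  have "(58 / 100) powr (7 / 3) \<le> (285 / 1000 :: real)" "(42 / 100) powr (7 / 3) \<le> (134 / 1000 :: real)"
    using powr_divide_le[of "58 / 100" "285 / 1000" 3 7] powr_divide_le[of "42 / 100" "134 / 1000" 3 7]
    by (simp_all add: power_divide)
  then have mq: "(\<Sum>b\<in>UNIV. \<bar>of_int (F.dg b)\<bar> * m b powr (7 / 3)) < 1"
    unfolding UNIV_bool F.dg_def m_def by simp
  have "False" if "homeomorphism Jf Jg h h'" "quasisymmetric Jf h" for h h'
  proof (rule F.no_quasisymmetric[where p = "7 / 4" and q = "7 / 3" and m = m and B = 2 and C = C, OF _ _ _ m1 mq that[unfolded Jf] diam])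
    fix I :: "(bool list \<times> nat) set" and y r
    assume "finite I" "\<And>i. i \<in> I \<Longrightarrow> y i \<in> Jg \<and> 0 < r i \<and> r i \<le> 2"
      "\<And>i j. i \<in> I \<Longrightarrow> j \<in> I \<Longrightarrow> i \<noteq> j \<Longrightarrow> r i \<le> dist (y i) (y j)"
    then show "(\<Sum>i\<in>I. r i powr (7 / 4)) \<le> C" by (rule C[where y = y])
  qed simp_all
  then show ?thesis
    using F.julia_homeomorphic G.julia_homeomorphic unfolding Jf Jg by blast
qed

end
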